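(* Let $\gamma>0$, let $p\ge3$ be an integer, let $m_0,n_0\in\mathbb Z$ with $m_0\ne0$, and for $\iota\in\{1,2\}$ put $\lambda_\iota=(-1)^{\iota-1}$. Let $\mathcal P_1$ be a perturbation as described in the context. For each $\iota=1,2$ consider the perturbed KP equation $$u_t+u_{xxx}-\lambda_\iota\partial_x^{-1}u_{yy}+uu_x+\mathcal P_1[u]=0,\qquad (x,y)\in\mathbb T_\gamma^2.$$ There exist a constant $\rho>0$ and real-analytic functions $q^{(\iota)}(r),\omega_0^{(\iota)}(r)$ on $(0,\rho)$ such that for every $d^{(\iota)}\in\mathbb R$ and $r\in(0,\rho)$ these functions determine a periodic one-gap solution $u_0^{(\iota)}(t,x,y;r)$ of the unperturbed KP equation with $\lambda=\lambda_\iota$, where $$u_0^{(\iota)}(t,x,y;r)=\tilde u_0^{(\iota)}(\zeta_0;r)=\sum_{k\in\mathbb Z\setminus\{0\}}\hat{\tilde u}_0^{(\iota)}(k;r)e^{\frac{2\pi i}{\gamma}k\zeta_0},\qquad \zeta_0=\omega_0^{(\iota)}(r)t+m_0x+n_0y+d^{(\iota)},$$ $$\hat{\tilde u}_0^{(\iota)}(k;r)=\frac{48m_0^2\pi^2}{\gamma^2}(-1)^{|k|}\frac{|k|\,(q^{(\iota)}(r))^{|k|}}{1-(q^{(\iota)}(r))^{2|k|}},\qquad q^{(\iota)}(r)=r+O(r^3).$$ For sufficiently small $\rho'\in(0,\rho)$ and $r\in(0,\rho')$ there exists a real-analytic frequency $\omega^{(\iota)}(r)$ such that $u^{(\iota)}(t,x,y;r)$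 is a periodic traveling-wave solution of the perturbed equation, where $$u^{(\iota)}(t,x,y;r)=\tilde u^{(\iota)}(\zeta;r)=\sum_{k\in\mathbb Z\setminus\{0\}}\hat{\tilde u}^{(\iota)}(k;r)e^{\frac{2\pi i}{\gamma}k\zeta},\qquad\zeta=\omega^{(\iota)}(r)t+m_0x+n_0y+d^{(\iota)}.$$ Moreover, for some $\sigma>0$, $$\sum_{|k|\ne1}\big|\hat{\tilde u}^{(\iota)}(k;r)-\hat{\tilde u}_0^{(\iota)}(k;r)\big|^2e^{\frac{4\pi\sigma}{\gamma}|k|}\lesssim|r|^{2p},\qquad \hat{\tilde u}^{(\iota)}(\pm1;r)=\hat{\tilde u}_0^{(\iota)}(\pm1;r),$$ and $$\omega^{(\iota)}(r)-\omega_0^{(\iota)}(r)=\begin{cases}O(r^{p-1}),&p\text{ odd},\\ O(r^{p}),&p\text{ even}.\end{cases}$$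
   Context: $\mathbb T_\gamma=\mathbb R/\gamma\mathbb Z$; the (unperturbed) KP equation is $u_t+u_{xxx}-\lambda\partial_x^{-1}u_{yy}+uu_x=0$ on $\mathbb T_\gamma^2$ with zero $x$-mean ($\int_{\mathbb T_\gamma}u\,dx=0$ for a.e. $y$); $\lambda=1$ is KP-I, $\lambda=-1$ is KP-II. A one-gap solution is a genus-one finite-gap (theta-functional) solution $12\partial_x^2\log\theta$. Perturbation class: $\mathcal P_1[u]=\partial_xQ_1(J^2u)$ with $$Q_1(J^2u)=u^p+u^{p+1}+Q_{1,>p+1}(u,u_x,u_y,u_{xx},u_{xy},u_{yy}),$$ where $Q_1(J^2u)=\delta\mathcal H_{\rm pert}/\delta u$ is the variational gradient of a real-analytic Hamiltonian functional, all Taylor coefficients are real, $Q_{1,>p+1}(z_0,\dots,z_5)$ is real analytic on the polydisc $\{(z_0,\dots,z_5)\in\mathbb C^6:|(z_0,\dots,z_5)|_\infty<R_1\}$ for some $R_1>0$, its Taylor expansion at the origin vanishes to order at least $p+2$, and $$Q_{1,>p+1}(z_0,-z_1,-z_2,z_3,z_4,z_5)=Q_{1,>p+1}(z_0,z_1,z_2,z_3,z_4,z_5).$$ The variables $(z_0,\dots,z_5)$ correspond to $(u,u_x,u_y,u_{xx},u_{xy},u_{yy})$. $a\lesssim b$ means $a\le Cb$ with a constant $C$ (here independent of $r$); $f(r)=O(r^k)$ means $|f(r)|\le C|r|^k$ with $C$ independent of $r$. *)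

theory Defs
  imports "HOL-Analysis.Analysis"
begin

section \<open>Smooth functions and functions on the torus\<close>

primrec C_k :: "nat \<Rightarrow> ('a::euclidean_space \<Rightarrow> real) \<Rightarrow> bool" where
  "C_k 0 f \<longleftrightarrow> continuous_on UNIV f"
| "C_k (Suc k) f \<longleftrightarrow>
     (\<forall>x. f differentiable (at x)) \<and>
     (\<forall>b\<in>Basis. C_k k (\<lambda>x. frechet_derivative f (at x) b))"

definition smooth :: "('a::euclidean_space \<Rightarrow> real) \<Rightarrow> bool" where
  "smooth f \<longleftrightarrow> (\<forall>k. C_k k f)"

text \<open>A function on the torus is a doubly periodic function of \<open>z = (x, y)\<close>; a function of
  time and space is curried, \<open>u t (x, y)\<close>.\<close>

definition torus_periodic :: "real \<Rightarrow> (real \<times> real \<Rightarrow> real) \<Rightarrow> bool" where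
  "torus_periodic \<gamma> w \<longleftrightarrow> (\<forall>x y. w (x + \<gamma>, y) = w (x, y) \<and> w (x, y + \<gamma>) = w (x, y))"

definition zero_xmean :: "real \<Rightarrow> (real \<times> real \<Rightarrow> real) \<Rightarrow> bool" where
  "zero_xmean \<gamma> w \<longleftrightarrow> (\<forall>y. ((\<lambda>x. w (x, y)) has_integral 0) {0..\<gamma>})"

definition dx :: "(real \<times> real \<Rightarrow> real) \<Rightarrow> real \<times> real \<Rightarrow> real" where
  "dx w z = frechet_derivative w (at z) (1, 0)"

definition dy :: "(real \<times> real \<Rightarrow> real) \<Rightarrow> real \<times> real \<Rightarrow> real" where
  "dy w z = frechet_derivative w (at z) (0, 1)"

text \<open>The inverse of \<open>\<partial>\<^sub>x\<close> on periodic functions of zero \<open>x\<close>-mean: the unique periodic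
  antiderivative in \<open>x\<close> of zero \<open>x\<close>-mean. It is only meaningful if \<open>w\<close> itself has zero \<open>x\<close>-mean.\<close>

definition dx_inv :: "real \<Rightarrow> (real \<times> real \<Rightarrow> real) \<Rightarrow> real \<times> real \<Rightarrow> real" where
  "dx_inv \<gamma> w = (THE v. torus_periodic \<gamma> v \<and> zero_xmean \<gamma> v \<and>
     (\<forall>x y. ((\<lambda>s. v (s, y)) has_real_derivative w (x, y)) (at x)))"

section \<open>The KP equation\<close>

definition kp_solution ::
  "real \<Rightarrow> real \<Rightarrow> ((real \<times> real \<Rightarrow> real) \<Rightarrow> real \<times> real \<Rightarrow> real) \<Rightarrow>
     (real \<Rightarrow> real \<times> real \<Rightarrow> real) \<Rightarrow> bool" where
  "kp_solution \<gamma> lam P u \<longleftrightarrow>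
     smooth (\<lambda>(t, z). u t z) \<and>
     (\<forall>t. torus_periodic \<gamma> (u t) \<and> zero_xmean \<gamma> (u t)) \<and>
     (\<forall>t z. deriv (\<lambda>s. u s z) t + dx (dx (dx (u t))) z
              - lam * dx_inv \<gamma> (dy (dy (u t))) z + u t z * dx (u t) z + P (u t) z = 0)"

section \<open>One-gap solutions\<close>

definition theta :: "complex \<Rightarrow> complex \<Rightarrow> complex" where
  "theta s \<tau> = (\<Sum>\<^sub>\<infinity>n\<in>(UNIV :: int set).
     exp (of_real pi * \<i> * of_int n ^ 2 * \<tau> + 2 * of_real pi * \<i> * of_int n * s))"

text \<open>The genus-one theta-functional solutions \<open>12 \<partial>\<^sub>x\<^sup>2 log \<theta>\<close>, with \<open>\<theta>\<close> real and positive
  along the real phase, so that the logarithm is the real one.\<close>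

definition one_gap_solution ::
  "real \<Rightarrow> real \<Rightarrow> (real \<Rightarrow> real \<times> real \<Rightarrow> real) \<Rightarrow> bool" where
  "one_gap_solution \<gamma> lam u \<longleftrightarrow>
     kp_solution \<gamma> lam (\<lambda>_ _. 0) u \<and>
     (\<exists>\<tau> U V W D. Im \<tau> > 0 \<and> U \<noteq> 0 \<and>
        (\<forall>s::real. theta (of_real s) \<tau> \<in> \<real> \<and> Re (theta (of_real s) \<tau>) > 0) \<and>
        (\<forall>t z. u t z =
           12 * dx (dx (\<lambda>(x, y). ln (Re (theta (of_real (U * x + V * y + W * t + D)) \<tau>)))) z))"

definition one_gap_coeff :: "real \<Rightarrow> int \<Rightarrow> real \<Rightarrow> int \<Rightarrow> real" where
  "one_gap_coeff \<gamma> m0 q k =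
     48 * (of_int m0)\<^sup>2 * pi\<^sup>2 / \<gamma>\<^sup>2 * (-1) ^ nat \<bar>k\<bar> *
       (of_int \<bar>k\<bar> * q ^ nat \<bar>k\<bar> / (1 - q ^ (2 * nat \<bar>k\<bar>)))"

text \<open>\<open>f\<close> is the (unconditionally convergent) Fourier series with coefficients \<open>c k\<close>, \<open>k \<noteq> 0\<close>.\<close>

definition has_fourier_series :: "real \<Rightarrow> (real \<Rightarrow> real) \<Rightarrow> (int \<Rightarrow> complex) \<Rightarrow> bool" where
  "has_fourier_series \<gamma> f c \<longleftrightarrow>
     (\<forall>\<zeta>. ((\<lambda>k. c k * exp (2 * of_real pi * \<i> / of_real \<gamma> * of_int k * of_real \<zeta>))
             has_sum of_real (f \<zeta>)) (UNIV - {0}))"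

section \<open>Real analyticity\<close>

definition real_analytic_on :: "(real \<Rightarrow> real) \<Rightarrow> real set \<Rightarrow> bool" where
  "real_analytic_on f S \<longleftrightarrow>
     (\<forall>x\<in>S. \<exists>\<epsilon>>0. \<exists>a. \<forall>y. \<bar>y - x\<bar> < \<epsilon> \<longrightarrow> (\<lambda>n. a n * (y - x) ^ n) sums f y)"

text \<open>The arguments of a density depending on the 2-jet: \<open>D0\<close> stands for the variable
  \<open>z\<^sub>0\<close> (that is, \<open>u\<close>), \<open>Dx, \<dots>, Dyy\<close> for \<open>z\<^sub>1, \<dots>, z\<^sub>5\<close> (that is, \<open>u\<^sub>x, u\<^sub>y, u\<^sub>x\<^sub>x, u\<^sub>x\<^sub>y, u\<^sub>y\<^sub>y\<close>).\<close>

datatype jetvar = D0 | Dx | Dy | Dxx | Dxy | Dyy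

lemma UNIV_jetvar: "(UNIV :: jetvar set) = {D0, Dx, Dy, Dxx, Dxy, Dyy}"
  using jetvar.exhaust by blast

instance jetvar :: finite
  by standard (simp add: UNIV_jetvar)

definition polydisc :: "(jetvar \<Rightarrow> complex) \<Rightarrow> real \<Rightarrow> (jetvar \<Rightarrow> complex) set" where
  "polydisc c R = {z. \<forall>i. norm (z i - c i) < R}"

text \<open>\<open>Q\<close> is near \<open>c\<close> the sum of its Taylor series with coefficients \<open>a \<alpha>\<close>, \<open>\<alpha>\<close> a multi-index.\<close>

definition has_taylor ::
  "((jetvar \<Rightarrow> complex) \<Rightarrow> complex) \<Rightarrow> (jetvar \<Rightarrow> complex) \<Rightarrow> ((jetvar \<Rightarrow> nat) \<Rightarrow> complex) \<Rightarrow> bool" where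
  "has_taylor Q c a \<longleftrightarrow>
     (\<exists>\<epsilon>>0. \<forall>z\<in>polydisc c \<epsilon>. ((\<lambda>\<alpha>. a \<alpha> * (\<Prod>i\<in>UNIV. (z i - c i) ^ \<alpha> i)) has_sum Q z) UNIV)"

definition analytic_on_polydisc :: "((jetvar \<Rightarrow> complex) \<Rightarrow> complex) \<Rightarrow> real \<Rightarrow> bool" where
  "analytic_on_polydisc Q R \<longleftrightarrow> (\<forall>c\<in>polydisc (\<lambda>_. 0) R. \<exists>a. has_taylor Q c a)"

section \<open>The perturbation class\<close>

fun jet :: "(real \<times> real \<Rightarrow> real) \<Rightarrow> real \<times> real \<Rightarrow> jetvar \<Rightarrow> real" where
  "jet w z D0 = w z"
| "jet w z Dx = dx w z"
| "jet w z Dy = dy w z"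
| "jet w z Dxx = dx (dx w) z"
| "jet w z Dxy = dx (dy w) z"
| "jet w z Dyy = dy (dy w) z"

text \<open>\<open>Q\<close> is the remainder \<open>Q\<^sub>1\<^sub>,\<^sub>>\<^sub>p\<^sub>+\<^sub>1\<close>. Its Taylor coefficients at the origin being real, \<open>Q\<close> is real
  at real points of the polydisc, so \<open>Re\<close> merely changes the type.\<close>

definition Q1 ::
  "nat \<Rightarrow> ((jetvar \<Rightarrow> complex) \<Rightarrow> complex) \<Rightarrow> (real \<times> real \<Rightarrow> real) \<Rightarrow> real \<times> real \<Rightarrow> real" where
  "Q1 p Q w z = w z ^ p + w z ^ (p + 1) + Re (Q (\<lambda>i. of_real (jet w z i)))"

definition P1 ::
  "nat \<Rightarrow> ((jetvar \<Rightarrow> complex) \<Rightarrow> complex) \<Rightarrow> (real \<times> real \<Rightarrow> real) \<Rightarrow> real \<times> real \<Rightarrow> real" where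
  "P1 p Q w = dx (Q1 p Q w)"

definition torus_smooth :: "real \<Rightarrow> (real \<times> real \<Rightarrow> real) set" where
  "torus_smooth \<gamma> = {w. smooth w \<and> torus_periodic \<gamma> w}"

definition jet_in_polydisc :: "real \<Rightarrow> (real \<times> real \<Rightarrow> real) \<Rightarrow> bool" where
  "jet_in_polydisc R w \<longleftrightarrow> (\<forall>z i. \<bar>jet w z i\<bar> < R)"

definition C2_norm :: "(real \<times> real \<Rightarrow> real) \<Rightarrow> real" where
  "C2_norm w = (SUP (z, i)\<in>UNIV. \<bar>jet w z i\<bar>)"

text \<open>Real analyticity of a functional: near every point it is a convergent series of bounded
  homogeneous polynomials (with respect to the \<open>C\<^sup>2\<close>-norm). The \<open>n\<close>-linear form \<open>A n\<close> takes its
  arguments as \<open>v 0, \<dots>, v (n - 1)\<close>.\<close>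

definition bounded_multilinear_form ::
  "real \<Rightarrow> nat \<Rightarrow> real \<Rightarrow> ((nat \<Rightarrow> real \<times> real \<Rightarrow> real) \<Rightarrow> real) \<Rightarrow> bool" where
  "bounded_multilinear_form \<gamma> n B A \<longleftrightarrow>
     (\<forall>v v'. (\<forall>i<n. v i = v' i) \<longrightarrow> A v = A v') \<and>
     (\<forall>v i f g a b. (\<forall>j. v j \<in> torus_smooth \<gamma>) \<and> i < n \<and>
          f \<in> torus_smooth \<gamma> \<and> g \<in> torus_smooth \<gamma> \<longrightarrow>
        A (v(i := \<lambda>z. a * f z + b * g z)) = a * A (v(i := f)) + b * A (v(i := g))) \<and>
     (\<forall>v. (\<forall>j. v j \<in> torus_smooth \<gamma>) \<longrightarrow> \<bar>A v\<bar> \<le> B * (\<Prod>i<n. C2_norm (v i)))"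

definition analytic_functional ::
  "real \<Rightarrow> real \<Rightarrow> ((real \<times> real \<Rightarrow> real) \<Rightarrow> real) \<Rightarrow> bool" where
  "analytic_functional \<gamma> R H \<longleftrightarrow>
     (\<forall>w\<in>torus_smooth \<gamma>. jet_in_polydisc R w \<longrightarrow>
        (\<exists>\<epsilon>>0. \<exists>M A. (\<forall>n. bounded_multilinear_form \<gamma> n (M ^ Suc n) (A n)) \<and>
           (\<forall>v\<in>torus_smooth \<gamma>. C2_norm v < \<epsilon> \<longrightarrow>
              (\<lambda>n. A n (\<lambda>_. v)) sums H (\<lambda>z. w z + v z))))"

text \<open>\<open>G w\<close> is the \<open>L\<^sup>2\<close>-gradient \<open>\<delta>H/\<delta>u\<close> of \<open>H\<close> at \<open>w\<close>.\<close>

definition variational_gradient ::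
  "real \<Rightarrow> real \<Rightarrow> ((real \<times> real \<Rightarrow> real) \<Rightarrow> real) \<Rightarrow>
     ((real \<times> real \<Rightarrow> real) \<Rightarrow> real \<times> real \<Rightarrow> real) \<Rightarrow> bool" where
  "variational_gradient \<gamma> R H G \<longleftrightarrow>
     (\<forall>w\<in>torus_smooth \<gamma>. jet_in_polydisc R w \<longrightarrow>
        (\<forall>v\<in>torus_smooth \<gamma>.
           ((\<lambda>\<epsilon>. H (\<lambda>z. w z + \<epsilon> * v z)) has_real_derivative
              integral (cbox (0, 0) (\<gamma>, \<gamma>)) (\<lambda>z. G w z * v z)) (at 0)))"

definition admissible_perturbation ::
  "real \<Rightarrow> nat \<Rightarrow> real \<Rightarrow> ((jetvar \<Rightarrow> complex) \<Rightarrow> complex) \<Rightarrow> bool" where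
  "admissible_perturbation \<gamma> p R Q \<longleftrightarrow>
     R > 0 \<and>
     analytic_on_polydisc Q R \<and>
     (\<exists>a. has_taylor Q (\<lambda>_. 0) a \<and> (\<forall>\<alpha>. a \<alpha> \<in> \<real>) \<and>
          (\<forall>\<alpha>. (\<Sum>i\<in>UNIV. \<alpha> i) < p + 2 \<longrightarrow> a \<alpha> = 0)) \<and>
     (\<forall>z\<in>polydisc (\<lambda>_. 0) R. Q (z(Dx := - z Dx, Dy := - z Dy)) = Q z) \<and>
     (\<exists>H. analytic_functional \<gamma> R H \<and> variational_gradient \<gamma> R H (Q1 p Q))"

text \<open>Solutions of the perturbed equation have their 2-jet in the domain of \<open>Q\<close>.\<close>

definition perturbed_kp_solution ::
  "real \<Rightarrow> real \<Rightarrow> nat \<Rightarrow> real \<Rightarrow> ((jetvar \<Rightarrow> complex) \<Rightarrow> complex) \<Rightarrow>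
     (real \<Rightarrow> real \<times> real \<Rightarrow> real) \<Rightarrow> bool" where
  "perturbed_kp_solution \<gamma> lam p R Q u \<longleftrightarrow>
     (\<forall>t. jet_in_polydisc R (u t)) \<and> kp_solution \<gamma> lam (P1 p Q) u"

definition kp_sign :: "nat \<Rightarrow> real" where
  "kp_sign \<iota> = (-1) ^ (\<iota> - 1)"

definition travelling_wave ::
  "(real \<Rightarrow> real) \<Rightarrow> real \<Rightarrow> int \<Rightarrow> int \<Rightarrow> real \<Rightarrow> real \<Rightarrow> real \<times> real \<Rightarrow> real" where
  "travelling_wave f \<omega> m0 n0 d = (\<lambda>t (x, y). f (\<omega> * t + of_int m0 * x + of_int n0 * y + d))"

end

theory Submission
  imports Defs "HOL-Complex_Analysis.Complex_Analysis"
begin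

text \<open>
  A wave \<open>f (\<omega> t + m0 x + n0 y + d)\<close> meets the derivatives \<open>\<partial>\<^sub>x\<close> and \<open>\<partial>\<^sub>y\<close> only through
  \<open>m0 d/d\<zeta>\<close> and \<open>n0 d/d\<zeta>\<close>, so the nonlocal term of the equation only shifts the frequency by
  \<open>\<lambda> n0\<^sup>2 / m0\<close>. Put \<open>\<theta> = 2\<pi>/\<gamma>\<close>, \<open>\<mu> = m0\<^sup>3 \<theta>\<^sup>2\<close> and \<open>\<omega> = \<mu> + \<kappa> + \<lambda> n0\<^sup>2 / m0\<close>. After one
  integration KP-I and KP-II become the same equation for an even profile of mean zero:
  \<open>\<kappa> f + \<mu> (f + f''/\<theta>\<^sup>2) + m0 (f\<^sup>2/2 + Q\<^sub>1) = const\<close>. At \<open>\<kappa> = 0\<close> its linear part annihilates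
  the modes \<open>\<plusminus>1\<close>. These modes are prescribed (they are those of the one-gap profile); the modes
  \<open>\<plusminus>1\<close> of the equation then determine \<open>\<kappa>\<close>, and the modes \<open>|k| \<ge> 2\<close> determine the rest of \<open>f\<close>.

  Translation equivariance forces the \<open>k\<close>-th mode of a small solution to be \<open>r\<^sup>|\<^sup>k\<^sup>|\<close> times a power
  series in \<open>r\<^sup>2\<close>. In other words, \<open>f\<close> is a double power series in \<open>a = r e\<^sup>i\<^sup>\<theta>\<^sup>\<zeta>\<close> and
  \<open>b = r e\<^sup>-\<^sup>i\<^sup>\<theta>\<^sup>\<zeta>\<close>: the monomial \<open>a\<^sup>i b\<^sup>j\<close> belongs to the mode \<open>i - j\<close> and has order \<open>i + j\<close>
  in \<open>r\<close>. The amplitude \<open>r\<close> therefore need not be a parameter. The unknown is one element of the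
  Banach algebra of absolutely convergent double power series (after rescaling \<open>r\<close> by a small
  \<open>\<rho>\<close>), and the splitting above is a contraction there (\<open>fixed_point_exists\<close>,
  \<open>full_equation\<close>). Analyticity in \<open>r\<close> and the exponential decay of the Fourier coefficients are
  read off from membership in the algebra. The factors \<open>r\<^sup>p\<close> and \<open>r\<^sup>p\<^sup>-\<^sup>1\<close> are statements about
  the degrees of monomials, proved by induction along the degree filtration (\<open>comparison\<close>). The
  correction \<open>\<kappa>\<close> contains only the monomials \<open>(ab)\<^sup>n\<close>, hence is even in \<open>r\<close>; for even \<open>p\<close> this
  improves \<open>O(r\<^sup>p\<^sup>-\<^sup>1)\<close> to \<open>O(r\<^sup>p)\<close>.

  For the unperturbed equation the nome itself serves as amplitude, \<open>q(r) = r\<close>. The numbers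
  \<open>|k| q\<^sup>|\<^sup>k\<^sup>| / (1 - q\<^sup>2\<^sup>|\<^sup>k\<^sup>|)\<close> convolve with themselves to a quadratic polynomial in \<open>k\<close> times the
  same numbers (\<open>has_sum_lambert_convolution\<close>), which says exactly that the one-gap profile is the
  fixed point of the unperturbed map (\<open>cn_fixed_point\<close>). That this profile is
  \<open>12 \<partial>\<^sub>x\<^sup>2 log \<theta>\<close> follows from the first-order linear equation that the theta function satisfies
  with the corresponding Lambert series as coefficient (\<open>theta_recursion\<close>).
\<close>

section \<open>The algebra of absolutely convergent double power series\<close>

unbundle no vec_syntax
no_notation Infinite_Set_Sum.abs_summable_on (infix "abs'_summable'_on" 50)

definition below :: "nat \<times> nat \<Rightarrow> (nat \<times> nat) set" where
  "below s = {..fst s} \<times> {..snd s}"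

lemma finite_below [simp]: "finite (below s)"
  by (simp add: below_def)

text \<open>A pair of exponents \<open>(p, q)\<close> is determined by \<open>s = p + q\<close> and \<open>p\<close>, with \<open>p\<close> below \<open>s\<close>.
  Regrouping by \<open>s\<close> turns sums over pairs into sums of Cauchy products.\<close>
lemma has_sum_antidiagonals:
  fixes f :: "(nat \<times> nat) \<times> (nat \<times> nat) \<Rightarrow> 'a::banach"
  assumes "f summable_on UNIV"
  shows "((\<lambda>s. \<Sum>p\<in>below s. f (p, s - p)) has_sum infsum f UNIV) UNIV"
proof -
  have "bij_betw (\<lambda>(s, p). (p, s - p)) (Sigma UNIV below) UNIV"
    by (rule bij_betwI[where g = "\<lambda>(p, q). (p + q, p)"]) (auto simp: below_def)
  from has_sum_reindex_bij_betw[OF this, of f "infsum f UNIV"] assms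
  have "((\<lambda>(s, p). f (p, s - p)) has_sum infsum f UNIV) (Sigma UNIV below)"
    by (simp add: case_prod_unfold)
  then show ?thesis
    by (rule has_sum_SigmaD) (auto intro: has_sum_finite)
qed

lemma abs_summable_tensor:
  fixes x :: "'a \<Rightarrow> 'c::real_normed_field" and y :: "'b \<Rightarrow> 'c"
  assumes "x abs_summable_on UNIV" "y abs_summable_on UNIV"
  shows "(\<lambda>(p, q). x p * y q) abs_summable_on UNIV"
proof -
  have "(\<lambda>z. norm (x (fst z) * y (snd z))) summable_on (UNIV \<times> UNIV)"
  proof (rule summable_on_SigmaI)
    show "((\<lambda>q. norm (x (fst (p, q)) * y (snd (p, q)))) has_sum (norm (x p) * (\<Sum>\<^sub>\<infinity>q. norm (y q)))) UNIV" for p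
      unfolding norm_mult fst_conv snd_conv using assms(2) by (intro has_sum_cmult_right) auto
    show "(\<lambda>p. norm (x p) * (\<Sum>\<^sub>\<infinity>q. norm (y q))) summable_on UNIV"
      using assms(1) by (intro summable_on_cmult_left) auto
  qed auto
  then show ?thesis by (simp add: case_prod_unfold)
qed

lemma abs_summable_convolution:
  fixes x y :: "nat \<times> nat \<Rightarrow> real"
  assumes "x abs_summable_on UNIV" "y abs_summable_on UNIV"
  shows "(\<lambda>s. \<Sum>p\<in>below s. x p * y (s - p)) abs_summable_on UNIV"
    and "(\<Sum>\<^sub>\<infinity>s. \<bar>\<Sum>p\<in>below s. x p * y (s - p)\<bar>) \<le> (\<Sum>\<^sub>\<infinity>p. \<bar>x p\<bar>) * (\<Sum>\<^sub>\<infinity>q. \<bar>y q\<bar>)"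
proof -
  let ?f = "\<lambda>(p, q). \<bar>x p\<bar> * \<bar>y q\<bar>"
  have *: "?f summable_on UNIV"
    using abs_summable_tensor[OF assms] by (simp add: case_prod_unfold abs_mult)
  have eq: "infsum ?f UNIV = (\<Sum>\<^sub>\<infinity>p. \<bar>x p\<bar>) * (\<Sum>\<^sub>\<infinity>q. \<bar>y q\<bar>)"
    using infsum_Sigma'_banach[of "\<lambda>p q. \<bar>x p\<bar> * \<bar>y q\<bar>" UNIV "\<lambda>_. UNIV"] *
    by (simp add: infsum_cmult_right' infsum_cmult_left')
  have hs: "((\<lambda>s. \<Sum>p\<in>below s. \<bar>x p\<bar> * \<bar>y (s - p)\<bar>) has_sum infsum ?f UNIV) UNIV"
    using has_sum_antidiagonals[OF *] by simp
  have le: "\<bar>\<Sum>p\<in>below s. x p * y (s - p)\<bar> \<le> (\<Sum>p\<in>below s. \<bar>x p\<bar> * \<bar>y (s - p)\<bar>)" for s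
    by (rule order_trans[OF sum_abs]) (simp add: abs_mult)
  show s: "(\<lambda>s. \<Sum>p\<in>below s. x p * y (s - p)) abs_summable_on UNIV"
    by (rule Infinite_Sum.abs_summable_on_comparison_test'[OF has_sum_imp_summable[OF hs]]) (simp add: le)
  show "(\<Sum>\<^sub>\<infinity>s. \<bar>\<Sum>p\<in>below s. x p * y (s - p)\<bar>) \<le> (\<Sum>\<^sub>\<infinity>p. \<bar>x p\<bar>) * (\<Sum>\<^sub>\<infinity>q. \<bar>y q\<bar>)"
    unfolding eq[symmetric] infsumI[OF hs, symmetric]
    by (rule infsum_mono) (use s le has_sum_imp_summable[OF hs] in auto)
qed

text \<open>Iterated formal power series already form a commutative ring; the subtype inherits the ring
  axioms, and only the closure under products and the norm are analytic.\<close>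
typedef wiener = "{X :: real fps fps. (\<lambda>(i, j). X $ i $ j) abs_summable_on UNIV}"
  by (rule exI[of _ 0]) (simp add: case_prod_unfold)

setup_lifting type_definition_wiener

lift_definition coef :: "wiener \<Rightarrow> nat \<times> nat \<Rightarrow> real" is "\<lambda>X (i, j). X $ i $ j" .

lemma coef_summable: "coef X abs_summable_on UNIV"
  by transfer simp

lemma coef_summable' [simp]: "(\<lambda>p. \<bar>coef X p\<bar>) summable_on UNIV"
  using coef_summable[of X] by simp

lemma wiener_eqI: "(\<And>p. coef X p = coef Y p) \<Longrightarrow> X = Y"
  by transfer (force simp: fps_eq_iff)

text \<open>Meaningful for summable coefficients only, see \<open>coef_of_coef\<close>.\<close>
definition of_coef :: "(nat \<times> nat \<Rightarrow> real) \<Rightarrow> wiener" where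
  "of_coef c = Abs_wiener (Abs_fps (\<lambda>i. Abs_fps (\<lambda>j. c (i, j))))"

lemma coef_of_coef:
  assumes "c abs_summable_on UNIV"
  shows "coef (of_coef c) = c"
  using assms unfolding of_coef_def coef.rep_eq
  by (subst Abs_wiener_inverse) (auto simp: fun_eq_iff case_prod_unfold)

lemma fps_fps_mult_nth:
  fixes X Y :: "real fps fps"
  shows "(X * Y) $ i $ j = (\<Sum>p\<in>below (i, j). (case p of (k, l) \<Rightarrow> X $ k $ l) * (case (i, j) - p of (k, l) \<Rightarrow> Y $ k $ l))"
  by (simp add: fps_mult_nth fps_sum_nth below_def sum.cartesian_product atLeast0AtMost case_prod_unfold)

instantiation wiener :: comm_ring_1
begin
lift_definition zero_wiener :: wiener is 0 by (simp add: case_prod_unfold)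
lift_definition one_wiener :: wiener is 1
  by (rule Infinite_Sum.abs_summable_on_comparison_test'[where g = "\<lambda>p. if p = (0,0) then 1 else 0"])
     (auto intro: finite_nonzero_values_imp_summable_on split: if_splits)
lift_definition plus_wiener :: "wiener \<Rightarrow> wiener \<Rightarrow> wiener" is "(+)"
proof -
  fix X Y :: "real fps fps"
  assume a: "(\<lambda>(i, j). X $ i $ j) abs_summable_on UNIV" "(\<lambda>(i, j). Y $ i $ j) abs_summable_on UNIV"
  show "(\<lambda>(i, j). (X + Y) $ i $ j) abs_summable_on UNIV"
    by (rule Infinite_Sum.abs_summable_on_comparison_test'[OF summable_on_add[OF a]]) (auto simp: abs_triangle_ineq)
qed
lift_definition uminus_wiener :: "wiener \<Rightarrow> wiener" is "uminus"
  by (simp add: case_prod_unfold)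
lift_definition minus_wiener :: "wiener \<Rightarrow> wiener \<Rightarrow> wiener" is "(-)"
proof -
  fix X Y :: "real fps fps"
  assume a: "(\<lambda>(i, j). X $ i $ j) abs_summable_on UNIV" "(\<lambda>(i, j). Y $ i $ j) abs_summable_on UNIV"
  show "(\<lambda>(i, j). (X - Y) $ i $ j) abs_summable_on UNIV"
    by (rule Infinite_Sum.abs_summable_on_comparison_test'[OF summable_on_add[OF a]]) (auto simp: abs_triangle_ineq4)
qed
lift_definition times_wiener :: "wiener \<Rightarrow> wiener \<Rightarrow> wiener" is "(*)"
proof -
  fix X Y :: "real fps fps"
  assume a: "(\<lambda>(i, j). X $ i $ j) abs_summable_on UNIV" "(\<lambda>(i, j). Y $ i $ j) abs_summable_on UNIV"
  from abs_summable_convolution(1)[OF this]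
  show "(\<lambda>(i, j). (X * Y) $ i $ j) abs_summable_on UNIV"
    by (rule back_subst[where P = "\<lambda>f. f abs_summable_on UNIV"]) (auto simp: fun_eq_iff fps_fps_mult_nth)
qed
instance
  by standard (transfer; simp add: algebra_simps; fail)+
end

lemma coef_simps [simp]:
  "coef 0 p = 0" "coef 1 p = (if p = 0 then 1 else 0)"
  "coef (X + Y) p = coef X p + coef Y p" "coef (X - Y) p = coef X p - coef Y p" "coef (- X) p = - coef X p"
  by (transfer; force simp: case_prod_unfold zero_prod_def)+

lemma coef_mult: "coef (X * Y) s = (\<Sum>p\<in>below s. coef X p * coef Y (s - p))"
  by transfer (auto simp: fps_fps_mult_nth)

instantiation wiener :: real_vector
begin
lift_definition scaleR_wiener :: "real \<Rightarrow> wiener \<Rightarrow> wiener" is "\<lambda>c X. fps_const (fps_const c) * X"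
  by (auto simp: case_prod_unfold abs_mult intro!: summable_on_cmult_right)
instance
  by standard (transfer; simp add: algebra_simps flip: fps_const_add fps_const_mult; fail)+
end

lemma coef_scaleR [simp]: "coef (c *\<^sub>R X) p = c * coef X p"
  by transfer (simp add: case_prod_unfold)

instantiation wiener :: real_normed_vector
begin
definition norm_wiener :: "wiener \<Rightarrow> real" where "norm_wiener X = (\<Sum>\<^sub>\<infinity>p. \<bar>coef X p\<bar>)"
definition dist_wiener :: "wiener \<Rightarrow> wiener \<Rightarrow> real" where "dist_wiener x y = norm (x - y)"
definition sgn_wiener :: "wiener \<Rightarrow> wiener" where "sgn_wiener x = x /\<^sub>R norm x"
definition uniformity_wiener :: "(wiener \<times> wiener) filter" where
  "uniformity_wiener = (INF e\<in>{0 <..}. principal {(x, y). dist x y < e})"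
definition open_wiener :: "wiener set \<Rightarrow> bool" where
  "open_wiener U \<longleftrightarrow> (\<forall>x\<in>U. eventually (\<lambda>(x', y). x' = x \<longrightarrow> y \<in> U) uniformity)"

instance
proof
  fix a :: real and x y :: wiener
  show "norm x = 0 \<longleftrightarrow> x = 0"
  proof
    assume "norm x = 0"
    then have "\<bar>coef x p\<bar> = 0" for p
      unfolding norm_wiener_def by (intro nonneg_infsum_le_0D[where A = UNIV]) auto
    then show "x = 0" by (intro wiener_eqI) simp
  qed (simp add: norm_wiener_def)
  show "norm (x + y) \<le> norm x + norm y"
    unfolding norm_wiener_def infsum_add[OF coef_summable' coef_summable', symmetric]
    by (rule infsum_mono[OF coef_summable' summable_on_add[OF coef_summable' coef_summable']]) (simp add: abs_triangle_ineq)
  show "norm (a *\<^sub>R x) = \<bar>a\<bar> * norm x"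
    by (simp add: norm_wiener_def abs_mult infsum_cmult_right')
qed (simp_all add: dist_wiener_def sgn_wiener_def uniformity_wiener_def open_wiener_def)
end

instance wiener :: real_normed_algebra_1
proof
  fix a :: real and x y :: wiener
  show "a *\<^sub>R x * y = a *\<^sub>R (x * y)" "x * a *\<^sub>R y = a *\<^sub>R (x * y)"
    by (auto intro!: wiener_eqI simp: coef_mult sum_distrib_left mult.assoc mult.left_commute)
  show "norm (x * y) \<le> norm x * norm y"
    using abs_summable_convolution(2)[OF coef_summable coef_summable, of x y] by (simp add: norm_wiener_def coef_mult)
  have "norm (1::wiener) = (\<Sum>\<^sub>\<infinity>p\<in>{0::nat\<times>nat}. 1)"
    unfolding norm_wiener_def by (rule infsum_cong_neutral) auto
  then show "norm (1::wiener) = 1" by simp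
qed

lemma abs_coef_le_norm: "\<bar>coef X p\<bar> \<le> norm X"
  using finite_sum_le_infsum[of "\<lambda>p. \<bar>coef X p\<bar>" UNIV "{p}"] by (simp add: norm_wiener_def)

lemma sum_abs_coef_le_norm: "finite F \<Longrightarrow> (\<Sum>p\<in>F. \<bar>coef X p\<bar>) \<le> norm X"
  unfolding norm_wiener_def by (rule finite_sum_le_infsum) auto

lemma norm_wiener_leI:
  assumes "\<And>F. finite F \<Longrightarrow> (\<Sum>p\<in>F. \<bar>coef X p\<bar>) \<le> B"
  shows "norm X \<le> B"
  unfolding norm_wiener_def by (rule infsum_le_finite_sums) (use assms in auto)

instance wiener :: banach
proof
  fix X :: "nat \<Rightarrow> wiener" assume C: "Cauchy X"
  have "Cauchy (\<lambda>n. coef (X n) p)" for p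
  proof (rule metric_CauchyI)
    fix e :: real assume "e > 0"
    then obtain M where "\<And>m n. m \<ge> M \<Longrightarrow> n \<ge> M \<Longrightarrow> norm (X m - X n) < e"
      using C unfolding Cauchy_def dist_norm by blast
    then have "\<forall>m\<ge>M. \<forall>n\<ge>M. dist (coef (X m) p) (coef (X n) p) < e"
      using abs_coef_le_norm[of "X _ - X _" p] by (auto simp: dist_norm intro!: le_less_trans[OF abs_coef_le_norm[of "X _ - X _" p, unfolded coef_simps]])
    then show "\<exists>M. \<forall>m\<ge>M. \<forall>n\<ge>M. dist (coef (X m) p) (coef (X n) p) < e" by blast
  qed
  then obtain x where x: "\<And>p. (\<lambda>n. coef (X n) p) \<longlonglongrightarrow> x p"
    unfolding Cauchy_convergent_iff convergent_def by metis
  have key: "\<exists>M. \<forall>n\<ge>M. \<forall>F. finite F \<longrightarrow> (\<Sum>p\<in>F. \<bar>x p - coef (X n) p\<bar>) \<le> e" if "e > 0" for e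
  proof -
    obtain M where M: "\<And>m n. m \<ge> M \<Longrightarrow> n \<ge> M \<Longrightarrow> norm (X m - X n) < e"
      using C \<open>e > 0\<close> unfolding Cauchy_def dist_norm by blast
    have "(\<Sum>p\<in>F. \<bar>x p - coef (X n) p\<bar>) \<le> e" if "n \<ge> M" "finite F" for n F
    proof (rule tendsto_upperbound)
      show "(\<lambda>m. \<Sum>p\<in>F. \<bar>coef (X m) p - coef (X n) p\<bar>) \<longlonglongrightarrow> (\<Sum>p\<in>F. \<bar>x p - coef (X n) p\<bar>)"
        by (intro tendsto_intros x)
      show "\<forall>\<^sub>F m in sequentially. (\<Sum>p\<in>F. \<bar>coef (X m) p - coef (X n) p\<bar>) \<le> e"
        using eventually_ge_at_top[of M]
      proof eventually_elim
        case (elim m)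
        with sum_abs_coef_le_norm[OF that(2), of "X m - X n"] M[OF elim that(1)] show ?case by simp
      qed
    qed simp
    then show ?thesis by blast
  qed
  obtain M where M: "\<And>F. finite F \<Longrightarrow> (\<Sum>p\<in>F. \<bar>x p - coef (X M) p\<bar>) \<le> 1"
    using key[of 1] by auto
  have "(\<lambda>p. x p - coef (X M) p) abs_summable_on UNIV"
    unfolding abs_summable_iff_bdd_above using M by (auto simp: bdd_above_def)
  from Infinite_Sum.abs_summable_on_comparison_test'[OF summable_on_add[OF this coef_summable[of "X M"]], of x]
  have sx: "x abs_summable_on UNIV" by fastforce
  have "X \<longlonglongrightarrow> of_coef x"
  proof (rule metric_LIMSEQ_I)
    fix e :: real assume "e > 0"
    then obtain M where M: "\<And>n F. n \<ge> M \<Longrightarrow> finite F \<Longrightarrow> (\<Sum>p\<in>F. \<bar>x p - coef (X n) p\<bar>) \<le> e / 2"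
      using key[of "e/2"] by auto
    have "norm (of_coef x - X n) \<le> e / 2" if "n \<ge> M" for n
      by (rule norm_wiener_leI) (use M that in \<open>simp add: coef_of_coef[OF sx]\<close>)
    then show "\<exists>no. \<forall>n\<ge>no. dist (X n) (of_coef x) < e"
      using \<open>e > 0\<close> by (intro exI[of _ M]) (fastforce simp: dist_norm norm_minus_commute)
  qed
  then show "convergent X" by (auto simp: convergent_def)
qed

section \<open>Multipliers, reflection and degree\<close>

lemma has_sum_fibres:
  fixes f :: "'a \<Rightarrow> 'b::{topological_comm_monoid_add, t3_space}"
  assumes "(f has_sum S) A" "\<And>l. (f has_sum g l) {z \<in> A. d z = l}"
  shows "(g has_sum S) UNIV"
proof -
  have "bij_betw snd (Sigma UNIV (\<lambda>l. {z \<in> A. d z = l})) A"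
    by (rule bij_betwI[where g = "\<lambda>z. (d z, z)"]) auto
  from has_sum_reindex_bij_betw[OF this, of f S] assms(1)
  have "((\<lambda>z. f (snd z)) has_sum S) (Sigma UNIV (\<lambda>l. {z \<in> A. d z = l}))" by simp
  then show ?thesis by (rule has_sum_SigmaD) (use assms(2) in auto)
qed

lemma abs_summable_geometric:
  fixes c :: "nat \<times> nat \<Rightarrow> real"
  assumes "\<And>i j. \<bar>c (i, j)\<bar> \<le> C * (1/2) ^ (i + j)"
  shows "c abs_summable_on UNIV" "(\<Sum>\<^sub>\<infinity>p. \<bar>c p\<bar>) \<le> 4 * C"
proof -
  have g: "((\<lambda>i. (1/2::real) ^ i) has_sum 2) UNIV"
    by (rule sums_nonneg_imp_has_sum) (use geometric_sums[of "1/2::real"] in auto)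
  have "((\<lambda>p. C * (1/2::real) ^ fst p * (1/2) ^ snd p) has_sum (4 * C)) (UNIV \<times> UNIV)"
  proof (rule has_sum_SigmaI)
    show "((\<lambda>j. C * (1/2::real) ^ fst (i, j) * (1/2) ^ snd (i, j)) has_sum C * (1/2) ^ i * 2) UNIV" for i :: nat
      using g by (auto intro!: has_sum_cmult_right)
    show "((\<lambda>i. C * (1/2) ^ i * 2) has_sum (4 * C)) UNIV"
      using has_sum_cmult_right[OF g, of "2 * C"] by (simp add: mult_ac)
    have "C \<ge> 0" using assms[of 0 0] by simp
    then show "(\<lambda>p. C * (1/2::real) ^ fst p * (1/2) ^ snd p) summable_on UNIV \<times> UNIV"
      by (intro summable_on_SigmaI[where g = "\<lambda>i. C * (1/2) ^ i * 2"] has_sum_imp_summable[OF \<open>((\<lambda>i. C * (1/2) ^ i * 2) has_sum (4 * C)) UNIV\<close>])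
         (use g in \<open>auto intro!: has_sum_cmult_right\<close>)
  qed
  then have h: "((\<lambda>p. C * (1/2::real) ^ (fst p + snd p)) has_sum (4 * C)) UNIV"
    by (simp add: power_add mult_ac)
  have le: "\<bar>c p\<bar> \<le> C * (1/2) ^ (fst p + snd p)" for p
    using assms[of "fst p" "snd p"] by simp
  show s: "c abs_summable_on UNIV"
    by (rule Infinite_Sum.abs_summable_on_comparison_test'[OF has_sum_imp_summable[OF h]]) (simp add: le)
  show "(\<Sum>\<^sub>\<infinity>p. \<bar>c p\<bar>) \<le> 4 * C"
    using infsum_mono[OF _ has_sum_imp_summable[OF h] le] s infsumI[OF h] by simp
qed

text \<open>All linear operators below relabel the exponents injectively and multiply the coefficients by
  a bounded weight; one estimate serves them all.\<close>
definition reweight :: "(nat \<times> nat \<Rightarrow> real) \<Rightarrow> (nat \<times> nat \<Rightarrow> nat \<times> nat) \<Rightarrow> wiener \<Rightarrow> wiener" where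
  "reweight g h X = of_coef (\<lambda>p. g p * coef X (h p))"

lemma reweight:
  assumes "inj h" "\<And>p. \<bar>g p\<bar> \<le> B"
  shows coef_reweight: "coef (reweight g h X) p = g p * coef X (h p)"
    and norm_reweight: "norm (reweight g h X) \<le> B * norm X"
    and bounded_linear_reweight: "bounded_linear (reweight g h)"
proof -
  have sh: "(\<lambda>p. \<bar>coef X (h p)\<bar>) summable_on UNIV" for X
  proof -
    have "(\<lambda>p. \<bar>coef X p\<bar>) summable_on range h" by (rule summable_on_subset_banach[OF coef_summable']) auto
    then show ?thesis using summable_on_reindex[OF assms(1), of "\<lambda>p. \<bar>coef X p\<bar>"] by (simp add: o_def)
  qed
  have le: "\<bar>g p * coef X (h p)\<bar> \<le> B * \<bar>coef X (h p)\<bar>" for X p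
    using assms(2)[of p] by (simp add: abs_mult mult_right_mono)
  have s: "(\<lambda>p. g p * coef X (h p)) abs_summable_on UNIV" for X
    by (rule Infinite_Sum.abs_summable_on_comparison_test'[OF summable_on_cmult_right[OF sh, of B]])
       (use le in auto)
  have c: "coef (reweight g h X) p = g p * coef X (h p)" for X p
    unfolding reweight_def by (simp add: coef_of_coef[OF s])
  then show "coef (reweight g h X) p = g p * coef X (h p)" .
  have B: "B \<ge> 0" using assms(2)[of "(0,0)"] by linarith
  have n: "norm (reweight g h X) \<le> B * norm X" for X
  proof (rule norm_wiener_leI)
    fix F :: "(nat \<times> nat) set" assume F: "finite F"
    have "(\<Sum>p\<in>F. \<bar>coef (reweight g h X) p\<bar>) \<le> (\<Sum>p\<in>F. B * \<bar>coef X (h p)\<bar>)"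
      by (rule sum_mono) (simp add: c le)
    also have "\<dots> = B * (\<Sum>q\<in>h ` F. \<bar>coef X q\<bar>)"
      using assms(1) by (subst sum.reindex) (auto simp: sum_distrib_left inj_on_def)
    also have "\<dots> \<le> B * norm X"
      by (rule mult_left_mono[OF sum_abs_coef_le_norm B]) (use F in auto)
    finally show "(\<Sum>p\<in>F. \<bar>coef (reweight g h X) p\<bar>) \<le> B * norm X" .
  qed
  then show "norm (reweight g h X) \<le> B * norm X" .
  show "bounded_linear (reweight g h)"
    by (rule bounded_linear_intro[where K = B])
       (use n in \<open>auto intro!: wiener_eqI simp: c algebra_simps\<close>)
qed

text \<open>The Fourier multiplier with symbol \<open>\<phi>\<close>: the monomial \<open>a\<^sup>i b\<^sup>j\<close> oscillates like
  \<open>e\<^sup>i\<^sup>k\<^sup>\<theta>\<^sup>\<zeta>\<close> with \<open>k = i - j\<close>.\<close>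
definition multiplier :: "(int \<Rightarrow> real) \<Rightarrow> wiener \<Rightarrow> wiener" where
  "multiplier \<phi> = reweight (\<lambda>(i, j). \<phi> (int i - int j)) id"

text \<open>The reflection \<open>\<zeta> \<mapsto> -\<zeta>\<close>, which exchanges \<open>a\<close> and \<open>b\<close>.\<close>
definition swapw :: "wiener \<Rightarrow> wiener" where "swapw = reweight (\<lambda>_. 1) prod.swap"

text \<open>The first mode divided by \<open>a\<close>. Every monomial of mode 1 contains the factor \<open>a\<close>, so this
  division loses nothing; it is what makes the equation for \<open>\<kappa>\<close> solvable for small \<open>r\<close>.\<close>
definition tau :: "wiener \<Rightarrow> wiener" where
  "tau = reweight (\<lambda>(i, j). if i = j then 1 else 0) (\<lambda>(i, j). (Suc i, j))"

definition multiplier_bound :: "real \<Rightarrow> (int \<Rightarrow> real) \<Rightarrow> bool" where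
  "multiplier_bound B \<phi> \<longleftrightarrow> (\<forall>k. \<bar>\<phi> k\<bar> \<le> B)"

lemma
  assumes "multiplier_bound B \<phi>"
  shows coef_multiplier: "coef (multiplier \<phi> X) (i, j) = \<phi> (int i - int j) * coef X (i, j)"
    and norm_multiplier: "norm (multiplier \<phi> X) \<le> B * norm X"
    and bounded_linear_multiplier: "bounded_linear (multiplier \<phi>)"
  unfolding multiplier_def using assms unfolding multiplier_bound_def
  by (auto simp: coef_reweight[where B = B] split: prod.splits intro!: norm_reweight bounded_linear_reweight[where B = B])

lemma coef_swapw [simp]: "coef (swapw X) p = coef X (prod.swap p)"
  and bounded_linear_swapw: "bounded_linear swapw"
  unfolding swapw_def by (auto simp: coef_reweight[where B = 1] intro!: bounded_linear_reweight[where B = 1])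

lemma inj_shift: "inj (\<lambda>(i, j). (Suc i, j :: nat))"
  by (auto simp: inj_def)

lemma coef_tau [simp]: "coef (tau X) (i, j) = (if i = j then coef X (Suc i, j) else 0)"
  and norm_tau: "norm (tau X) \<le> norm X"
proof -
  have b: "\<bar>(\<lambda>(i, j). if i = j then 1 else 0 :: real) p\<bar> \<le> 1" for p :: "nat \<times> nat"
    by (cases p) auto
  show "coef (tau X) (i, j) = (if i = j then coef X (Suc i, j) else 0)"
    unfolding tau_def coef_reweight[OF inj_shift b] by simp
  show "norm (tau X) \<le> norm X"
    unfolding tau_def using norm_reweight[OF inj_shift b] by auto
qed

lemma swapw_mult: "swapw (X * Y) = swapw X * swapw Y"
proof (rule wiener_eqI)
  fix s :: "nat \<times> nat"
  show "coef (swapw (X * Y)) s = coef (swapw X * swapw Y) s"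
    unfolding coef_swapw coef_mult
    by (rule sum.reindex_bij_witness[where i = prod.swap and j = prod.swap]) (cases s; auto simp: below_def)+
qed

lemma swapw_one [simp]: "swapw 1 = 1"
  by (rule wiener_eqI) (auto simp: zero_prod_def)

text \<open>The power series in \<open>ab = r\<^sup>2\<close>, that is, the elements independent of \<open>\<zeta>\<close>.\<close>
definition diag :: "wiener \<Rightarrow> bool" where
  "diag K \<longleftrightarrow> (\<forall>i j. i \<noteq> j \<longrightarrow> coef K (i, j) = 0)"

lemma coef_diag_mult:
  assumes "diag K"
  shows "coef (K * X) (i, j) = (\<Sum>n\<le>min i j. coef K (n, n) * coef X (i - n, j - n))"
  unfolding coef_mult
proof (rule sum.mono_neutral_cong_right[THEN trans])
  show "(\<lambda>n. (n, n)) ` {..min i j} \<subseteq> below (i, j)" by (auto simp: below_def)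
  show "\<forall>p\<in>below (i, j) - (\<lambda>n. (n, n)) ` {..min i j}. coef K p * coef X ((i, j) - p) = 0"
  proof
    fix p assume p: "p \<in> below (i, j) - (\<lambda>n. (n, n)) ` {..min i j}"
    obtain k l where [simp]: "p = (k, l)" by (cases p)
    have "k \<noteq> l" using p by (auto simp: below_def image_iff)
    then show "coef K p * coef X ((i, j) - p) = 0" using assms by (simp add: diag_def)
  qed
  show "(\<Sum>p\<in>(\<lambda>n. (n, n)) ` {..min i j}. coef K p * coef X ((i, j) - p)) = (\<Sum>n\<le>min i j. coef K (n, n) * coef X (i - n, j - n))"
    by (subst sum.reindex) (auto simp: inj_on_def)
qed auto

lemma diag_mult: "diag K \<Longrightarrow> diag L \<Longrightarrow> diag (K * L)"
  unfolding diag_def[of "K * L"] by (auto simp: coef_diag_mult diag_def[of L] intro!: sum.neutral)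

lemma diag_tau: "diag (tau X)"
  by (simp add: diag_def)

text \<open>Elements independent of \<open>\<zeta>\<close> are constants for the Fourier decomposition.\<close>
lemma tau_diag_mult:
  assumes "diag K"
  shows "tau (K * X) = K * tau X"
proof (rule wiener_eqI)
  fix p :: "nat \<times> nat"
  show "coef (tau (K * X)) p = coef (K * tau X) p"
    by (cases p) (auto simp: coef_diag_mult[OF assms(1)] Suc_diff_le min_def diff_right_commute intro!: sum.cong sum.neutral sum.neutral[symmetric])
qed

lemma diag_swapw: "diag K \<Longrightarrow> swapw K = K"
  by (rule wiener_eqI) (clarsimp simp: diag_def, metis)

text \<open>Order at least \<open>n\<close> in \<open>r\<close>.\<close>
definition ord_ge :: "nat \<Rightarrow> wiener \<Rightarrow> bool" where
  "ord_ge n X \<longleftrightarrow> (\<forall>i j. i + j < n \<longrightarrow> coef X (i, j) = 0)"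

lemma ord_ge_0 [simp]: "ord_ge 0 X" by (simp add: ord_ge_def)
lemma ord_ge_zero [simp]: "ord_ge n 0" by (simp add: ord_ge_def)
lemma ord_ge_mono: "ord_ge n X \<Longrightarrow> m \<le> n \<Longrightarrow> ord_ge m X" by (auto simp: ord_ge_def)
lemma ord_ge_add: "ord_ge n X \<Longrightarrow> ord_ge n Y \<Longrightarrow> ord_ge n (X + Y)" by (auto simp: ord_ge_def)
lemma ord_ge_diff: "ord_ge n X \<Longrightarrow> ord_ge n Y \<Longrightarrow> ord_ge n (X - Y)" by (auto simp: ord_ge_def)
lemma ord_ge_scaleR: "ord_ge n X \<Longrightarrow> ord_ge n (c *\<^sub>R X)" by (auto simp: ord_ge_def)
lemma ord_ge_mult: "ord_ge m X \<Longrightarrow> ord_ge n Y \<Longrightarrow> ord_ge (m + n) (X * Y)"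
  unfolding ord_ge_def coef_mult
proof (intro allI impI sum.neutral ballI)
  fix i j p
  assume a: "\<forall>i j. i + j < m \<longrightarrow> coef X (i, j) = 0" "\<forall>i j. i + j < n \<longrightarrow> coef Y (i, j) = 0"
    and lt: "i + j < m + n" and p: "p \<in> below (i, j)"
  obtain k l where [simp]: "p = (k, l)" by (cases p)
  have "k + l < m \<or> (i - k) + (j - l) < n" using lt p by (auto simp: below_def)
  then show "coef X p * coef Y ((i, j) - p) = 0" using a by auto
qed
lemma ord_ge_multiplier:
  assumes "multiplier_bound B \<phi>" "ord_ge n X"
  shows "ord_ge n (multiplier \<phi> X)"
  using assms(2) by (auto simp: ord_ge_def coef_multiplier[OF assms(1)])
lemma ord_ge_tau: "ord_ge (Suc n) X \<Longrightarrow> ord_ge n (tau X)"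
  by (auto simp: ord_ge_def)

lemma bounded_linear_coef: "bounded_linear (\<lambda>X. coef X p)"
  by (rule bounded_linear_intro[where K = 1]) (auto simp: abs_coef_le_norm)

lemma ord_ge_infsum:
  assumes "\<And>a. a \<in> A \<Longrightarrow> ord_ge n (f a)" "f summable_on A"
  shows "ord_ge n (infsum f A)"
proof (unfold ord_ge_def, intro allI impI)
  fix i j :: nat assume "i + j < n"
  have "((\<lambda>a. coef (f a) (i, j)) has_sum coef (infsum f A) (i, j)) A"
    using has_sum_bounded_linear[OF bounded_linear_coef has_sum_infsum[OF assms(2)]] by simp
  moreover have "((\<lambda>a. coef (f a) (i, j)) has_sum 0) A"
    by (rule has_sum_0) (use assms(1) \<open>i + j < n\<close> in \<open>auto simp: ord_ge_def\<close>)
  ultimately show "coef (infsum f A) (i, j) = 0" by (rule has_sum_unique)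
qed

section \<open>Evaluation and Fourier modes\<close>

text \<open>Evaluation at a point and extraction of a Fourier mode at fixed \<open>r\<close> are both pairings with a
  bounded weight on the exponents, and a product can be paired by way of
  \<open>has_sum_antidiagonals\<close>.\<close>

definition pair :: "(nat \<times> nat \<Rightarrow> complex) \<Rightarrow> wiener \<Rightarrow> complex" where
  "pair \<psi> X = (\<Sum>\<^sub>\<infinity>p. of_real (coef X p) * \<psi> p)"

lemma pair:
  assumes "\<And>p. norm (\<psi> p) \<le> 1"
  shows pair_abs_summable: "(\<lambda>p. of_real (coef X p) * \<psi> p) abs_summable_on UNIV"
    and has_sum_pair: "((\<lambda>p. of_real (coef X p) * \<psi> p) has_sum pair \<psi> X) UNIV"
    and norm_pair: "norm (pair \<psi> X) \<le> norm X"
    and bounded_linear_pair: "bounded_linear (pair \<psi>)"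
proof -
  have le: "norm (of_real (coef X p) * \<psi> p) \<le> \<bar>coef X p\<bar>" for X p
    using assms[of p] by (simp add: norm_mult mult_left_le)
  have s: "(\<lambda>p. of_real (coef X p) * \<psi> p) abs_summable_on UNIV" for X
    by (rule Infinite_Sum.abs_summable_on_comparison_test'[OF coef_summable']) (use le in auto)
  then show "(\<lambda>p. of_real (coef X p) * \<psi> p) abs_summable_on UNIV" .
  have h: "((\<lambda>p. of_real (coef X p) * \<psi> p) has_sum pair \<psi> X) UNIV" for X
    unfolding pair_def by (rule has_sum_infsum[OF abs_summable_summable[OF s]])
  then show "((\<lambda>p. of_real (coef X p) * \<psi> p) has_sum pair \<psi> X) UNIV" .
  have n: "norm (pair \<psi> X) \<le> norm X" for X
  proof -
    have "norm (pair \<psi> X) \<le> (\<Sum>\<^sub>\<infinity>p. norm (of_real (coef X p) * \<psi> p))"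
      unfolding pair_def by (rule norm_infsum_bound[OF s])
    also have "\<dots> \<le> norm X" unfolding norm_wiener_def
      by (rule infsum_mono[OF s]) (use le in auto)
    finally show ?thesis .
  qed
  then show "norm (pair \<psi> X) \<le> norm X" .
  show "bounded_linear (pair \<psi>)"
  proof (rule bounded_linear_intro[where K = 1])
    fix X Y c
    show "pair \<psi> (X + Y) = pair \<psi> X + pair \<psi> Y"
      by (rule has_sum_unique[OF h]) (use has_sum_add[OF h h, of X Y] in \<open>simp add: algebra_simps\<close>)
    show "pair \<psi> (c *\<^sub>R X) = c *\<^sub>R pair \<psi> X"
      by (rule has_sum_unique[OF h]) (use has_sum_cmult_right[OF h, of "of_real c" X] in \<open>simp add: scaleR_conv_of_real[where 'a = complex] mult_ac\<close>)
  qed (use n in auto)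
qed

lemma has_sum_pair_mult:
  assumes "\<And>p. norm (\<psi> p) \<le> 1"
  shows "((\<lambda>(p, q). of_real (coef X p * coef Y q) * \<psi> (p + q)) has_sum pair \<psi> (X * Y)) UNIV"
    and "(\<lambda>(p, q). of_real (coef X p * coef Y q) * \<psi> (p + q)) abs_summable_on UNIV"
proof -
  let ?f = "\<lambda>(p, q). of_real (coef X p * coef Y q) * \<psi> (p + q)"
  have "(\<lambda>(p, q). coef X p * coef Y q) abs_summable_on UNIV"
    by (rule abs_summable_tensor[OF coef_summable coef_summable])
  then show s: "?f abs_summable_on UNIV"
    by (rule Infinite_Sum.abs_summable_on_comparison_test)
       (auto simp: norm_mult assms abs_mult intro!: mult_left_le)
  then have sf: "?f summable_on UNIV" by (rule abs_summable_summable)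
  have "(\<Sum>p\<in>below s. ?f (p, s - p)) = of_real (coef (X * Y) s) * \<psi> s" for s
    unfolding coef_mult of_real_sum sum_distrib_right
  proof (rule sum.cong[OF refl])
    fix p assume "p \<in> below s"
    then have "p + (s - p) = s" by (cases p; cases s) (auto simp: below_def)
    then show "?f (p, s - p) = of_real (coef X p * coef Y (s - p)) * \<psi> s" by simp
  qed
  with has_sum_antidiagonals[OF sf]
  have "((\<lambda>s. of_real (coef (X * Y) s) * \<psi> s) has_sum infsum ?f UNIV) UNIV" by simp
  from has_sum_unique[OF this has_sum_pair[of \<psi> "X * Y", OF assms]]
  have "infsum ?f UNIV = pair \<psi> (X * Y)" .
  with has_sum_infsum[OF sf] show "(?f has_sum pair \<psi> (X * Y)) UNIV" by (simp only:)
qed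

lemma pair_mult:
  assumes \<psi>: "\<And>p. norm (\<psi> p) \<le> 1" and mult: "\<And>p q. \<psi> (p + q) = \<psi> p * \<psi> q"
  shows "pair \<psi> (X * Y) = pair \<psi> X * pair \<psi> Y"
proof -
  let ?x = "\<lambda>p. of_real (coef X p) * \<psi> p" and ?y = "\<lambda>p. of_real (coef Y p) * \<psi> p"
  have eq: "(\<lambda>(p, q). of_real (coef X p * coef Y q) * \<psi> (p + q)) = (\<lambda>(p, q). ?x p * ?y q)"
    by (auto simp only: fun_eq_iff mult split_paired_all prod.case of_real_mult ac_simps)
  have "((\<lambda>(p, q). ?x p * ?y q) has_sum pair \<psi> (X * Y)) (UNIV \<times> UNIV)"
    using has_sum_pair_mult(1)[of \<psi> X Y, OF \<psi>] unfolding eq by simp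
  then have "((\<lambda>p. ?x p * pair \<psi> Y) has_sum pair \<psi> (X * Y)) UNIV"
    by (rule has_sum_SigmaD) (simp only: prod.case, rule has_sum_cmult_right[OF has_sum_pair[of \<psi> Y, OF \<psi>]])
  moreover have "((\<lambda>p. ?x p * pair \<psi> Y) has_sum pair \<psi> X * pair \<psi> Y) UNIV"
    by (rule has_sum_cmult_left[OF has_sum_pair[of \<psi> X, OF \<psi>]])
  ultimately show ?thesis by (rule has_sum_unique)
qed

definition mode :: "real \<Rightarrow> int \<Rightarrow> wiener \<Rightarrow> complex" where
  "mode r k = pair (\<lambda>(i, j). if int i - int j = k then of_real r ^ (i + j) else 0)"

definition val :: "real \<Rightarrow> real \<Rightarrow> wiener \<Rightarrow> complex" where
  "val r s = pair (\<lambda>(i, j). of_real r ^ (i + j) * cis (s * (real i - real j)))"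

lemma mode_weight: "0 \<le> r \<Longrightarrow> r \<le> 1 \<Longrightarrow> norm ((\<lambda>(i, j). if int i - int j = k then of_real r ^ (i + j) else 0) p :: complex) \<le> 1"
  by (cases p) (auto simp: norm_power power_le_one)

lemma val_weight: "0 \<le> r \<Longrightarrow> r \<le> 1 \<Longrightarrow> norm ((\<lambda>(i, j). of_real r ^ (i + j) * cis (s * (real i - real j))) p :: complex) \<le> 1"
  by (cases p) (auto simp: norm_mult norm_power power_le_one)

lemma bounded_linear_mode: "0 \<le> r \<Longrightarrow> r \<le> 1 \<Longrightarrow> bounded_linear (mode r k)"
  unfolding mode_def by (rule bounded_linear_pair) (rule mode_weight)

lemma bounded_linear_val: "0 \<le> r \<Longrightarrow> r \<le> 1 \<Longrightarrow> bounded_linear (val r s)"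
  unfolding val_def by (rule bounded_linear_pair) (rule val_weight)

lemma norm_val: "0 \<le> r \<Longrightarrow> r \<le> 1 \<Longrightarrow> norm (val r s X) \<le> norm X"
  unfolding val_def by (rule norm_pair) (rule val_weight)

lemma val_mult:
  assumes "0 \<le> r" "r \<le> 1"
  shows "val r s (X * Y) = val r s X * val r s Y"
  unfolding val_def
  by (rule pair_mult[OF val_weight[OF assms]]) (auto simp: power_add cis_mult algebra_simps)

text \<open>Modes of products are convolutions: group the pairs of exponents by the mode of the first
  factor.\<close>
lemma has_sum_mode_mult:
  assumes "0 \<le> r" "r \<le> 1"
  shows "((\<lambda>l. mode r l X * mode r (k - l) Y) has_sum mode r k (X * Y)) UNIV"
proof -
  define \<psi> where "\<psi> = (\<lambda>k (i :: nat, j :: nat). if int i - int j = k then complex_of_real r ^ (i + j) else 0)"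
  have \<psi>: "norm (\<psi> k p) \<le> 1" for k p unfolding \<psi>_def by (rule mode_weight[OF assms])
  have m: "mode r k = pair (\<psi> k)" for k by (simp add: mode_def \<psi>_def)
  let ?d = "\<lambda>p :: nat \<times> nat. int (fst p) - int (snd p)"
  let ?h = "\<lambda>p. of_real (coef X p) * \<psi> (?d p) p * mode r (k - ?d p) Y"
  have "(?h has_sum mode r k (X * Y)) UNIV"
  proof (rule has_sum_SigmaD)
    show "((\<lambda>(p, q). of_real (coef X p * coef Y q) * \<psi> k (p + q)) has_sum mode r k (X * Y)) (UNIV \<times> UNIV)"
      using has_sum_pair_mult(1)[of "\<psi> k", OF \<psi>] by (simp add: m)
    fix p
    have "\<psi> k (p + q) = \<psi> (?d p) p * \<psi> (k - ?d p) q" for q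
      by (cases p; cases q) (auto simp: \<psi>_def power_add)
    then show "((\<lambda>q. case (p, q) of (p, q) \<Rightarrow> of_real (coef X p * coef Y q) * \<psi> k (p + q)) has_sum ?h p) UNIV"
      using has_sum_cmult_right[OF has_sum_pair[of "\<psi> (k - ?d p)" Y, OF \<psi>], of "of_real (coef X p) * \<psi> (?d p) p"]
      by (simp add: m mult_ac)
  qed
  then show ?thesis
  proof (rule has_sum_fibres[where d = ?d])
    fix l
    have "((\<lambda>p. of_real (coef X p) * \<psi> l p * mode r (k - l) Y) has_sum mode r l X * mode r (k - l) Y) UNIV"
      unfolding m by (rule has_sum_cmult_left[OF has_sum_pair[of "\<psi> l" X, OF \<psi>]])
    then show "(?h has_sum mode r l X * mode r (k - l) Y) {p \<in> UNIV. ?d p = l}"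
      by (rule has_sum_cong_neutral[THEN iffD1, rotated -1]) (auto simp: \<psi>_def)
  qed
qed

lemma has_sum_mode_val:
  assumes "0 \<le> r" "r \<le> 1"
  shows "((\<lambda>k. mode r k X * cis (s * of_int k)) has_sum val r s X) UNIV"
proof (rule has_sum_fibres[where d = "\<lambda>p. int (fst p) - int (snd p)"])
  show "((\<lambda>p. of_real (coef X p) * (case p of (i, j) \<Rightarrow> of_real r ^ (i + j) * cis (s * (real i - real j)))) has_sum val r s X) UNIV"
    unfolding val_def by (rule has_sum_pair[OF val_weight[OF assms]])
  fix k
  have "((\<lambda>p. (of_real (coef X p) * (case p of (i, j) \<Rightarrow> if int i - int j = k then of_real r ^ (i + j) else 0)) * cis (s * of_int k)) has_sum mode r k X * cis (s * of_int k)) UNIV"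
    unfolding mode_def by (rule has_sum_cmult_left[OF has_sum_pair[OF mode_weight[OF assms]]])
  then show "((\<lambda>p. of_real (coef X p) * (case p of (i, j) \<Rightarrow> of_real r ^ (i + j) * cis (s * (real i - real j)))) has_sum mode r k X * cis (s * of_int k)) {z \<in> UNIV. int (fst z) - int (snd z) = k}"
    by (rule has_sum_cong_neutral[THEN iffD1, rotated -1]) auto
qed

text \<open>A monomial of mode \<open>k\<close> has degree at least \<open>|k|\<close>. This is the source both of the exponential
  decay in \<open>k\<close> and of the powers of \<open>r\<close>.\<close>
lemma norm_mode_le:
  assumes "0 \<le> r" "r \<le> 1" "ord_ge n X"
  shows "norm (mode r k X) \<le> r ^ max n (nat \<bar>k\<bar>) * norm X"
proof -
  let ?\<psi> = "\<lambda>(i, j). if int i - int j = k then complex_of_real r ^ (i + j) else 0"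
  have le: "norm (of_real (coef X p) * ?\<psi> p) \<le> r ^ max n (nat \<bar>k\<bar>) * \<bar>coef X p\<bar>" for p
  proof -
    obtain i j where [simp]: "p = (i, j)" by (cases p)
    consider "i + j < n" | "int i - int j \<noteq> k" | "i + j \<ge> max n (nat \<bar>k\<bar>)" "int i - int j = k" by linarith
    then show ?thesis
    proof cases
      case 3
      then have "r ^ (i + j) \<le> r ^ max n (nat \<bar>k\<bar>)" using assms by (intro power_decreasing) auto
      then show ?thesis using 3 assms by (simp add: norm_mult norm_power mult.commute[of "r ^ _"] mult_left_mono)
    qed (use assms in \<open>auto simp: ord_ge_def\<close>)
  qed
  have "norm (mode r k X) \<le> (\<Sum>\<^sub>\<infinity>p. norm (of_real (coef X p) * ?\<psi> p))"
    unfolding mode_def pair_def by (rule norm_infsum_bound[OF pair_abs_summable[OF mode_weight[OF assms(1,2)]]])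
  also have "\<dots> \<le> (\<Sum>\<^sub>\<infinity>p. r ^ max n (nat \<bar>k\<bar>) * \<bar>coef X p\<bar>)"
    by (rule infsum_mono[OF pair_abs_summable[OF mode_weight[OF assms(1,2)]] summable_on_cmult_right[OF coef_summable'] le])
  also have "\<dots> = r ^ max n (nat \<bar>k\<bar>) * norm X"
    by (simp add: norm_wiener_def infsum_cmult_right')
  finally show ?thesis .
qed

section \<open>Analytic nonlinearities\<close>

definition deg :: "(jetvar \<Rightarrow> nat) \<Rightarrow> nat" where "deg \<alpha> = (\<Sum>v\<in>UNIV. \<alpha> v)"

definition monomial :: "(jetvar \<Rightarrow> 'a::comm_monoid_mult) \<Rightarrow> (jetvar \<Rightarrow> nat) \<Rightarrow> 'a" where
  "monomial T \<alpha> = (\<Prod>v\<in>UNIV. T v ^ \<alpha> v)"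

text \<open>The analytic function of the jet with Taylor coefficients \<open>b\<close>, evaluated in the algebra.\<close>
definition nlin :: "((jetvar \<Rightarrow> nat) \<Rightarrow> real) \<Rightarrow> (jetvar \<Rightarrow> wiener) \<Rightarrow> wiener" where
  "nlin b T = (\<Sum>\<^sub>\<infinity>\<alpha>. b \<alpha> *\<^sub>R monomial T \<alpha>)"

lemma norm_power_le_wiener: "norm (x::wiener) \<le> s \<Longrightarrow> norm (x ^ n) \<le> s ^ n"
  by (rule order_trans[OF norm_power_ineq power_mono]) auto

lemma norm_prod_powers:
  fixes T :: "jetvar \<Rightarrow> wiener"
  assumes "\<And>v. norm (T v) \<le> s" "finite A"
  shows "norm (\<Prod>v\<in>A. T v ^ \<alpha> v) \<le> s ^ sum \<alpha> A"
  using assms(2)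
proof (induction A rule: finite_induct)
  case (insert v A)
  then show ?case
    by (simp add: power_add, intro order_trans[OF norm_mult_ineq] mult_mono norm_power_le_wiener assms(1))
       (use order_trans[OF norm_ge_zero assms(1)] in auto)
qed simp

lemma norm_monomial:
  fixes T :: "jetvar \<Rightarrow> wiener"
  assumes "\<And>v. norm (T v) \<le> s"
  shows "norm (monomial T \<alpha>) \<le> s ^ deg \<alpha>"
  using norm_prod_powers[where A = UNIV and \<alpha> = \<alpha>, OF assms] by (simp add: monomial_def deg_def)

lemma norm_two_products: "norm (a * b + c * d) \<le> norm a * norm b + norm c * norm (d :: wiener)"
  by (intro norm_triangle_le add_mono norm_mult_ineq)

text \<open>Multiplying by \<open>s\<close> replaces the exponent \<open>n - 1\<close> of the mean value estimate by \<open>n\<close>.\<close>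
lemma power_diff_bound:
  fixes x y :: wiener
  assumes "norm x \<le> s" "norm y \<le> s" "norm (x - y) \<le> d"
  shows "s * norm (x ^ n - y ^ n) \<le> real n * s ^ n * d"
proof (induction n)
  case (Suc n)
  have s: "s \<ge> 0" using assms(1) norm_ge_zero order_trans by blast
  have "x ^ Suc n - y ^ Suc n = x * (x ^ n - y ^ n) + (x - y) * y ^ n" by (simp add: algebra_simps)
  then have "norm (x ^ Suc n - y ^ Suc n) \<le> norm x * norm (x ^ n - y ^ n) + norm (x - y) * norm (y ^ n)"
    by (simp only: norm_two_products)
  also have "\<dots> \<le> s * norm (x ^ n - y ^ n) + d * s ^ n"
    using norm_ge_zero[of "x - y"]
    by (intro add_mono mult_mono norm_power_le_wiener assms) (use s assms(3) in linarith | simp)+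
  finally have "s * norm (x ^ Suc n - y ^ Suc n) \<le> s * (s * norm (x ^ n - y ^ n) + d * s ^ n)"
    using s by (intro mult_left_mono)
  also have "\<dots> \<le> s * (real n * s ^ n * d + d * s ^ n)"
    using Suc s by (intro mult_left_mono add_right_mono)
  also have "\<dots> = real (Suc n) * s ^ Suc n * d" by (simp add: algebra_simps)
  finally show ?case .
qed simp

lemma monomial_diff_bound:
  fixes T U :: "jetvar \<Rightarrow> wiener"
  assumes "\<And>v. norm (T v) \<le> s" "\<And>v. norm (U v) \<le> s" "\<And>v. norm (T v - U v) \<le> d"
  shows "s * norm (monomial T \<alpha> - monomial U \<alpha>) \<le> real (deg \<alpha>) * s ^ deg \<alpha> * d"
proof -
  have s: "s \<ge> 0" using assms(1) norm_ge_zero order_trans by blast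
  have "s * norm ((\<Prod>v\<in>A. T v ^ \<alpha> v) - (\<Prod>v\<in>A. U v ^ \<alpha> v)) \<le> real (sum \<alpha> A) * s ^ sum \<alpha> A * d" if "finite A" for A
    using that
  proof (induction A rule: finite_induct)
    case (insert v A)
    let ?t = "T v ^ \<alpha> v" and ?u = "U v ^ \<alpha> v" and ?S = "sum \<alpha> A"
    let ?P = "\<Prod>v\<in>A. T v ^ \<alpha> v" and ?Q = "\<Prod>v\<in>A. U v ^ \<alpha> v"
    have "?t * ?P - ?u * ?Q = (?t - ?u) * ?P + ?u * (?P - ?Q)" by (simp add: algebra_simps)
    then have "norm (?t * ?P - ?u * ?Q) \<le> norm (?t - ?u) * norm ?P + norm ?u * norm (?P - ?Q)"
      by (simp only: norm_two_products)
    also have "\<dots> \<le> norm (?t - ?u) * s ^ ?S + s ^ \<alpha> v * norm (?P - ?Q)"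
      using insert(1) by (intro add_mono mult_left_mono mult_right_mono norm_prod_powers norm_power_le_wiener assms) auto
    finally have "s * norm (?t * ?P - ?u * ?Q) \<le> s * (norm (?t - ?u) * s ^ ?S + s ^ \<alpha> v * norm (?P - ?Q))"
      using s by (rule mult_left_mono)
    also have "\<dots> = (s * norm (?t - ?u)) * s ^ ?S + s ^ \<alpha> v * (s * norm (?P - ?Q))" by (simp add: algebra_simps)
    also have "\<dots> \<le> (real (\<alpha> v) * s ^ \<alpha> v * d) * s ^ ?S + s ^ \<alpha> v * (real ?S * s ^ ?S * d)"
      using insert s by (intro add_mono mult_left_mono mult_right_mono power_diff_bound assms) auto
    finally show ?case using insert(1,2) by (simp add: power_add algebra_simps)
  qed simp
  from this[of UNIV] show ?thesis by (simp add: monomial_def deg_def)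
qed

text \<open>Absolute convergence of the Taylor series on the closed polydisc of radius \<open>\<epsilon>\<close>.\<close>
definition majorised :: "real \<Rightarrow> ((jetvar \<Rightarrow> nat) \<Rightarrow> real) \<Rightarrow> bool" where
  "majorised \<epsilon> b \<longleftrightarrow> \<epsilon> > 0 \<and> (\<lambda>\<alpha>. \<bar>b \<alpha>\<bar> * \<epsilon> ^ deg \<alpha>) summable_on UNIV"

lemma nlin_abs_summable:
  fixes T :: "jetvar \<Rightarrow> wiener"
  assumes "majorised \<epsilon> b" "\<And>v. norm (T v) \<le> \<epsilon>"
  shows "(\<lambda>\<alpha>. b \<alpha> *\<^sub>R monomial T \<alpha>) abs_summable_on UNIV"
proof (rule Infinite_Sum.abs_summable_on_comparison_test')
  show "(\<lambda>\<alpha>. \<bar>b \<alpha>\<bar> * \<epsilon> ^ deg \<alpha>) summable_on UNIV" using assms(1) by (simp add: majorised_def)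
  show "norm (b \<alpha> *\<^sub>R monomial T \<alpha>) \<le> \<bar>b \<alpha>\<bar> * \<epsilon> ^ deg \<alpha>" for \<alpha>
    using norm_monomial[of T \<epsilon> \<alpha>] assms(2) by (simp add: mult_left_mono)
qed

lemma has_sum_nlin:
  fixes T :: "jetvar \<Rightarrow> wiener"
  assumes "majorised \<epsilon> b" "\<And>v. norm (T v) \<le> \<epsilon>"
  shows "((\<lambda>\<alpha>. b \<alpha> *\<^sub>R monomial T \<alpha>) has_sum nlin b T) UNIV"
  unfolding nlin_def by (rule has_sum_infsum[OF abs_summable_summable[OF nlin_abs_summable[OF assms]]])

lemma nat_le_two_power: "real n \<le> 2 ^ n"
  by (metis less_exp less_imp_le of_nat_le_iff of_nat_numeral of_nat_power)

lemma small_power_bound: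
  fixes x :: real
  assumes "0 \<le> x" "x \<le> 1/2" "n \<ge> 2"
  shows "real n * x ^ n \<le> 4 * x\<^sup>2"
proof -
  obtain k where n: "n = k + 2" using assms(3) le_Suc_ex by (metis add.commute)
  have "real n * x ^ k \<le> 2 ^ n * (1/2) ^ k"
    using assms nat_le_two_power by (intro mult_mono power_mono) auto
  also have "\<dots> = 4" by (simp add: n power_add power_divide)
  finally have "real n * x ^ k * x\<^sup>2 \<le> 4 * x\<^sup>2" by (intro mult_right_mono) auto
  then show ?thesis by (simp only: n power_add mult.assoc)
qed

text \<open>The Lipschitz constant is proportional to the radius \<open>s\<close> of the ball because the series starts
  at degree two; at half the radius of convergence the factor \<open>deg \<alpha>\<close> is absorbed by
  \<open>2\<^sup>-\<^sup>d\<^sup>e\<^sup>g\<close>.\<close>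
lemma nlin_lipschitz:
  assumes maj: "majorised \<epsilon> b" and b2: "\<And>\<alpha>. deg \<alpha> < 2 \<Longrightarrow> b \<alpha> = 0"
    and T: "\<And>v. norm (T v) \<le> s" and U: "\<And>v. norm (U v) \<le> s" and d: "\<And>v. norm (T v - U v) \<le> d"
    and s: "0 < s" "s \<le> \<epsilon> / 2"
  shows "norm (nlin b T - nlin b U) \<le> 4 * (\<Sum>\<^sub>\<infinity>\<alpha>. \<bar>b \<alpha>\<bar> * \<epsilon> ^ deg \<alpha>) / \<epsilon>\<^sup>2 * s * d"
proof -
  have \<epsilon>: "\<epsilon> > 0" using maj by (simp add: majorised_def)
  have d0: "d \<ge> 0" using d norm_ge_zero order_trans by blast
  have le: "norm (b \<alpha> *\<^sub>R monomial T \<alpha> - b \<alpha> *\<^sub>R monomial U \<alpha>) \<le> \<bar>b \<alpha>\<bar> * \<epsilon> ^ deg \<alpha> * (4 / \<epsilon>\<^sup>2 * s * d)" for \<alpha>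
  proof (cases "deg \<alpha> < 2")
    case False
    have "real (deg \<alpha>) * (s / \<epsilon>) ^ deg \<alpha> \<le> 4 * (s / \<epsilon>)\<^sup>2"
      using False s \<epsilon> by (intro small_power_bound) (auto simp: field_simps)
    then have "real (deg \<alpha>) * s ^ deg \<alpha> \<le> 4 * s\<^sup>2 / \<epsilon>\<^sup>2 * \<epsilon> ^ deg \<alpha>"
      using \<epsilon> by (simp add: power_divide field_simps)
    then have "s * norm (monomial T \<alpha> - monomial U \<alpha>) \<le> 4 * s\<^sup>2 / \<epsilon>\<^sup>2 * \<epsilon> ^ deg \<alpha> * d"
      using order_trans[OF monomial_diff_bound[of T s U d \<alpha>, OF T U d] mult_right_mono[OF _ d0]] by blast
    also have "\<dots> = s * (\<epsilon> ^ deg \<alpha> * (4 / \<epsilon>\<^sup>2 * s * d))" by (simp add: power2_eq_square)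
    finally have "norm (monomial T \<alpha> - monomial U \<alpha>) \<le> \<epsilon> ^ deg \<alpha> * (4 / \<epsilon>\<^sup>2 * s * d)"
      using s(1) by (simp only: mult_le_cancel_left_pos)
    then show ?thesis
      by (metis abs_ge_zero mult.assoc mult_left_mono norm_scaleR scaleR_diff_right)
  qed (simp add: b2)
  have sm: "(\<lambda>\<alpha>. \<bar>b \<alpha>\<bar> * \<epsilon> ^ deg \<alpha> * (4 / \<epsilon>\<^sup>2 * s * d)) summable_on UNIV"
    using maj by (intro summable_on_cmult_left) (simp add: majorised_def)
  have "((\<lambda>\<alpha>. b \<alpha> *\<^sub>R monomial T \<alpha> - b \<alpha> *\<^sub>R monomial U \<alpha>) has_sum (nlin b T - nlin b U)) UNIV"
  proof -
    have "norm (T v) \<le> \<epsilon>" "norm (U v) \<le> \<epsilon>" for v using T[of v] U[of v] s \<epsilon> by linarith+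
    then show ?thesis
      using has_sum_add[OF has_sum_nlin[of \<epsilon> b T, OF maj] has_sum_uminusI[OF has_sum_nlin[of \<epsilon> b U, OF maj]]] by simp
  qed
  then have "norm (nlin b T - nlin b U) \<le> (\<Sum>\<^sub>\<infinity>\<alpha>. \<bar>b \<alpha>\<bar> * \<epsilon> ^ deg \<alpha> * (4 / \<epsilon>\<^sup>2 * s * d))"
    by (rule norm_infsum_le[OF _ has_sum_infsum[OF sm]]) (use le in auto)
  also have "\<dots> = 4 * (\<Sum>\<^sub>\<infinity>\<alpha>. \<bar>b \<alpha>\<bar> * \<epsilon> ^ deg \<alpha>) / \<epsilon>\<^sup>2 * s * d"
    using maj by (subst infsum_cmult_left) (auto simp: majorised_def)
  finally show ?thesis .
qed

lemma nlin_zero: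
  assumes "\<And>\<alpha>. deg \<alpha> < 2 \<Longrightarrow> b \<alpha> = 0"
  shows "nlin b (\<lambda>_. 0) = 0"
  unfolding nlin_def
proof (rule infsum_0)
  fix \<alpha> :: "jetvar \<Rightarrow> nat"
  show "b \<alpha> *\<^sub>R monomial (\<lambda>_. 0::wiener) \<alpha> = 0"
  proof (cases "deg \<alpha> < 2")
    case False
    then obtain v where "\<alpha> v \<noteq> 0" unfolding deg_def by (metis less_numeral_extra(3) pos2 sum.neutral)
    then have "monomial (\<lambda>_. 0::wiener) \<alpha> = 0"
      unfolding monomial_def by (intro prod_zero bexI[of _ v]) (auto simp: power_0_left)
    then show ?thesis by simp
  qed (simp add: assms)
qed

lemma ord_ge_power: "ord_ge 1 X \<Longrightarrow> ord_ge n (X ^ n)"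
  using ord_ge_mult[of 1 X] by (induction n) auto

lemma ord_ge_nlin:
  assumes "\<And>\<alpha>. deg \<alpha> < p \<Longrightarrow> b \<alpha> = 0" "\<And>v. ord_ge 1 (T v)" "majorised \<epsilon> b" "\<And>v. norm (T v) \<le> \<epsilon>"
  shows "ord_ge p (nlin b T)"
  unfolding nlin_def
proof (rule ord_ge_infsum[OF _ abs_summable_summable[OF nlin_abs_summable[OF assms(3,4)]]])
  fix \<alpha> :: "jetvar \<Rightarrow> nat"
  have "ord_ge (sum \<alpha> A) (\<Prod>v\<in>A. T v ^ \<alpha> v)" if "finite A" for A
    using that by (induction A rule: finite_induct) (auto intro!: ord_ge_mult ord_ge_power assms(2))
  then have "ord_ge (deg \<alpha>) (monomial T \<alpha>)" by (simp add: deg_def monomial_def)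
  then show "ord_ge p (b \<alpha> *\<^sub>R monomial T \<alpha>)"
    using assms(1)[of \<alpha>] by (cases "deg \<alpha> < p") (auto intro!: ord_ge_scaleR elim: ord_ge_mono)
qed

text \<open>The reflection \<open>\<zeta> \<mapsto> -\<zeta>\<close> changes the sign of \<open>u\<^sub>x\<close> and \<open>u\<^sub>y\<close> and of no other jet
  variable.\<close>
definition parity :: "(jetvar \<Rightarrow> nat) \<Rightarrow> nat" where "parity \<alpha> = \<alpha> Dx + \<alpha> Dy"

lemma swapw_power: "swapw (X ^ n) = swapw X ^ n"
  by (induction n) (auto simp: swapw_mult)

lemma monomial_jetvar:
  "monomial T \<alpha> = T D0 ^ \<alpha> D0 * T Dx ^ \<alpha> Dx * T Dy ^ \<alpha> Dy * T Dxx ^ \<alpha> Dxx * T Dxy ^ \<alpha> Dxy * T Dyy ^ \<alpha> Dyy"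
  unfolding monomial_def UNIV_jetvar by (simp add: mult_ac)

lemma swapw_nlin:
  assumes T: "\<And>v. swapw (T v) = (if v \<in> {Dx, Dy} then - T v else T v)"
    and b: "\<And>\<alpha>. odd (parity \<alpha>) \<Longrightarrow> b \<alpha> = 0"
    and "majorised \<epsilon> b" "\<And>v. norm (T v) \<le> \<epsilon>"
  shows "swapw (nlin b T) = nlin b T"
proof -
  have "swapw (b \<alpha> *\<^sub>R monomial T \<alpha>) = b \<alpha> *\<^sub>R monomial T \<alpha>" for \<alpha>
  proof (cases "odd (parity \<alpha>)")
    case False
    have "swapw (monomial T \<alpha>) = (- 1) ^ parity \<alpha> * monomial T \<alpha>"
      unfolding monomial_jetvar parity_def power_add
      by (simp add: swapw_mult swapw_power T power_minus[of "T _"] mult_ac)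
    then have "swapw (monomial T \<alpha>) = monomial T \<alpha>" using False by simp
    then show ?thesis by (simp add: linear_cmul[OF bounded_linear.linear[OF bounded_linear_swapw]])
  qed (simp add: b linear_0[OF bounded_linear.linear[OF bounded_linear_swapw]])
  then show ?thesis
    using has_sum_bounded_linear[OF bounded_linear_swapw has_sum_nlin[of \<epsilon> b T, OF assms(3,4)]] has_sum_nlin[of \<epsilon> b T, OF assms(3,4)]
    by (auto dest: has_sum_unique)
qed

lemma val_power: "0 \<le> r \<Longrightarrow> r \<le> 1 \<Longrightarrow> val r s (X ^ n) = val r s X ^ n"
proof (induction n)
  case 0
  have "val r s 1 = (\<Sum>\<^sub>\<infinity>p\<in>{0::nat \<times> nat}. 1)"
    unfolding val_def pair_def by (rule infsum_cong_neutral) (auto simp: zero_prod_def)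
  then show ?case by simp
qed (simp add: val_mult)

lemma has_sum_val_nlin:
  assumes "majorised \<epsilon> b" "\<And>v. norm (T v) \<le> \<epsilon>" "0 \<le> r" "r \<le> 1"
  shows "((\<lambda>\<alpha>. of_real (b \<alpha>) * monomial (\<lambda>v. val r s (T v)) \<alpha>) has_sum val r s (nlin b T)) UNIV"
proof -
  have "val r s (b \<alpha> *\<^sub>R monomial T \<alpha>) = of_real (b \<alpha>) * monomial (\<lambda>v. val r s (T v)) \<alpha>" for \<alpha>
    unfolding monomial_jetvar
    by (simp add: linear_cmul[OF bounded_linear.linear[OF bounded_linear_val[OF assms(3,4)]]]
          scaleR_conv_of_real[where 'a = complex] val_mult val_power assms(3,4))
  then show ?thesis
    using has_sum_bounded_linear[OF bounded_linear_val[OF assms(3,4), of s] has_sum_nlin[of \<epsilon> b T, OF assms(1,2)]] by simp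
qed

lemma nlin_add:
  assumes "majorised \<epsilon> b" "majorised \<epsilon> c" "\<And>v. norm (T v) \<le> \<epsilon>"
  shows "nlin (\<lambda>\<alpha>. b \<alpha> + c \<alpha>) T = nlin b T + nlin c T"
  unfolding nlin_def[of "\<lambda>\<alpha>. b \<alpha> + c \<alpha>"]
  using has_sum_add[OF has_sum_nlin[OF assms(1,3)] has_sum_nlin[OF assms(2,3)]]
  by (auto intro!: infsumI simp: scaleR_add_left)

text \<open>The multi-index of the pure power \<open>u\<^sup>n\<close>.\<close>
definition pow_index :: "nat \<Rightarrow> jetvar \<Rightarrow> nat" where
  "pow_index n = (\<lambda>v. if v = D0 then n else 0)"

lemma deg_pow_index [simp]: "deg (pow_index n) = n" and parity_pow_index [simp]: "parity (pow_index n) = 0"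
  by (auto simp: deg_def pow_index_def parity_def UNIV_jetvar)

definition single :: "nat \<Rightarrow> real \<Rightarrow> (jetvar \<Rightarrow> nat) \<Rightarrow> real" where
  "single n c = (\<lambda>\<alpha>. if \<alpha> = pow_index n then c else 0)"

lemma majorised_single: "\<epsilon> > 0 \<Longrightarrow> majorised \<epsilon> (single n c)"
  unfolding majorised_def by (auto intro!: finite_nonzero_values_imp_summable_on simp: single_def)

lemma nlin_single: "nlin (single n c) T = c *\<^sub>R T D0 ^ n"
proof -
  have "nlin (single n c) T = (\<Sum>\<^sub>\<infinity>\<alpha>\<in>{pow_index n}. c *\<^sub>R monomial T \<alpha>)"
    unfolding nlin_def by (rule infsum_cong_neutral) (auto simp: single_def)
  then show ?thesis by (simp add: monomial_jetvar pow_index_def)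
qed

lemma majorised_add:
  assumes "majorised \<epsilon> b" "majorised \<epsilon> c" shows "majorised \<epsilon> (\<lambda>\<alpha>. b \<alpha> + c \<alpha>)"
proof -
  have "(\<lambda>\<alpha>. norm ((b \<alpha> + c \<alpha>) * \<epsilon> ^ deg \<alpha>)) summable_on UNIV"
  proof (rule Infinite_Sum.abs_summable_on_comparison_test')
    show "(\<lambda>\<alpha>. \<bar>b \<alpha>\<bar> * \<epsilon> ^ deg \<alpha> + \<bar>c \<alpha>\<bar> * \<epsilon> ^ deg \<alpha>) summable_on UNIV"
      using assms by (intro summable_on_add) (auto simp: majorised_def)
    show "norm ((b \<alpha> + c \<alpha>) * \<epsilon> ^ deg \<alpha>) \<le> \<bar>b \<alpha>\<bar> * \<epsilon> ^ deg \<alpha> + \<bar>c \<alpha>\<bar> * \<epsilon> ^ deg \<alpha>" for \<alpha>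
      using assms(1) abs_triangle_ineq[of "b \<alpha>" "c \<alpha>"]
      by (auto simp: majorised_def abs_mult mult_right_mono simp flip: distrib_right)
  qed
  then show ?thesis using assms by (simp add: majorised_def abs_mult)
qed

section \<open>The bifurcation equation\<close>

text \<open>The unknown is \<open>\<Phi> = -f''/\<theta>\<^sup>2\<close>, whose modes are \<open>k\<^sup>2\<close> times those of \<open>f\<close>: the density \<open>Q\<^sub>1\<close>
  contains second derivatives, and all jet variables are bounded multipliers of \<open>\<Phi>\<close>. Accordingly
  \<open>dinv2\<close> maps \<open>\<Phi>\<close> to \<open>f\<close>, and \<open>resolvent\<close> is \<open>k\<^sup>2\<close> times the inverse of \<open>k\<^sup>2 - 1\<close>, the symbol
  of the linear part up to the factor \<open>-\<mu>\<close>.\<close>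

definition dinv2 :: "int \<Rightarrow> real" where "dinv2 k = 1 / (of_int k)\<^sup>2"
definition outer :: "int \<Rightarrow> real" where "outer k = (if \<bar>k\<bar> \<ge> 2 then 1 else 0)"
definition primary :: "int \<Rightarrow> real" where "primary k = (if \<bar>k\<bar> = 1 then 1 else 0)"
definition resolvent :: "int \<Rightarrow> real" where
  "resolvent k = (if \<bar>k\<bar> \<ge> 2 then (of_int k)\<^sup>2 / ((of_int k)\<^sup>2 - 1) else 0)"

lemma int_sq_ge1: "k \<noteq> 0 \<Longrightarrow> (of_int k :: real)\<^sup>2 \<ge> 1"
  by (metis int_one_le_iff_zero_less of_int_1_le_iff of_int_power zero_less_power2)

lemma dinv2_le: "multiplier_bound 1 dinv2"
  unfolding multiplier_bound_def
proof
  show "\<bar>dinv2 k\<bar> \<le> 1" for k using int_sq_ge1[of k] by (cases "k = 0") (auto simp: dinv2_def)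
qed

lemma outer_le: "multiplier_bound 1 outer" and primary_le: "multiplier_bound 1 primary"
  by (auto simp: multiplier_bound_def outer_def primary_def)

lemma int_sq_ge4: "\<bar>k\<bar> \<ge> 2 \<Longrightarrow> (of_int k :: real)\<^sup>2 \<ge> 4"
  using power_mono[of 2 "\<bar>of_int k\<bar> :: real" 2] by simp

lemma resolvent_le: "multiplier_bound 2 resolvent"
  unfolding multiplier_bound_def
proof
  show "\<bar>resolvent k\<bar> \<le> 2" for k using int_sq_ge4[of k] by (auto simp: resolvent_def field_simps)
qed

lemmas coef_dinv2 = coef_multiplier[OF dinv2_le] and coef_outer = coef_multiplier[OF outer_le]
  and coef_primary = coef_multiplier[OF primary_le] and coef_resolvent = coef_multiplier[OF resolvent_le]

lemma multiplier_swapw: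
  assumes "multiplier_bound B \<phi>" "\<And>k. \<phi> (- k) = c * \<phi> k"
  shows "swapw (multiplier \<phi> X) = c *\<^sub>R multiplier \<phi> (swapw X)"
proof (rule wiener_eqI)
  fix p :: "nat \<times> nat"
  show "coef (swapw (multiplier \<phi> X)) p = coef (c *\<^sub>R multiplier \<phi> (swapw X)) p"
    using assms(2)[of "int (fst p) - int (snd p)"] by (cases p) (simp add: coef_multiplier[OF assms(1)])
qed

lemma linear_multiplier:
  assumes "multiplier_bound B \<phi>"
  shows "multiplier \<phi> (X + Y) = multiplier \<phi> X + multiplier \<phi> Y" "multiplier \<phi> (X - Y) = multiplier \<phi> X - multiplier \<phi> Y"
    "multiplier \<phi> (c *\<^sub>R X) = c *\<^sub>R multiplier \<phi> X"
  by (rule wiener_eqI, auto simp: coef_multiplier[OF assms] algebra_simps)+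

lemma linear_tau: "tau (X + Y) = tau X + tau Y" "tau (X - Y) = tau X - tau Y" "tau (c *\<^sub>R X) = c *\<^sub>R tau X"
  by (rule wiener_eqI, auto)+

lemma linear_swapw: "swapw (X + Y) = swapw X + swapw Y" "swapw (X - Y) = swapw X - swapw Y" "swapw (c *\<^sub>R X) = c *\<^sub>R swapw X" "swapw (- X) = - swapw X"
  by (rule wiener_eqI, auto)+

text \<open>The parameters are \<open>\<theta> = 2\<pi>/\<gamma>\<close>, \<open>m = m0\<close> and \<open>n = n0\<close>.\<close>
locale wave =
  fixes \<theta> m n :: real
  assumes \<theta>: "\<theta> > 0" and m: "m \<noteq> 0"
begin

definition \<mu> :: real where "\<mu> = m ^ 3 * \<theta>\<^sup>2"

lemma \<mu>: "\<mu> \<noteq> 0" using \<theta> m by (simp add: \<mu>_def)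

text \<open>The jet variables of the wave as multipliers of \<open>\<Phi>\<close>. A first derivative carries a factor
  \<open>\<i>\<close>, which is omitted here to keep the coefficients real; it is restored by \<open>unit\<close> below. At
  \<open>k = 0\<close> the quotients are \<open>0\<close> by the convention on division by zero.\<close>
fun jet_symbol :: "jetvar \<Rightarrow> int \<Rightarrow> real" where
  "jet_symbol D0 k = dinv2 k"
| "jet_symbol Dx k = m * \<theta> / of_int k"
| "jet_symbol Dy k = n * \<theta> / of_int k"
| "jet_symbol Dxx k = - (m * \<theta>)\<^sup>2"
| "jet_symbol Dxy k = - (m * n * \<theta>\<^sup>2)"
| "jet_symbol Dyy k = - (n * \<theta>)\<^sup>2"

definition jet_const :: real where "jet_const = 1 + \<bar>m * \<theta>\<bar> + \<bar>n * \<theta>\<bar> + (m * \<theta>)\<^sup>2 + \<bar>m * n * \<theta>\<^sup>2\<bar> + (n * \<theta>)\<^sup>2"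

lemma jet_const: "jet_const \<ge> 1" by (simp add: jet_const_def)

lemma divide_int_le: "\<bar>x / of_int k\<bar> \<le> \<bar>x :: real\<bar>"
proof (cases "k = 0")
  case False
  then have "\<bar>of_int k :: real\<bar> \<ge> 1" by simp
  then show ?thesis using mult_right_mono[of 1 "\<bar>of_int k\<bar> :: real" "\<bar>x\<bar>"] by (auto simp: abs_divide divide_simps mult.commute)
qed simp

lemma jet_symbol_le: "multiplier_bound jet_const (jet_symbol v)"
  unfolding multiplier_bound_def
proof
  fix k
  show "\<bar>jet_symbol v k\<bar> \<le> jet_const"
  using divide_int_le[of "m * \<theta>" k] divide_int_le[of "n * \<theta>" k] dinv2_le[unfolded multiplier_bound_def, rule_format, of k]
    zero_le_power2[of "m * \<theta>"] zero_le_power2[of "n * \<theta>"] abs_ge_zero[of "m * \<theta>"] abs_ge_zero[of "n * \<theta>"] abs_ge_zero[of "m * n * \<theta>\<^sup>2"]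
  unfolding jet_const_def by (cases v; simp; linarith)
qed

definition jets :: "wiener \<Rightarrow> jetvar \<Rightarrow> wiener" where
  "jets \<Phi> v = multiplier (jet_symbol v) \<Phi>"

lemma jets_D0: "jets \<Phi> D0 = multiplier dinv2 \<Phi>"
  by (simp add: jets_def multiplier_def)

lemma norm_jets: "norm (jets \<Phi> v) \<le> jet_const * norm \<Phi>"
  unfolding jets_def by (rule norm_multiplier[OF jet_symbol_le])

lemma jets_diff: "jets \<Phi> v - jets \<Psi> v = jets (\<Phi> - \<Psi>) v"
  unfolding jets_def by (simp add: linear_multiplier[OF jet_symbol_le])

lemma swapw_jets:
  assumes "swapw \<Phi> = \<Phi>"
  shows "swapw (jets \<Phi> v) = (if v \<in> {Dx, Dy} then - jets \<Phi> v else jets \<Phi> v)"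
proof -
  have "jet_symbol v (- k) = (if v \<in> {Dx, Dy} then - 1 else 1) * jet_symbol v k" for k
    by (cases v) (auto simp: dinv2_def)
  from multiplier_swapw[of jet_const "jet_symbol v" "if v \<in> {Dx, Dy} then - 1 else 1" \<Phi>, OF jet_symbol_le this] assms show ?thesis by (auto simp: jets_def)
qed

lemma ord_ge_jets: "ord_ge k \<Phi> \<Longrightarrow> ord_ge k (jets \<Phi> v)"
  unfolding jets_def by (rule ord_ge_multiplier[OF jet_symbol_le])

text \<open>The correction \<open>\<kappa>\<close> as read off from the first mode of the equation. \<open>B1\<close> is the prescribed
  first-mode part of \<open>\<Phi>\<close>, \<open>H\<close> the part in the modes \<open>|k| \<ge> 2\<close>, and \<open>W\<close> is to be the reciprocal of
  \<open>tau B1\<close>.\<close>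
definition speed_shift :: "((jetvar \<Rightarrow> nat) \<Rightarrow> real) \<Rightarrow> wiener \<Rightarrow> wiener \<Rightarrow> wiener \<Rightarrow> wiener" where
  "speed_shift b W B1 H = - m *\<^sub>R (W * tau (nlin b (jets (B1 + H))))"

text \<open>The equation in the modes \<open>|k| \<ge> 2\<close>, solved for \<open>H\<close>.\<close>
definition wave_map :: "((jetvar \<Rightarrow> nat) \<Rightarrow> real) \<Rightarrow> wiener \<Rightarrow> wiener \<Rightarrow> wiener \<Rightarrow> wiener" where
  "wave_map b W B1 H = (1 / \<mu>) *\<^sub>R multiplier resolvent (speed_shift b W B1 H * multiplier dinv2 H + m *\<^sub>R nlin b (jets (B1 + H)))"

lemma swapw_wave_map:
  assumes "majorised \<epsilon> b" "\<And>\<alpha>. odd (parity \<alpha>) \<Longrightarrow> b \<alpha> = 0"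
    and "swapw B1 = B1" "diag W" "swapw H = H" "jet_const * norm (B1 + H) \<le> \<epsilon>"
  shows "swapw (wave_map b W B1 H) = wave_map b W B1 H"
proof -
  have "swapw (nlin b (jets (B1 + H))) = nlin b (jets (B1 + H))"
  proof (rule swapw_nlin[OF swapw_jets assms(2,1)])
    show "norm (jets (B1 + H) v) \<le> \<epsilon>" for v using norm_jets[of "B1 + H" v] assms(6) by linarith
  qed (simp add: linear_swapw assms)
  moreover have "swapw (speed_shift b W B1 H) = speed_shift b W B1 H"
    using assms(4) by (simp add: speed_shift_def linear_swapw diag_swapw diag_mult diag_tau)
  moreover have "swapw (multiplier dinv2 H) = multiplier dinv2 H"
    using multiplier_swapw[OF dinv2_le, of 1 H] assms(5) by (simp add: dinv2_def)
  ultimately show ?thesis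
    using multiplier_swapw[OF resolvent_le, of 1] by (simp add: wave_map_def linear_swapw swapw_mult resolvent_def)
qed

lemma wave_map_outer: "multiplier outer (wave_map b W B1 H) = wave_map b W B1 H"
proof (rule wiener_eqI)
  fix p :: "nat \<times> nat"
  show "coef (multiplier outer (wave_map b W B1 H)) p = coef (wave_map b W B1 H) p"
    by (cases p) (auto simp: wave_map_def coef_outer coef_resolvent outer_def resolvent_def)
qed

lemma diag_speed_shift: "diag W \<Longrightarrow> diag (speed_shift b W B1 H)"
  using diag_mult[OF _ diag_tau, of W "nlin b (jets (B1 + H))"] unfolding speed_shift_def diag_def[of "_ *\<^sub>R _"] by (auto simp: diag_def)

text \<open>On the ball of radius \<open>\<rho>\<close> the nonlinearity is of size \<open>\<rho>\<^sup>2\<close> with Lipschitz constant of order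
  \<open>\<rho>\<close>. Division by the first mode costs a factor \<open>1/\<rho>\<close>, so \<open>\<kappa>\<close> is of size \<open>\<rho>\<close> with Lipschitz
  constant of order one; but \<open>\<kappa>\<close> enters multiplied by \<open>H\<close>, which restores the factor \<open>\<rho>\<close>.
  Reflection symmetry and the absence of the modes \<open>|k| \<le> 1\<close> are closed conditions that the map
  preserves.\<close>
theorem fixed_point_exists:
  assumes maj: "majorised \<epsilon> b" and b2: "\<And>\<alpha>. deg \<alpha> < 2 \<Longrightarrow> b \<alpha> = 0"
    and par: "\<And>\<alpha>. odd (parity \<alpha>) \<Longrightarrow> b \<alpha> = 0" and K1: "K1 > 0"
  obtains \<rho>1 where "\<rho>1 > 0"
    "\<And>\<rho> W B1. 0 < \<rho> \<Longrightarrow> \<rho> \<le> \<rho>1 \<Longrightarrow> norm B1 \<le> K1 * \<rho> \<Longrightarrow> norm W \<le> K1 / \<rho> \<Longrightarrow> diag W \<Longrightarrow> swapw B1 = B1 \<Longrightarrow>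
       \<exists>H. norm H \<le> \<rho> \<and> swapw H = H \<and> multiplier outer H = H \<and> wave_map b W B1 H = H"
proof -
  define C where "C = 4 * (\<Sum>\<^sub>\<infinity>\<alpha>. \<bar>b \<alpha>\<bar> * \<epsilon> ^ deg \<alpha>) / \<epsilon>\<^sup>2"
  define K0 where "K0 = jet_const * (K1 + 1)"
  define c1 where "c1 = \<bar>m\<bar> * K1 * C * K0\<^sup>2"
  define c2 where "c2 = \<bar>m\<bar> * K1 * C * K0 * jet_const"
  define L where "L = (2 / \<bar>\<mu>\<bar>) * (c2 + c1 + \<bar>m\<bar> * C * K0\<^sup>2 + \<bar>m\<bar> * C * K0 * jet_const)"
  have \<epsilon>: "\<epsilon> > 0" using maj by (simp add: majorised_def)
  have C: "C \<ge> 0" unfolding C_def using \<epsilon> by (auto intro!: divide_nonneg_nonneg infsum_nonneg)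
  have K0: "K0 > 0" using jet_const K1 by (simp add: K0_def)
  have pos: "c1 \<ge> 0" "c2 \<ge> 0" using C K0 K1 jet_const by (auto simp: c1_def c2_def)
  have L: "L \<ge> 0" unfolding L_def using C K0 K1 jet_const pos by (auto intro!: mult_nonneg_nonneg add_nonneg_nonneg)
  define \<rho>1 where "\<rho>1 = min (\<epsilon> / (2 * K0)) (1 / (2 * (L + 1)))"
  have "\<rho>1 > 0" using \<epsilon> K0 L by (simp add: \<rho>1_def)
  moreover have "\<exists>H. norm H \<le> \<rho> \<and> swapw H = H \<and> multiplier outer H = H \<and> wave_map b W B1 H = H"
    if \<rho>: "0 < \<rho>" "\<rho> \<le> \<rho>1" and B1: "norm B1 \<le> K1 * \<rho>" and W: "norm W \<le> K1 / \<rho>" and dW: "diag W" and sB: "swapw B1 = B1"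
    for \<rho> W B1
  proof -
    define s where "s = K0 * \<rho>"
    define S where "S = {H. norm H \<le> \<rho> \<and> swapw H = H \<and> multiplier outer H = H}"
    have s: "0 < s" "s \<le> \<epsilon> / 2" using \<rho> K0 by (auto simp: s_def \<rho>1_def field_simps)
    have L\<rho>: "L * \<rho> \<le> 1 / 2"
    proof -
      have "(L + 1) * \<rho> \<le> 1 / 2" using \<rho> L by (auto simp: \<rho>1_def field_simps)
      then show ?thesis using \<rho>(1) by (simp add: algebra_simps)
    qed
    define N where "N H = nlin b (jets (B1 + H))" for H
    have jb: "jet_const * norm (B1 + H) \<le> s" if "norm H \<le> \<rho>" for H
    proof -
      have "norm (B1 + H) \<le> K1 * \<rho> + \<rho>" using norm_triangle_ineq[of B1 H] B1 that by linarith
      then have "jet_const * norm (B1 + H) \<le> jet_const * (K1 * \<rho> + \<rho>)" using jet_const by (intro mult_left_mono) auto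
      then show ?thesis by (simp add: s_def K0_def algebra_simps)
    qed
    have jb': "norm (jets (B1 + H) v) \<le> s" if "norm H \<le> \<rho>" for H v
      using norm_jets[of "B1 + H" v] jb[OF that] by linarith
    have N: "norm (N H) \<le> C * s\<^sup>2" if "norm H \<le> \<rho>" for H
      using nlin_lipschitz[of \<epsilon> b "jets (B1 + H)" s "\<lambda>_. 0" s, OF maj b2] jb'[OF that] s nlin_zero[OF b2]
      by (simp add: N_def C_def power2_eq_square mult.assoc)
    have dN: "norm (N H - N H') \<le> C * s * jet_const * norm (H - H')" if "norm H \<le> \<rho>" "norm H' \<le> \<rho>" for H H'
      using nlin_lipschitz[of \<epsilon> b "jets (B1 + H)" s "jets (B1 + H')" "jet_const * norm (H - H')", OF maj b2]
        jb'[OF that(1)] jb'[OF that(2)] s norm_jets[of "H - H'"]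
      by (simp add: N_def C_def jets_diff mult.assoc)
    define \<kappa> where "\<kappa> H = speed_shift b W B1 H" for H
    have tauW: "norm (- m *\<^sub>R (W * tau X)) \<le> \<bar>m\<bar> * (K1 / \<rho>) * norm X" for X
    proof -
      have "norm (W * tau X) \<le> (K1 / \<rho>) * norm X"
        by (rule order_trans[OF norm_mult_ineq mult_mono]) (use W norm_tau K1 \<rho> in auto)
      then have "\<bar>m\<bar> * norm (W * tau X) \<le> \<bar>m\<bar> * ((K1 / \<rho>) * norm X)" by (intro mult_left_mono) auto
      then show ?thesis by (simp add: mult.assoc)
    qed
    have \<kappa>: "norm (\<kappa> H) \<le> c1 * \<rho>" if "norm H \<le> \<rho>" for H
    proof -
      have "norm (\<kappa> H) \<le> \<bar>m\<bar> * (K1 / \<rho>) * (C * s\<^sup>2)"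
        unfolding \<kappa>_def speed_shift_def N_def[symmetric]
        by (rule order_trans[OF tauW mult_left_mono[OF N[OF that]]]) (use K1 \<rho> in auto)
      also have "\<dots> = c1 * \<rho>" using \<rho> by (simp add: c1_def s_def power2_eq_square)
      finally show ?thesis .
    qed
    have d\<kappa>: "norm (\<kappa> H - \<kappa> H') \<le> c2 * norm (H - H')" if "norm H \<le> \<rho>" "norm H' \<le> \<rho>" for H H'
    proof -
      have "\<kappa> H - \<kappa> H' = - m *\<^sub>R (W * tau (N H - N H'))"
        by (simp add: \<kappa>_def speed_shift_def N_def linear_tau algebra_simps)
      also have "norm \<dots> \<le> \<bar>m\<bar> * (K1 / \<rho>) * (C * s * jet_const * norm (H - H'))"
        by (rule order_trans[OF tauW mult_left_mono[OF dN[OF that]]]) (use K1 \<rho> in auto)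
      also have "\<dots> = c2 * norm (H - H')" using \<rho> by (simp add: c2_def s_def)
      finally show ?thesis .
    qed
    have R: "norm ((1 / \<mu>) *\<^sub>R multiplier resolvent X) \<le> (2 / \<bar>\<mu>\<bar>) * norm X" for X
      using mult_left_mono[OF norm_multiplier[OF resolvent_le, of X], of "1 / \<bar>\<mu>\<bar>"] by simp
    have dn: "norm (multiplier dinv2 H) \<le> norm H" for H using norm_multiplier[OF dinv2_le, of H] by simp
    have "norm (wave_map b W B1 H) \<le> \<rho>" if "norm H \<le> \<rho>" for H
    proof -
      have "norm (\<kappa> H * multiplier dinv2 H + m *\<^sub>R N H) \<le> norm (\<kappa> H) * norm (multiplier dinv2 H) + \<bar>m\<bar> * norm (N H)"
        by (rule norm_triangle_le) (use norm_mult_ineq in auto)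
      also have "\<dots> \<le> (c1 * \<rho>) * \<rho> + \<bar>m\<bar> * (C * s\<^sup>2)"
        using \<kappa>[OF that] N[OF that] order_trans[OF dn that] \<rho> pos by (intro add_mono mult_mono mult_left_mono) auto
      also have "\<dots> = (c1 + \<bar>m\<bar> * C * K0\<^sup>2) * \<rho> * \<rho>" by (simp add: s_def power2_eq_square algebra_simps)
      finally have "norm (wave_map b W B1 H) \<le> (2 / \<bar>\<mu>\<bar>) * ((c1 + \<bar>m\<bar> * C * K0\<^sup>2) * \<rho> * \<rho>)"
        unfolding wave_map_def \<kappa>_def N_def by (intro order_trans[OF R] mult_left_mono) auto
      also have "\<dots> = (2 / \<bar>\<mu>\<bar> * (c1 + \<bar>m\<bar> * C * K0\<^sup>2)) * \<rho> * \<rho>" by simp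
      also have "\<dots> \<le> L * \<rho> * \<rho>"
        using pos C K0 jet_const \<rho> by (intro mult_right_mono) (auto simp: L_def intro!: divide_right_mono)
      also have "\<dots> \<le> 1 / 2 * \<rho>" using L\<rho> \<rho> by (intro mult_right_mono) auto
      finally show ?thesis using \<rho> by simp
    qed
    then have inv: "wave_map b W B1 ` S \<subseteq> S"
      unfolding S_def using wave_map_outer swapw_wave_map[OF maj par sB dW] jb s by force
    have lip: "dist (wave_map b W B1 H) (wave_map b W B1 H') \<le> 1 / 2 * dist H H'" if "H \<in> S" "H' \<in> S" for H H'
    proof -
      have n: "norm H \<le> \<rho>" "norm H' \<le> \<rho>" using that by (auto simp: S_def)
      define \<delta> where "\<delta> = norm (H - H')"
      let ?G = "\<lambda>H. \<kappa> H * multiplier dinv2 H + m *\<^sub>R N H"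
      have eq: "?G H - ?G H' = (\<kappa> H - \<kappa> H') * multiplier dinv2 H + \<kappa> H' * multiplier dinv2 (H - H') + m *\<^sub>R (N H - N H')"
        by (simp add: linear_multiplier[OF dinv2_le] algebra_simps)
      have "norm (?G H - ?G H') \<le> norm (\<kappa> H - \<kappa> H') * norm (multiplier dinv2 H) + norm (\<kappa> H') * norm (multiplier dinv2 (H - H')) + \<bar>m\<bar> * norm (N H - N H')"
        unfolding eq by (rule norm_triangle_le, rule add_mono[OF norm_two_products]) simp
      also have "\<dots> \<le> (c2 * \<delta>) * \<rho> + (c1 * \<rho>) * \<delta> + \<bar>m\<bar> * (C * s * jet_const * \<delta>)"
        using d\<kappa>[OF n] \<kappa>[OF n(2)] dN[OF n] order_trans[OF dn n(1)] dn[of "H - H'"] \<rho> pos unfolding \<delta>_def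
        by (intro add_mono mult_mono mult_left_mono) auto
      also have "\<dots> = (c2 + c1 + \<bar>m\<bar> * C * K0 * jet_const) * \<rho> * \<delta>" by (simp add: s_def algebra_simps)
      finally have le: "norm (?G H - ?G H') \<le> (c2 + c1 + \<bar>m\<bar> * C * K0 * jet_const) * \<rho> * \<delta>" .
      have "wave_map b W B1 H - wave_map b W B1 H' = (1 / \<mu>) *\<^sub>R multiplier resolvent (?G H - ?G H')"
        unfolding wave_map_def \<kappa>_def N_def by (simp only: linear_multiplier[OF resolvent_le] scaleR_diff_right)
      then have "norm (wave_map b W B1 H - wave_map b W B1 H') \<le> (2 / \<bar>\<mu>\<bar>) * norm (?G H - ?G H')" using R by simp
      also have "\<dots> \<le> (2 / \<bar>\<mu>\<bar>) * ((c2 + c1 + \<bar>m\<bar> * C * K0 * jet_const) * \<rho> * \<delta>)" using le by (intro mult_left_mono) auto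
      also have "\<dots> = (2 / \<bar>\<mu>\<bar> * (c2 + c1 + \<bar>m\<bar> * C * K0 * jet_const)) * \<rho> * \<delta>" by simp
      also have "\<dots> \<le> L * \<rho> * \<delta>"
        using pos C K0 jet_const \<rho> by (intro mult_right_mono) (auto simp: L_def \<delta>_def intro!: divide_right_mono)
      also have "\<dots> \<le> 1 / 2 * \<delta>" using L\<rho> by (intro mult_right_mono) (auto simp: \<delta>_def)
      finally show ?thesis by (simp add: dist_norm \<delta>_def)
    qed
    have "closed S"
    proof -
      have "S = {H. norm H \<le> \<rho>} \<inter> {H. swapw H = H} \<inter> {H. multiplier outer H = H}" by (auto simp: S_def)
      then show ?thesis
        by (auto intro!: closed_Int closed_Collect_le closed_Collect_eq continuous_intros
            linear_continuous_on[OF bounded_linear_swapw] linear_continuous_on[OF bounded_linear_multiplier[OF outer_le]])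
    qed
    moreover have "0 \<in> S"
      using \<rho> linear_0[OF bounded_linear.linear[OF bounded_linear_multiplier[OF outer_le]]]
        linear_0[OF bounded_linear.linear[OF bounded_linear_swapw]] by (simp add: S_def)
    ultimately have "\<exists>!H. H \<in> S \<and> wave_map b W B1 H = H"
      using inv lip by (intro Banach_fix[where c = "1/2"]) (auto simp: complete_eq_closed)
    then show ?thesis by (auto simp: S_def)
  qed
  ultimately show ?thesis by (rule that)
qed

text \<open>A fixed point solves the equation in the modes \<open>|k| \<ge> 2\<close> by construction and in the mode 1 by
  the choice of \<open>\<kappa>\<close>; the mode \<open>-1\<close> follows by reflection. Being diagonal means that only the
  constant of integration is left.\<close>
lemma full_equation:
  assumes fixp: "wave_map b W B1 H = H" and "diag W" and B1: "multiplier primary B1 = B1" "swapw B1 = B1" and H: "swapw H = H"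
    and W: "W * tau B1 = 1"
    and N: "swapw (nlin b (jets (B1 + H))) = nlin b (jets (B1 + H))"
  defines "\<Phi> \<equiv> B1 + H"
  shows "diag (speed_shift b W B1 H * multiplier dinv2 \<Phi> + \<mu> *\<^sub>R (multiplier dinv2 \<Phi> - \<Phi>) + m *\<^sub>R nlin b (jets \<Phi>))" (is "diag ?E")
proof -
  let ?\<kappa> = "speed_shift b W B1 H" and ?N = "nlin b (jets \<Phi>)"
  have d\<kappa>: "diag ?\<kappa>" by (rule diag_speed_shift[OF \<open>diag W\<close>])
  have oH: "multiplier outer H = H" using wave_map_outer[of b W B1 H] by (simp add: fixp)
  have cH: "coef H (i, j) = 0" if "\<bar>int i - int j\<bar> < 2" for i j
    using arg_cong[OF oH, of "\<lambda>X. coef X (i, j)"] that by (simp add: coef_outer outer_def)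
  have cB: "coef B1 (i, j) = 0" if "\<bar>int i - int j\<bar> \<noteq> 1" for i j
    using arg_cong[OF B1(1), of "\<lambda>X. coef X (i, j)"] that by (simp add: coef_primary primary_def)
  have s\<Phi>: "swapw \<Phi> = \<Phi>" using B1 H by (simp add: \<Phi>_def linear_swapw)
  have s\<kappa>: "swapw ?\<kappa> = ?\<kappa>" by (rule diag_swapw[OF d\<kappa>])
  have sE: "swapw ?E = ?E"
    using multiplier_swapw[OF dinv2_le, of 1 \<Phi>] N by (simp add: linear_swapw swapw_mult s\<kappa> s\<Phi> \<Phi>_def[symmetric] dinv2_def)
  have t\<Phi>: "tau \<Phi> = tau B1"
    by (rule wiener_eqI) (auto simp: \<Phi>_def cH split: prod.splits)
  have td: "tau (multiplier dinv2 \<Phi>) = tau \<Phi>"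
    by (rule wiener_eqI) (auto simp: coef_dinv2 dinv2_def)
  have "tau ?E = ?\<kappa> * tau B1 + m *\<^sub>R tau ?N"
    by (simp add: linear_tau tau_diag_mult[OF d\<kappa>] td t\<Phi>)
  also have "?\<kappa> * tau B1 = - m *\<^sub>R (tau ?N * (W * tau B1))"
    unfolding speed_shift_def \<Phi>_def[symmetric] by (simp add: mult_ac)
  finally have tE: "tau ?E = 0" by (simp add: W)
  have cancel: "g + \<mu>' * ((1 / K - 1) * (1 / \<mu>' * (K / (K - 1)) * g)) = 0" if "K \<ge> 4" "\<mu>' \<noteq> 0" for g \<mu>' K :: real
    using that by (simp add: field_simps)
  have out: "coef ?E (i, j) = 0" if "\<bar>int i - int j\<bar> \<ge> 2" for i j
  proof -
    let ?k = "real_of_int (int i - int j)"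
    let ?G = "?\<kappa> * multiplier dinv2 H + m *\<^sub>R ?N"
    have k: "?k\<^sup>2 \<ge> 4" using int_sq_ge4[OF that] by simp
    have c: "coef H (i, j) = (1 / \<mu>) * (?k\<^sup>2 / (?k\<^sup>2 - 1)) * coef ?G (i, j)"
      using arg_cong[OF fixp, of "\<lambda>X. coef X (i, j)"] that
      by (simp add: wave_map_def coef_resolvent resolvent_def \<Phi>_def del: of_int_diff)
    have "multiplier dinv2 \<Phi> = multiplier dinv2 B1 + multiplier dinv2 H" by (simp add: \<Phi>_def linear_multiplier[OF dinv2_le])
    moreover have "coef (?\<kappa> * multiplier dinv2 B1) (i, j) = 0"
      unfolding coef_diag_mult[OF d\<kappa>]
    proof (rule sum.neutral, rule ballI)
      fix l assume "l \<in> {..min i j}"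
      then have "int (i - l) - int (j - l) = int i - int j" by auto
      then show "coef ?\<kappa> (l, l) * coef (multiplier dinv2 B1) (i - l, j - l) = 0"
        using cB[of "i - l" "j - l"] that by (simp add: coef_dinv2)
    qed
    moreover have "coef (multiplier dinv2 \<Phi> - \<Phi>) (i, j) = (1 / ?k\<^sup>2 - 1) * coef H (i, j)"
      using cB[of i j] that by (simp add: coef_dinv2 dinv2_def \<Phi>_def algebra_simps)
    ultimately have "coef ?E (i, j) = coef ?G (i, j) + \<mu> * ((1 / ?k\<^sup>2 - 1) * coef H (i, j))"
      by (simp add: distrib_left)
    also have "\<dots> = 0" unfolding c by (rule cancel) (use k \<mu> in auto)
    finally show ?thesis .
  qed
  have one: "coef ?E (Suc j, j) = 0" for j
    using arg_cong[OF tE, of "\<lambda>X. coef X (j, j)"] by simp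
  have one': "coef ?E (j, Suc j) = 0" for j
    using one[of j] arg_cong[OF sE, of "\<lambda>X. coef X (Suc j, j)"] by (simp only: coef_swapw prod.swap_def fst_conv snd_conv)
  show "diag ?E" unfolding diag_def
  proof (intro allI impI)
    fix i j :: nat assume "i \<noteq> j"
    then consider "\<bar>int i - int j\<bar> \<ge> 2" | "i = Suc j" | "j = Suc i" by linarith
    then show "coef ?E (i, j) = 0" using out one one' by cases auto
  qed
qed

lemma ord_ge_outer: "multiplier outer H = H \<Longrightarrow> ord_ge 2 H"
  unfolding ord_ge_def
proof (intro allI impI)
  fix i j :: nat assume H: "multiplier outer H = H" and "i + j < 2"
  then have "\<not> \<bar>int i - int j\<bar> \<ge> 2" by linarith
  then show "coef H (i, j) = 0" using arg_cong[OF H, of "\<lambda>X. coef X (i, j)"] by (simp add: coef_outer outer_def)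
qed

lemma ord_ge_primary: "multiplier primary H = H \<Longrightarrow> ord_ge 1 H"
  unfolding ord_ge_def
proof (intro allI impI)
  fix i j :: nat assume H: "multiplier primary H = H" and "i + j < 1"
  then have [simp]: "i = 0" "j = 0" by auto
  show "coef H (i, j) = 0" using arg_cong[OF H, of "\<lambda>X. coef X (i, j)"] by (simp add: coef_primary primary_def)
qed

text \<open>If \<open>H - H0\<close> has order \<open>k\<close>, the nonlinear terms differ at order \<open>min (k + 1) p\<close>, because
  \<open>f\<^sup>2 - f0\<^sup>2 = (f - f0)(f + f0)\<close> gains one degree; hence the two \<open>\<kappa>\<close> differ at one degree less, and
  \<open>\<kappa> f\<close> makes up for it since \<open>H\<close> has order two. Each turn of the fixed point equation thus raises
  the order of \<open>H - H0\<close> by one until it reaches \<open>p\<close>.\<close>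
lemma comparison:
  assumes b: "\<And>\<Phi>. ord_ge 1 \<Phi> \<Longrightarrow> \<Phi> = B1 + H \<Longrightarrow> ord_ge p (nlin b (jets \<Phi>) - nlin b0 (jets \<Phi>))"
    and b0: "\<And>T. nlin b0 T = (1/2) *\<^sub>R (T D0)\<^sup>2" and p: "p \<ge> 3"
    and H: "wave_map b W B1 H = H" and H0: "wave_map b0 W B1 H0 = H0" and B1: "multiplier primary B1 = B1"
  shows "ord_ge p (H - H0)" "ord_ge (p - 1) (speed_shift b W B1 H - speed_shift b0 W B1 H0)"
proof -
  have H2: "ord_ge 2 H" "ord_ge 2 H0" using wave_map_outer[of b W B1 H] wave_map_outer[of b0 W B1 H0] H H0 by (auto intro: ord_ge_outer)
  have B: "ord_ge 1 B1" by (rule ord_ge_primary[OF B1])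
  let ?N = "nlin b (jets (B1 + H))" and ?M = "nlin b0 (jets (B1 + H0))"
  have o1: "ord_ge 1 (B1 + H)" "ord_ge 1 (B1 + H0)" using B H2 by (auto intro!: ord_ge_add elim: ord_ge_mono)
  have dN: "ord_ge (min (k + 1) p) (?N - ?M)" if "ord_ge k (H - H0)" for k
  proof -
    let ?f = "jets (B1 + H) D0" and ?h = "jets (B1 + H0) D0"
    have "ord_ge (k + 1) ((?f - ?h) * (?f + ?h))"
      using ord_ge_mult[OF ord_ge_jets[OF that, of D0] ord_ge_add[OF ord_ge_jets[OF o1(1), of D0] ord_ge_jets[OF o1(2), of D0]]]
      by (simp add: jets_diff)
    then have "ord_ge (min (k + 1) p) ((1/2) *\<^sub>R ((?f - ?h) * (?f + ?h)))"
      by (intro ord_ge_scaleR) (auto elim: ord_ge_mono)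
    moreover have "ord_ge (min (k + 1) p) (?N - nlin b0 (jets (B1 + H)))"
      by (rule ord_ge_mono[OF b[OF o1(1) refl]]) simp
    ultimately have "ord_ge (min (k + 1) p) ((?N - nlin b0 (jets (B1 + H))) + (1/2) *\<^sub>R ((?f - ?h) * (?f + ?h)))"
      by (rule ord_ge_add[rotated])
    moreover have "nlin b0 (jets (B1 + H)) - ?M = (1/2) *\<^sub>R ((?f - ?h) * (?f + ?h))"
      unfolding b0 by (simp add: power2_eq_square algebra_simps)
    ultimately have "ord_ge (min (k + 1) p) ((?N - nlin b0 (jets (B1 + H))) + (nlin b0 (jets (B1 + H)) - ?M))"
      by (simp only:)
    then show ?thesis by simp
  qed
  have d\<kappa>: "ord_ge (l - 1) (speed_shift b W B1 H - speed_shift b0 W B1 H0)" if "ord_ge l (?N - ?M)" for l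
  proof -
    have "speed_shift b W B1 H - speed_shift b0 W B1 H0 = - m *\<^sub>R (W * tau (?N - ?M))"
      by (simp add: speed_shift_def linear_tau algebra_simps)
    moreover have "ord_ge (l - 1) (tau (?N - ?M))" using that by (cases l) (auto intro: ord_ge_tau)
    ultimately show ?thesis using ord_ge_mult[of 0 W "l - 1"] by (auto intro!: ord_ge_scaleR simp del: scaleR_minus_left)
  qed
  have \<kappa>0: "ord_ge 1 (speed_shift b0 W B1 H0)"
  proof -
    have "ord_ge 2 ?M" unfolding b0 power2_eq_square
      using ord_ge_mult[OF ord_ge_jets[OF o1(2)] ord_ge_jets[OF o1(2)], of D0 D0] by (intro ord_ge_scaleR) (simp add: numeral_2_eq_2)
    then have "ord_ge 1 (tau ?M)" by (intro ord_ge_tau) (simp add: numeral_2_eq_2)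
    then show ?thesis using ord_ge_mult[of 0 W 1] unfolding speed_shift_def by (intro ord_ge_scaleR) auto
  qed
  have step: "ord_ge (min (k + 1) p) (H - H0)" if k: "ord_ge k (H - H0)" for k
  proof -
    let ?l = "min (k + 1) p"
    have o2: "ord_ge 2 (multiplier dinv2 H)" "ord_ge k (multiplier dinv2 (H - H0))"
      using H2 k by (auto intro: ord_ge_multiplier[OF dinv2_le])
    have "ord_ge (?l - 1 + 2) ((speed_shift b W B1 H - speed_shift b0 W B1 H0) * multiplier dinv2 H)"
      by (rule ord_ge_mult[OF d\<kappa>[OF dN[OF k]] o2(1)])
    moreover have "ord_ge (1 + k) (speed_shift b0 W B1 H0 * multiplier dinv2 (H - H0))"
      by (rule ord_ge_mult[OF \<kappa>0 o2(2)])
    ultimately have "ord_ge ?l ((speed_shift b W B1 H - speed_shift b0 W B1 H0) * multiplier dinv2 H + speed_shift b0 W B1 H0 * multiplier dinv2 (H - H0) + m *\<^sub>R (?N - ?M))"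
      using dN[OF k] by (intro ord_ge_add ord_ge_scaleR) (auto elim: ord_ge_mono)
    then have "ord_ge ?l (multiplier resolvent ((speed_shift b W B1 H - speed_shift b0 W B1 H0) * multiplier dinv2 H + speed_shift b0 W B1 H0 * multiplier dinv2 (H - H0) + m *\<^sub>R (?N - ?M)))"
      by (rule ord_ge_multiplier[OF resolvent_le])
    moreover have "H - H0 = (1 / \<mu>) *\<^sub>R multiplier resolvent ((speed_shift b W B1 H - speed_shift b0 W B1 H0) * multiplier dinv2 H + speed_shift b0 W B1 H0 * multiplier dinv2 (H - H0) + m *\<^sub>R (?N - ?M))"
    proof -
      have "(speed_shift b W B1 H - speed_shift b0 W B1 H0) * multiplier dinv2 H + speed_shift b0 W B1 H0 * multiplier dinv2 (H - H0) + m *\<^sub>R (?N - ?M)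
        = (speed_shift b W B1 H * multiplier dinv2 H + m *\<^sub>R ?N) - (speed_shift b0 W B1 H0 * multiplier dinv2 H0 + m *\<^sub>R ?M)"
        by (simp add: linear_multiplier[OF dinv2_le] algebra_simps)
      then have "(1 / \<mu>) *\<^sub>R multiplier resolvent ((speed_shift b W B1 H - speed_shift b0 W B1 H0) * multiplier dinv2 H + speed_shift b0 W B1 H0 * multiplier dinv2 (H - H0) + m *\<^sub>R (?N - ?M))
        = wave_map b W B1 H - wave_map b0 W B1 H0"
        by (simp only: wave_map_def linear_multiplier[OF resolvent_le] scaleR_diff_right)
      then show ?thesis by (simp only: H H0)
    qed
    ultimately show ?thesis by (metis ord_ge_scaleR)
  qed
  have "ord_ge (min (k + 2) p) (H - H0)" for k
  proof (induction k)
    case 0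
    then show ?case using ord_ge_diff[OF H2] p by (auto elim: ord_ge_mono)
  next
    case (Suc k)
    from step[OF Suc] show ?case by (rule ord_ge_mono) auto
  qed
  from this[of p] show o: "ord_ge p (H - H0)" by (simp add: min_def)
  from d\<kappa>[OF dN[OF o]] show "ord_ge (p - 1) (speed_shift b W B1 H - speed_shift b0 W B1 H0)" by (rule ord_ge_mono) auto
qed

end

section \<open>A convolution identity for Lambert coefficients\<close>

definition decays :: "(int \<Rightarrow> 'a::real_normed_field) \<Rightarrow> bool" where
  "decays c \<longleftrightarrow> (\<exists>C x. 0 \<le> x \<and> x < 1 \<and> (\<forall>k. norm (c k) \<le> C * x ^ nat \<bar>k\<bar>))"

lemma decaysI: "0 \<le> x \<Longrightarrow> x < 1 \<Longrightarrow> (\<And>k. norm (c k) \<le> C * x ^ nat \<bar>k\<bar>) \<Longrightarrow> decays c"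
  unfolding decays_def by blast

lemma int_geometric_summable:
  assumes "0 \<le> x" "x < (1::real)"
  shows "(\<lambda>k::int. x ^ nat \<bar>k\<bar>) summable_on UNIV"
proof -
  have s: "(\<lambda>n. x ^ n) summable_on (UNIV :: nat set)"
    using assms by (intro summable_nonneg_imp_summable_on summable_geometric) auto
  have "(\<lambda>k::int. x ^ nat \<bar>k\<bar>) summable_on {0..}"
  proof (subst summable_on_reindex_bij_betw[of int UNIV "{0..}", symmetric])
    show "bij_betw int UNIV {0..}" by (rule bij_betwI[where g = nat]) auto
  qed (use s in simp)
  moreover have "(\<lambda>k::int. x ^ nat \<bar>k\<bar>) summable_on {..0}"
  proof (subst summable_on_reindex_bij_betw[of "\<lambda>n. - int n" UNIV "{..0}", symmetric])
    show "bij_betw (\<lambda>n. - int n) UNIV {..0}" by (rule bij_betwI[where g = "\<lambda>k. nat (- k)"]) auto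
  qed (use s in simp)
  ultimately have "(\<lambda>k::int. x ^ nat \<bar>k\<bar>) summable_on ({0..} \<union> {..0})" by (rule summable_on_union)
  moreover have "{0..} \<union> {..0} = (UNIV :: int set)" by auto
  ultimately show ?thesis by simp
qed

lemma decays_abs_summable:
  fixes c :: "int \<Rightarrow> 'a::{real_normed_field}"
  assumes "decays c" shows "c abs_summable_on UNIV"
proof -
  obtain C x where x: "0 \<le> x" "x < 1" "\<And>k. norm (c k) \<le> C * x ^ nat \<bar>k\<bar>" using assms unfolding decays_def by blast
  show ?thesis
    by (rule Infinite_Sum.abs_summable_on_comparison_test'[OF summable_on_cmult_right[OF int_geometric_summable[OF x(1,2)], of C]])
       (use x in auto)
qed

lemma decays_summable: "decays (c :: int \<Rightarrow> 'a::{real_normed_field, banach}) \<Longrightarrow> c summable_on UNIV"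
  by (rule abs_summable_summable[OF decays_abs_summable])

text \<open>Half of the exponential decay absorbs the factor \<open>k\<close>.\<close>
lemma decays_of_int_mult:
  fixes c :: "int \<Rightarrow> 'a::real_normed_field"
  assumes "decays c"
  shows "decays (\<lambda>k. of_int k * c k)"
proof -
  obtain C x where x: "0 \<le> x" "x < 1" "\<And>k. norm (c k) \<le> C * x ^ nat \<bar>k\<bar>" using assms unfolding decays_def by blast
  define y where "y = sqrt x"
  have y: "0 \<le> y" "y < 1" "x = y * y" using x by (auto simp: y_def)
  have "(\<lambda>n. of_nat n * y ^ n) \<longlonglongrightarrow> 0" using y by (intro powser_times_n_limit_0) auto
  then obtain B where B: "\<And>n. norm (of_nat n * y ^ n) \<le> B"
    using convergent_imp_Bseq[of "\<lambda>n. of_nat n * y ^ n"] unfolding convergent_def Bseq_def by blast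
  have C: "C \<ge> 0" using order_trans[OF norm_ge_zero x(3)[of 0]] by simp
  show ?thesis
  proof (rule decaysI[OF y(1,2)])
    fix k :: int
    have "norm (of_int k * c k) = real (nat \<bar>k\<bar>) * norm (c k)" by (simp add: norm_mult)
    also have "\<dots> \<le> real (nat \<bar>k\<bar>) * (C * (y ^ nat \<bar>k\<bar> * y ^ nat \<bar>k\<bar>))"
      using x(3)[of k] by (intro mult_left_mono) (auto simp: y(3) power_mult_distrib)
    also have "\<dots> = (real (nat \<bar>k\<bar>) * y ^ nat \<bar>k\<bar>) * (C * y ^ nat \<bar>k\<bar>)" by simp
    also have "\<dots> \<le> B * (C * y ^ nat \<bar>k\<bar>)"
      using B[of "nat \<bar>k\<bar>"] C y by (intro mult_right_mono) auto
    finally show "norm (of_int k * c k) \<le> B * C * y ^ nat \<bar>k\<bar>" by (simp add: mult.assoc)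
  qed
qed

lemma decays_cmult: "decays c \<Longrightarrow> decays (\<lambda>k. a * c k)"
  unfolding decays_def
proof (elim exE conjE)
  fix C x :: real assume x: "0 \<le> x" "x < 1" "\<forall>k. norm (c k) \<le> C * x ^ nat \<bar>k\<bar>"
  show "\<exists>C x. 0 \<le> x \<and> x < 1 \<and> (\<forall>k. norm (a * c k) \<le> C * x ^ nat \<bar>k\<bar>)"
    by (rule exI[of _ "norm a * C"], rule exI[of _ x]) (use x in \<open>auto simp: norm_mult mult.assoc intro!: mult_left_mono\<close>)
qed

lemma decays_mono: "decays c \<Longrightarrow> (\<And>k. norm (d k) \<le> norm (c k)) \<Longrightarrow> decays d"
  unfolding decays_def by (meson order_trans)

text \<open>The Fourier coefficients of the one-gap profile up to sign and a constant. With
  \<open>q = e\<^sup>-\<^sup>h\<close> they are \<open>k / (2 sinh (k h))\<close>, and \<open>lambert_tail\<close> is the decaying part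
  of \<open>k coth (k h) / 2\<close>.\<close>
definition lambert :: "real \<Rightarrow> int \<Rightarrow> real" where
  "lambert q k = of_int \<bar>k\<bar> * q ^ nat \<bar>k\<bar> / (1 - q ^ (2 * nat \<bar>k\<bar>))"

definition lambert_tail :: "real \<Rightarrow> int \<Rightarrow> real" where
  "lambert_tail q k = of_int \<bar>k\<bar> * (q ^ (2 * nat \<bar>k\<bar>) / (1 - q ^ (2 * nat \<bar>k\<bar>)))"

context
  fixes q :: real assumes q: "0 < q" "q < 1"
begin

lemma one_minus_pow: "n \<ge> 1 \<Longrightarrow> 1 - q ^ (2 * n) \<ge> 1 - q" "n \<ge> 1 \<Longrightarrow> q ^ (2 * n) < 1"
proof -
  assume "n \<ge> 1"
  then have "q ^ (2 * n) \<le> q ^ 1" using q by (intro power_decreasing) auto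
  then show "1 - q ^ (2 * n) \<ge> 1 - q" "q ^ (2 * n) < 1" using q by auto
qed

lemma decays_lambert: "decays (lambert q)"
proof (rule decays_mono[OF decays_of_int_mult[OF decaysI[of q _ "1 / (1 - q)"]]])
  show "norm (q ^ nat \<bar>k\<bar> / (1 - q)) \<le> 1 / (1 - q) * q ^ nat \<bar>k\<bar>" for k using q by simp
  show "norm (lambert q k) \<le> norm (of_int k * (q ^ nat \<bar>k\<bar> / (1 - q)))" for k
  proof (cases "k = 0")
    case False
    then have n: "1 - q ^ (2 * nat \<bar>k\<bar>) \<ge> 1 - q" by (intro one_minus_pow) auto
    then show ?thesis using q by (auto simp: lambert_def abs_mult intro!: frac_le)
  qed (simp add: lambert_def)
qed (use q in auto)

lemma decays_lambert_tail: "decays (lambert_tail q)"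
proof (rule decays_mono[OF decays_lambert])
  show "norm (lambert_tail q k) \<le> norm (lambert q k)" for k
  proof (cases "k = 0")
    case False
    have "q ^ (2 * nat \<bar>k\<bar>) \<le> q ^ nat \<bar>k\<bar>" using q by (intro power_decreasing) auto
    moreover have "1 - q ^ (2 * nat \<bar>k\<bar>) > 0" using one_minus_pow(2)[of "nat \<bar>k\<bar>"] False by simp
    ultimately show ?thesis using q by (auto simp: lambert_def lambert_tail_def abs_mult intro!: divide_right_mono mult_left_mono)
  qed (simp add: lambert_def lambert_tail_def)
qed

lemma lambert_powi: "lambert q k = of_int k * q powi k / (1 - q powi (2 * k))"
proof -
  consider "k = 0" | "k > 0" | "k < 0" by linarith
  then show ?thesis
  proof cases
    case 2
    then have "q powi k = q ^ nat k" "q powi (2 * k) = q ^ (2 * nat k)" by (auto simp: power_int_def nat_mult_distrib)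
    then show ?thesis using 2 by (simp add: lambert_def)
  next
    case 3
    define n where "n = nat (- k)"
    have n: "k = - int n" "n \<ge> 1" using 3 by (auto simp: n_def)
    define x where "x = q ^ n"
    have x: "0 < x" "x * x < 1" using one_minus_pow(2)[OF n(2)] q by (auto simp: x_def mult_2 power_add)
    have p: "q powi k = 1 / x" "q powi (2 * k) = 1 / (x * x)"
      using n(1) q by (auto simp: x_def power_int_minus power_int_mult field_simps power2_eq_square power_mult_distrib power_int_def nat_mult_distrib power_mult)
    have "lambert q k = real n * x / (1 - x * x)" using n by (simp add: lambert_def x_def mult_2 power_add)
    also have "\<dots> = - real n * (1 / x) / (1 - 1 / (x * x))" using x by (simp add: field_simps)
    finally show ?thesis unfolding p using n by simp
  qed (simp add: lambert_def)
qed

lemma half_coth: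
  assumes "l \<noteq> 0"
  shows "of_int l * ((1 + q powi (2 * l)) / (1 - q powi (2 * l))) / 2 = (of_int \<bar>l\<bar> / 2 + lambert_tail q l)"
proof -
  define n where "n = nat \<bar>l\<bar>"
  define x where "x = q ^ (2 * n)"
  have x: "0 < x" "x < 1" using one_minus_pow(2)[of n] q assms by (auto simp: x_def n_def)
  have t: "lambert_tail q l = real n * (x / (1 - x))" by (simp add: lambert_tail_def x_def n_def)
  have "l = int n \<or> l = - int n" by (auto simp: n_def)
  then consider "l = int n" | "l = - int n" by blast
  then show ?thesis
  proof cases
    case 1
    have p: "q powi (2 * l) = x" unfolding 1 x_def by (simp add: power_int_def nat_mult_distrib)
    have ol: "real_of_int l = real n" "real_of_int \<bar>l\<bar> = real n" using 1 by auto
    show ?thesis unfolding p ol t using x by (simp add: field_simps)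
  next
    case 2
    have p: "q powi (2 * l) = 1 / x" unfolding 2 x_def using q by (simp add: power_int_def nat_mult_distrib power_inverse divide_inverse)
    have ol: "real_of_int l = - real n" "real_of_int \<bar>l\<bar> = real n" using 2 by auto
    show ?thesis unfolding p ol t using x by (simp add: field_simps)
  qed
qed

text \<open>The addition theorem
  \<open>1 / (sinh x sinh y) = (coth x + coth y) / sinh (x + y)\<close>, with the hyperbolic cotangents split
  into their limits \<open>\<plusminus>1\<close> and exponentially small remainders.\<close>
lemma lambert_product:
  assumes "k \<noteq> 0"
  shows "lambert q l * lambert q (k - l) = lambert q k / of_int k *
     (of_int (k - l) * (of_int \<bar>l\<bar> / 2 + lambert_tail q l) + of_int l * (of_int \<bar>k - l\<bar> / 2 + lambert_tail q (k - l)))"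
proof -
  consider "l = 0" | "l = k" | "l \<noteq> 0" "l \<noteq> k" by blast
  then show ?thesis
  proof cases
    case 3
    define x y where "x = q powi (2 * l)" and "y = q powi (2 * (k - l))"
    have ne: "q powi (2 * j) \<noteq> 1" if jn: "j \<noteq> 0" for j
    proof -
      consider "j > 0" | "j < 0" using jn by linarith
      then show ?thesis
      proof cases
        case 1
        then have "q powi (2 * j) = q ^ (2 * nat j)" by (simp add: power_int_def nat_mult_distrib)
        moreover have "nat j \<ge> 1" using 1 by linarith
        ultimately show ?thesis using one_minus_pow(2)[of "nat j"] by simp
      next
        case 2
        then have "nat (- (2 * j)) = 2 * nat (- j)" by linarith
        with 2 have "q powi (2 * j) = inverse (q ^ (2 * nat (- j)))" by (simp add: power_int_def power_inverse)
        moreover have "nat (- j) \<ge> 1" using 2 by linarith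
        ultimately show ?thesis using one_minus_pow(2)[of "nat (- j)"] by simp
      qed
    qed
    have xy: "q powi (2 * k) = x * y" unfolding x_def y_def using q by (simp flip: power_int_add)
    have n: "x \<noteq> 1" "y \<noteq> 1" "x * y \<noteq> 1" using ne[of l] ne[of "k - l"] ne[of k] 3 assms unfolding xy[symmetric] by (auto simp: x_def y_def)
    have pk: "q powi k = q powi l * q powi (k - l)" using q by (simp flip: power_int_add)
    have "lambert q l * lambert q (k - l) = (of_int l * of_int (k - l)) * q powi k / ((1 - x) * (1 - y))"
      unfolding lambert_powi pk by (simp add: x_def y_def)
    also have "1 / ((1 - x) * (1 - y)) = ((1 + x) / (1 - x) + (1 + y) / (1 - y)) / 2 / (1 - x * y)"
      using n by (simp add: divide_simps) (simp add: algebra_simps)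
    then have "(of_int l * of_int (k - l)) * q powi k / ((1 - x) * (1 - y)) = (of_int l * of_int (k - l)) * q powi k * (((1 + x) / (1 - x) + (1 + y) / (1 - y)) / 2 / (1 - x * y))"
      by (metis divide_inverse mult_1 inverse_eq_divide)
    also have "\<dots> = q powi k / (1 - x * y) * (of_int (k - l) * (of_int l * ((1 + x) / (1 - x)) / 2) + of_int l * (of_int (k - l) * ((1 + y) / (1 - y)) / 2))"
      by (simp add: algebra_simps add_divide_distrib diff_divide_distrib)
    also have "q powi k / (1 - x * y) = lambert q k / of_int k" using assms by (simp add: lambert_powi xy)
    also have "of_int l * ((1 + x) / (1 - x)) / 2 = of_int \<bar>l\<bar> / 2 + lambert_tail q l"
      unfolding x_def by (rule half_coth[OF 3(1)])
    also have "of_int (k - l) * ((1 + y) / (1 - y)) / 2 = of_int \<bar>k - l\<bar> / 2 + lambert_tail q (k - l)"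
      unfolding y_def by (rule half_coth) (use 3(2) in auto)
    finally show ?thesis .
  qed (use assms in \<open>auto simp: lambert_def lambert_tail_def\<close>)
qed

text \<open>After the addition theorem the limits of the cotangents contribute a finite sum, which is
  \<open>(k\<^sup>3 - k) / 6\<close>, and the remainders contribute a multiple of \<open>k\<close>, because their first moment
  vanishes by oddness.\<close>
lemma has_sum_lambert_convolution:
  assumes "k \<noteq> 0"
  shows "((\<lambda>l. lambert q l * lambert q (k - l)) has_sum
     lambert q k * (((of_int k)\<^sup>2 - 1) / 6 + 2 * (\<Sum>\<^sub>\<infinity>l. lambert_tail q l))) UNIV"
proof -
  define E where "E = (\<Sum>\<^sub>\<infinity>l. lambert_tail q l)"
  have pos: "((\<lambda>l. lambert q l * lambert q (k - l)) has_sum lambert q k * (((of_int k)\<^sup>2 - 1) / 6 + 2 * E)) UNIV"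
    if kpos: "k > 0" for k
  proof -
    have fin: "((\<lambda>l. (of_int (k - l) * of_int \<bar>l\<bar> + of_int l * of_int \<bar>k - l\<bar>) / 2) has_sum ((of_int k) ^ 3 - real_of_int k) / 6) UNIV"
    proof (rule has_sum_finite_neutralI[where B = "{0..k}"])
      show "(of_int (k - l) * of_int \<bar>l\<bar> + of_int l * of_int \<bar>k - l\<bar>) / 2 = (0::real)" if "l \<in> UNIV - {0..k}" for l
        using that kpos by (auto simp: abs_if algebra_simps)
      have s: "(\<Sum>l\<in>{0..int n}. real_of_int (int n - l) * of_int l) = (real n ^ 3 - real n) / 6" for n
      proof -
        have "(\<Sum>l\<in>{0..int n}. real_of_int (int n - l) * of_int l) = (\<Sum>l\<le>n. (real n - real l) * real l)"
          by (rule sum.reindex_bij_witness[where i = int and j = nat]) auto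
        also have "\<dots> = real n * (\<Sum>l\<le>n. real l) - (\<Sum>l\<le>n. (real l)\<^sup>2)"
          by (simp add: algebra_simps sum_subtractf sum_distrib_left power2_eq_square)
        also have "(\<Sum>l\<le>n. real l) = real n * (real n + 1) / 2" by (induction n) (auto simp: field_simps)
        also have "(\<Sum>l\<le>n. (real l)\<^sup>2) = real n * (real n + 1) * (2 * real n + 1) / 6"
          by (induction n) (auto simp: field_simps power2_eq_square)
        finally show ?thesis by (simp add: field_simps power3_eq_cube)
      qed
      have "(\<Sum>l\<in>{0..k}. (of_int (k - l) * of_int \<bar>l\<bar> + of_int l * of_int \<bar>k - l\<bar>) / 2) = (\<Sum>l\<in>{0..k}. real_of_int (k - l) * of_int l)"
        by (intro sum.cong) auto
      then show "((of_int k) ^ 3 - of_int k) / 6 = (\<Sum>l\<in>{0..k}. (of_int (k - l) * of_int \<bar>l\<bar> + of_int l * of_int \<bar>k - l\<bar>) / 2 :: real)"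
        using s[of "nat k"] kpos by simp
    qed auto
    have t1: "(lambert_tail q has_sum E) UNIV" unfolding E_def by (rule has_sum_infsum[OF decays_summable[OF decays_lambert_tail]])
    have t2: "((\<lambda>l. of_int l * lambert_tail q l) has_sum 0) UNIV"
    proof -
      have "(\<lambda>l. of_int l * lambert_tail q l) summable_on UNIV"
        by (rule decays_summable[OF decays_of_int_mult[OF decays_lambert_tail]])
      then obtain S where S: "((\<lambda>l. of_int l * lambert_tail q l) has_sum S) UNIV" by (auto simp: summable_on_def)
      have "((\<lambda>l. of_int (- l) * lambert_tail q (- l)) has_sum S) UNIV"
        using S by (subst has_sum_reindex_bij_betw[of uminus UNIV UNIV]) (auto intro!: bij_betwI[where g = uminus])
      then have "((\<lambda>l. - (of_int l * lambert_tail q l)) has_sum S) UNIV" by (simp add: lambert_tail_def)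
      from has_sum_unique[OF has_sum_uminusI[OF this, simplified] S] have "S = 0" by simp
      then show ?thesis using S by simp
    qed
    have t3: "((\<lambda>l. of_int (k - l) * lambert_tail q l) has_sum of_int k * E) UNIV"
      using has_sum_add[OF has_sum_cmult_right[OF t1, of "of_int k"] has_sum_uminusI[OF t2]] by (simp add: algebra_simps)
    have t4: "((\<lambda>l. of_int l * lambert_tail q (k - l)) has_sum of_int k * E) UNIV"
      using t3 by (subst (asm) has_sum_reindex_bij_betw[of "\<lambda>l. k - l" UNIV UNIV, symmetric]) (auto intro!: bij_betwI[where g = "\<lambda>l. k - l"])
    have "((\<lambda>l. lambert q k / of_int k * ((of_int (k - l) * of_int \<bar>l\<bar> + of_int l * of_int \<bar>k - l\<bar>) / 2 + (of_int (k - l) * lambert_tail q l + of_int l * lambert_tail q (k - l))))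
        has_sum lambert q k / of_int k * (((of_int k) ^ 3 - of_int k) / 6 + (of_int k * E + of_int k * E))) UNIV"
      by (intro has_sum_cmult_right has_sum_add fin t3 t4)
    also have "lambert q k / of_int k * (((of_int k) ^ 3 - of_int k) / 6 + (of_int k * E + of_int k * E)) = lambert q k * (((of_int k)\<^sup>2 - 1) / 6 + 2 * E)"
      using kpos by (simp add: field_simps power3_eq_cube power2_eq_square)
    also have "(\<lambda>l. lambert q k / of_int k * ((of_int (k - l) * of_int \<bar>l\<bar> + of_int l * of_int \<bar>k - l\<bar>) / 2 + (of_int (k - l) * lambert_tail q l + of_int l * lambert_tail q (k - l))))
        = (\<lambda>l. lambert q l * lambert q (k - l))"
      using kpos by (simp add: fun_eq_iff lambert_product field_simps)
    finally show ?thesis .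
  qed
  have "((\<lambda>l. lambert q l * lambert q (k - l)) has_sum lambert q k * (((of_int k)\<^sup>2 - 1) / 6 + 2 * E)) UNIV"
  proof (cases "k > 0")
    case False
    have ev: "lambert q (- l) = lambert q l" for l by (simp add: lambert_def)
    have "((\<lambda>l. lambert q (- l) * lambert q (- k - (- l))) has_sum lambert q (- k) * (((of_int (- k))\<^sup>2 - 1) / 6 + 2 * E)) UNIV"
      using pos[of "- k"] False assms by (subst has_sum_reindex_bij_betw[of uminus UNIV UNIV]) (auto intro!: bij_betwI[where g = uminus])
    moreover have "lambert q (- k - (- l)) = lambert q (k - l)" for l using ev[of "k - l"] by simp
    ultimately show ?thesis by (simp add: ev)
  qed (rule pos)
  then show ?thesis by (simp add: E_def)
qed

end

section \<open>The one-gap profile as a fixed point\<close>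

lemma mode_multiplier:
  assumes "multiplier_bound B \<phi>" "0 \<le> r" "r \<le> 1"
  shows "mode r k (multiplier \<phi> X) = of_real (\<phi> k) * mode r k X"
proof -
  let ?\<psi> = "\<lambda>(i, j). if int i - int j = k then complex_of_real r ^ (i + j) else 0"
  have w: "\<And>p. norm (?\<psi> p) \<le> 1" by (rule mode_weight[OF assms(2,3)])
  have "((\<lambda>p. of_real (coef (multiplier \<phi> X) p) * ?\<psi> p) has_sum mode r k (multiplier \<phi> X)) UNIV"
    unfolding mode_def by (rule has_sum_pair[OF w])
  moreover have "(\<lambda>p. of_real (coef (multiplier \<phi> X) p) * ?\<psi> p) = (\<lambda>p. of_real (\<phi> k) * (of_real (coef X p) * ?\<psi> p))"
    by (auto simp: fun_eq_iff coef_multiplier[OF assms(1)])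
  moreover have "((\<lambda>p. of_real (\<phi> k) * (of_real (coef X p) * ?\<psi> p)) has_sum of_real (\<phi> k) * mode r k X) UNIV"
    unfolding mode_def by (rule has_sum_cmult_right[OF has_sum_pair[OF w]])
  ultimately show ?thesis by (simp only: has_sum_unique)
qed

lemma mode_diag:
  assumes "diag K" "0 \<le> r" "r \<le> 1" "k \<noteq> 0"
  shows "mode r k K = 0"
  unfolding mode_def pair_def
  by (rule infsum_0) (use assms in \<open>auto simp: diag_def split: if_splits\<close>)

lemma mode_diag_mult:
  assumes "diag K" "0 \<le> r" "r \<le> 1"
  shows "mode r k (K * X) = mode r 0 K * mode r k X"
proof -
  have "((\<lambda>l. mode r l K * mode r (k - l) X) has_sum mode r k (K * X)) UNIV"
    by (rule has_sum_mode_mult[OF assms(2,3)])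
  moreover have "((\<lambda>l. mode r l K * mode r (k - l) X) has_sum mode r 0 K * mode r k X) UNIV"
    by (rule has_sum_finite_neutralI[where B = "{0}"]) (auto simp: mode_diag[OF assms])
  ultimately show ?thesis by (rule has_sum_unique)
qed

lemma has_sum_mode_shift:
  assumes "0 \<le> r" "r \<le> 1"
  shows "((\<lambda>j. of_real (coef X (j + k, j) * r ^ (2 * j + k))) has_sum mode r (int k) X) UNIV"
proof -
  have "((\<lambda>p. of_real (coef X p) * (case p of (i, j) \<Rightarrow> if int i - int j = int k then complex_of_real r ^ (i + j) else 0)) has_sum mode r (int k) X) UNIV"
    unfolding mode_def by (rule has_sum_pair) (rule mode_weight[OF assms])
  then have "((\<lambda>p. of_real (coef X p) * complex_of_real r ^ (fst p + snd p)) has_sum mode r (int k) X) (range (\<lambda>j. (j + k, j)))"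
  proof (rule has_sum_cong_neutral[THEN iffD1, rotated -1])
    have iff: "p \<in> range (\<lambda>j. (j + k, j)) \<longleftrightarrow> int (fst p) - int (snd p) = int k" for p :: "nat \<times> nat"
      by (cases p) (auto simp: image_iff)
    show "complex_of_real (coef X p) * (case p of (i, j) \<Rightarrow> if int i - int j = int k then complex_of_real r ^ (i + j) else 0) = 0"
      if "p \<in> UNIV - range (\<lambda>j. (j + k, j))" for p using that iff[of p] by (auto split: prod.splits)
    show "complex_of_real (coef X p) * (case p of (i, j) \<Rightarrow> if int i - int j = int k then complex_of_real r ^ (i + j) else 0) = of_real (coef X p) * complex_of_real r ^ (fst p + snd p)"
      if "p \<in> UNIV \<inter> range (\<lambda>j. (j + k, j))" for p using that iff[of p] by (auto split: prod.splits)
  qed auto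
  then have "(((\<lambda>p. of_real (coef X p) * complex_of_real r ^ (fst p + snd p)) \<circ> (\<lambda>j. (j + k, j))) has_sum mode r (int k) X) UNIV"
    by (subst (asm) has_sum_reindex) (auto simp: inj_on_def)
  moreover have "(\<lambda>p. of_real (coef X p) * complex_of_real r ^ (fst p + snd p)) \<circ> (\<lambda>j. (j + k, j)) = (\<lambda>j. of_real (coef X (j + k, j) * r ^ (2 * j + k)))"
    by (simp add: fun_eq_iff mult_2 add_ac)
  ultimately show ?thesis by (simp only:)
qed

text \<open>On the level of functions of \<open>r\<close>, \<open>tau\<close> divides the first mode by \<open>r\<close>.\<close>
lemma mode_tau:
  assumes "0 \<le> r" "r \<le> 1"
  shows "of_real r * mode r 0 (tau X) = mode r 1 X"
proof -
  have "((\<lambda>j. of_real r * of_real (coef (tau X) (j + 0, j) * r ^ (2 * j + 0))) has_sum of_real r * mode r (int 0) (tau X)) UNIV"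
    by (rule has_sum_cmult_right[OF has_sum_mode_shift[OF assms]])
  moreover have "(\<lambda>j. of_real r * of_real (coef (tau X) (j + 0, j) * r ^ (2 * j + 0))) = (\<lambda>j. complex_of_real (coef X (j + 1, j) * r ^ (2 * j + 1)))"
    by (simp add: fun_eq_iff mult_ac)
  ultimately show ?thesis using has_sum_unique[OF _ has_sum_mode_shift[OF assms, of X 1]] by simp
qed

lemma mode_swapw:
  assumes "0 \<le> r" "r \<le> 1"
  shows "mode r k (swapw X) = mode r (- k) X"
proof -
  let ?g = "\<lambda>p. of_real (coef X p) * (case p of (i, j) \<Rightarrow> if int i - int j = - k then complex_of_real r ^ (i + j) else 0)"
  have "mode r k (swapw X) = (\<Sum>\<^sub>\<infinity>p. ?g (prod.swap p))"
    unfolding mode_def pair_def by (rule infsum_cong) (auto simp: add.commute split: if_splits)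
  also have "\<dots> = infsum ?g UNIV" by (rule infsum_reindex_bij_betw) simp
  finally show ?thesis by (simp add: mode_def pair_def)
qed

lemma powser_zero:
  fixes e :: "nat \<Rightarrow> real"
  assumes s: "summable (\<lambda>j. \<bar>e j\<bar>)" and z: "\<And>x. 0 < x \<Longrightarrow> x < 1 \<Longrightarrow> (\<lambda>j. e j * x ^ j) sums 0"
  shows "e n = 0"
proof (induction n rule: less_induct)
  case (less n)
  define f where "f x = (\<Sum>j. e (j + n) * x ^ j)" for x
  have "(\<lambda>j. e (j + n) * x ^ j) sums f x" if "norm x < 1" for x
    unfolding f_def
  proof (rule summable_sums, rule summable_comparison_test)
    show "summable (\<lambda>j. \<bar>e (j + n)\<bar>)" using s by (subst summable_iff_shift)
    show "\<exists>N. \<forall>j\<ge>N. norm (e (j + n) * x ^ j) \<le> \<bar>e (j + n)\<bar>"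
      using that by (auto simp: abs_mult power_abs intro!: mult_left_le power_le_one exI[of _ 0])
  qed
  then have "(f \<longlongrightarrow> e (0 + n)) (at 0)" by (intro powser_limit_0[of 1]) auto
  then have lim: "(f \<longlongrightarrow> e n) (at_right 0)" by (simp add: filterlim_at_split)
  have "f x = 0" if x: "0 < x" "x < 1" for x
  proof -
    have "(\<lambda>j. e (j + n) * x ^ (j + n)) sums (0 - (\<Sum>j<n. e j * x ^ j))"
      using sums_iff_shift[of "\<lambda>j. e j * x ^ j" n "0 - (\<Sum>j<n. e j * x ^ j)"] z[OF x] by simp
    then have "(\<lambda>j. e (j + n) * x ^ j * x ^ n) sums 0" using less by (simp add: power_add mult_ac)
    then have "(\<lambda>j. e (j + n) * x ^ j * x ^ n / x ^ n) sums (0 / x ^ n)" by (rule sums_divide)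
    then show ?thesis using x by (simp add: f_def sums_iff)
  qed
  then have "eventually (\<lambda>x. f x = 0) (at_right 0)"
    by (intro eventually_at_rightI[of 0 1]) auto
  then have "((\<lambda>_. 0) \<longlongrightarrow> e n) (at_right (0::real))"
    by (rule Lim_transform_eventually[OF lim])
  then show "e n = 0" by (simp add: tendsto_const_iff)
qed

text \<open>The monomials of a given mode have distinct degrees, so an element is determined by its modes as
  functions of \<open>r\<close>. This transfers identities between numbers to the algebra.\<close>
lemma mode_zero_imp:
  assumes "\<And>r k. 0 < r \<Longrightarrow> r < 1 \<Longrightarrow> mode r (int k) X = 0" "swapw X = X"
  shows "X = 0"
proof -
  have "coef X (j + k, j) = 0" for j k
  proof (rule powser_zero[where e = "\<lambda>j. coef X (j + k, j)"])
    show "summable (\<lambda>j. \<bar>coef X (j + k, j)\<bar>)"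
    proof (rule summable_on_imp_summable)
      have "(\<lambda>p. \<bar>coef X p\<bar>) summable_on range (\<lambda>j. (j + k, j))"
        by (rule summable_on_subset_banach[OF coef_summable']) auto
      then show "(\<lambda>j. \<bar>coef X (j + k, j)\<bar>) summable_on UNIV"
        by (subst (asm) summable_on_reindex) (auto simp: inj_on_def o_def)
    qed
    fix x :: real assume x: "0 < x" "x < 1"
    define r where "r = sqrt x"
    have r: "0 < r" "r < 1" "r ^ 2 = x" using x by (auto simp: r_def)
    have "((\<lambda>j. of_real (coef X (j + k, j) * r ^ (2 * j + k))) has_sum complex_of_real 0) UNIV"
      using has_sum_mode_shift[of r X k] assms(1)[of r k] r by simp
    then have "(\<lambda>j. coef X (j + k, j) * r ^ (2 * j + k)) sums 0"
      by (subst (asm) has_sum_of_real_iff) (rule has_sum_imp_sums)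
    then have "(\<lambda>j. coef X (j + k, j) * r ^ (2 * j + k) / r ^ k) sums (0 / r ^ k)" by (rule sums_divide)
    moreover have "coef X (j + k, j) * r ^ (2 * j + k) / r ^ k = coef X (j + k, j) * x ^ j" for j
      using r by (simp add: power_add power_mult)
    ultimately show "(\<lambda>j. coef X (j + k, j) * x ^ j) sums 0" by simp
  qed
  then have z: "coef X (i, j) = 0" if "j \<le> i" for i j using that by (metis le_add_diff_inverse add.commute)
  show ?thesis
  proof (rule wiener_eqI)
    fix p :: "nat \<times> nat"
    have "coef X p = coef X (prod.swap p)" using arg_cong[OF assms(2), of "\<lambda>X. coef X p"] by simp
    then show "coef X p = coef 0 p" using z[of "snd p" "fst p"] z[of "fst p" "snd p"]
      by (cases p; cases "fst p \<le> snd p") auto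
  qed
qed

context wave
begin

definition amp :: real where "amp = 12 * m\<^sup>2 * \<theta>\<^sup>2"

lemma amp: "amp > 0" using m \<theta> by (simp add: amp_def)

text \<open>The double power series of \<open>\<Phi>\<close> for the one-gap profile, obtained by expanding
  \<open>1 / (1 - q\<^sup>2\<^sup>d)\<close> geometrically at \<open>q = r\<close>: the mode \<open>d\<close> contributes the monomials
  \<open>a\<^sup>d\<^sup>(\<^sup>t\<^sup>+\<^sup>1\<^sup>) b\<^sup>d\<^sup>t\<close>. The variables are rescaled by \<open>\<rho>\<close>.\<close>
definition cn_coef :: "real \<Rightarrow> nat \<times> nat \<Rightarrow> real" where
  "cn_coef \<rho> = (\<lambda>(i, j). let d = nat \<bar>int i - int j\<bar> in
     if d \<noteq> 0 \<and> d dvd min i j then amp * (-1) ^ d * real d ^ 3 * \<rho> ^ (i + j) else 0)"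

definition cn :: "real \<Rightarrow> wiener" where "cn \<rho> = of_coef (cn_coef \<rho>)"

text \<open>The cube of \<open>d\<close> is at most \<open>8\<^sup>i\<^sup>+\<^sup>j\<close>, so \<open>\<rho> \<le> 1/16\<close> leaves a geometric majorant.\<close>
lemma cn_coef_bound:
  assumes "0 < \<rho>" "\<rho> \<le> 1/16"
  shows "\<bar>cn_coef \<rho> (i, j)\<bar> \<le> amp * (1/2) ^ (i + j)"
proof -
  define d where "d = nat \<bar>int i - int j\<bar>"
  have d: "d \<le> i + j" by (simp add: d_def)
  have "real d ^ 3 \<le> (2 ^ (i + j)) ^ 3"
    using order_trans[OF of_nat_mono[OF d] nat_le_two_power] by (intro power_mono) auto
  also have "\<dots> = ((2::real) ^ 3) ^ (i + j)" by (simp only: power_mult[symmetric] mult.commute)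
  also have "\<dots> = 8 ^ (i + j)" by simp
  finally have "real d ^ 3 * \<rho> ^ (i + j) \<le> 8 ^ (i + j) * (1/16) ^ (i + j)"
    using assms by (intro mult_mono power_mono) auto
  also have "\<dots> = (1/2) ^ (i + j)" by (simp flip: power_mult_distrib)
  finally have "amp * (real d ^ 3 * \<rho> ^ (i + j)) \<le> amp * (1/2) ^ (i + j)"
    using amp by (intro mult_left_mono) auto
  then show ?thesis using amp assms by (auto simp: cn_coef_def d_def[symmetric] abs_mult Let_def)
qed

context
  fixes \<rho> :: real assumes \<rho>: "0 < \<rho>" "\<rho> \<le> 1/16"
begin

lemma coef_cn: "coef (cn \<rho>) = cn_coef \<rho>"
  unfolding cn_def by (rule coef_of_coef[OF abs_summable_geometric(1)[OF cn_coef_bound[OF \<rho>]]])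

lemma cn_coef_sym: "cn_coef \<rho> (j, i) = cn_coef \<rho> (i, j)"
  unfolding cn_coef_def prod.case
  by (simp only: abs_minus_commute[of "int i" "int j"] min.commute[of i j] add.commute[of i j])

lemma swapw_cn: "swapw (cn \<rho>) = cn \<rho>"
  by (rule wiener_eqI) (auto simp: coef_cn cn_coef_sym)

lemma mode_cn_pos:
  assumes r: "0 < r" "r < 1" and k: "k \<ge> 1"
  shows "mode r (int k) (cn \<rho>) = of_real (amp * (-1) ^ k * (real k)\<^sup>2 * lambert (\<rho> * r) (int k))"
proof -
  define q where "q = \<rho> * r"
  have q: "0 < q" "q < 1" using \<rho> r mult_strict_mono[of \<rho> 1 r 1] by (auto simp: q_def)
  have q2: "q ^ (2 * k) < 1" by (rule one_minus_pow(2)[OF q k])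
  have "((\<lambda>j. of_real (coef (cn \<rho>) (j + k, j) * r ^ (2 * j + k))) has_sum mode r (int k) (cn \<rho>)) UNIV"
    by (rule has_sum_mode_shift) (use r in auto)
  then have "((\<lambda>j. complex_of_real (coef (cn \<rho>) (j + k, j) * r ^ (2 * j + k))) has_sum mode r (int k) (cn \<rho>)) (range (\<lambda>t. k * t))"
    by (rule has_sum_cong_neutral[THEN iffD1, rotated -1]) (auto simp: coef_cn cn_coef_def image_iff elim!: dvdE)
  then have "((\<lambda>t. complex_of_real (coef (cn \<rho>) (k * t + k, k * t) * r ^ (2 * (k * t) + k))) has_sum mode r (int k) (cn \<rho>)) UNIV"
    by (subst (asm) has_sum_reindex) (use k in \<open>auto simp: inj_on_def o_def\<close>)
  moreover have "coef (cn \<rho>) (k * t + k, k * t) * r ^ (2 * (k * t) + k) = amp * (-1) ^ k * real k ^ 3 * q ^ k * (q ^ (2 * k)) ^ t" for t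
    using k by (simp add: coef_cn cn_coef_def q_def power_mult_distrib power_add power_mult power2_eq_square mult_ac nat_diff_distrib')
  ultimately have "((\<lambda>t. complex_of_real (amp * (-1) ^ k * real k ^ 3 * q ^ k * (q ^ (2 * k)) ^ t)) has_sum mode r (int k) (cn \<rho>)) UNIV"
    by (simp only:)
  moreover have "((\<lambda>t. complex_of_real (amp * (-1) ^ k * real k ^ 3 * q ^ k * (q ^ (2 * k)) ^ t)) has_sum of_real (amp * (-1) ^ k * real k ^ 3 * q ^ k * (1 / (1 - q ^ (2 * k))))) UNIV"
  proof (intro has_sum_of_real has_sum_cmult_right sums_nonneg_imp_has_sum)
    show "(\<lambda>t. (q ^ (2 * k)) ^ t) sums (1 / (1 - q ^ (2 * k)))" using q q2 by (intro geometric_sums) auto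
  qed (use q in auto)
  ultimately have "mode r (int k) (cn \<rho>) = of_real (amp * (-1) ^ k * real k ^ 3 * q ^ k * (1 / (1 - q ^ (2 * k))))"
    by (rule has_sum_unique)
  then show ?thesis by (simp add: lambert_def q_def power3_eq_cube power2_eq_square mult_ac)
qed

lemma mode_cn:
  assumes r: "0 < r" "r < 1"
  shows "mode r k (cn \<rho>) = of_real (amp * (-1) ^ nat \<bar>k\<bar> * (of_int k)\<^sup>2 * lambert (\<rho> * r) k)"
proof -
  have sw: "mode r (- k) (cn \<rho>) = mode r k (cn \<rho>)" for k
    using mode_swapw[of r k "cn \<rho>"] r by (simp add: swapw_cn)
  have ev: "lambert q (- k) = lambert q k" for q k by (simp add: lambert_def)
  show ?thesis
  proof (cases k rule: int_cases3)
    case zero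
    have "mode r 0 (cn \<rho>) = 0"
      unfolding mode_def pair_def by (rule infsum_0) (auto simp: coef_cn cn_coef_def Let_def split: if_splits)
    then show ?thesis using zero by simp
  next
    case (pos n)
    then show ?thesis using mode_cn_pos[OF r, of n] by simp
  next
    case (neg n)
    then show ?thesis using mode_cn_pos[OF r, of n] sw[of "int n"] ev[of _ "int n"] by simp
  qed
qed

end

definition cn_primary :: "real \<Rightarrow> wiener" where "cn_primary \<rho> = multiplier primary (cn \<rho>)"
definition cn_outer :: "real \<Rightarrow> wiener" where "cn_outer \<rho> = multiplier outer (cn \<rho>)"
text \<open>The reciprocal of \<open>tau (cn_primary \<rho>)\<close>. The latter is the geometric series
  \<open>- amp \<rho> / (1 - \<rho>\<^sup>2 ab)\<close>, so the reciprocal is a polynomial.\<close>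
definition cn_divisor :: "real \<Rightarrow> wiener" where
  "cn_divisor \<rho> = of_coef (\<lambda>p. if p = (0, 0) then - 1 / (amp * \<rho>) else if p = (1, 1) then \<rho> / amp else 0)"

text \<open>The Taylor coefficients of \<open>u\<^sup>2/2\<close>, the nonlinearity of the unperturbed equation.\<close>
definition kdv :: "(jetvar \<Rightarrow> nat) \<Rightarrow> real" where "kdv = single 2 (1/2)"

lemma nlin_kdv: "nlin kdv T = (1/2) *\<^sub>R (T D0)\<^sup>2"
  by (simp add: kdv_def nlin_single)

lemma majorised_kdv: "\<epsilon> > 0 \<Longrightarrow> majorised \<epsilon> kdv"
  by (simp add: kdv_def majorised_single)

lemma kdv_deg: "deg \<alpha> < 2 \<Longrightarrow> kdv \<alpha> = 0" and kdv_parity: "odd (parity \<alpha>) \<Longrightarrow> kdv \<alpha> = 0"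
  by (auto simp: kdv_def single_def)

context
  fixes \<rho> :: real assumes \<rho>: "0 < \<rho>" "\<rho> \<le> 1/16"
begin

lemma cn_primary_plus_outer: "cn_primary \<rho> + cn_outer \<rho> = cn \<rho>"
proof (rule wiener_eqI)
  fix p :: "nat \<times> nat"
  obtain i j where [simp]: "p = (i, j)" by (cases p)
  have "coef (cn \<rho>) (i, j) = 0" if "int i - int j = 0"
    using that by (simp add: coef_cn[OF \<rho>] cn_coef_def)
  moreover consider "\<bar>int i - int j\<bar> = 1" | "\<bar>int i - int j\<bar> \<ge> 2" | "i = j" by linarith
  ultimately show "coef (cn_primary \<rho> + cn_outer \<rho>) p = coef (cn \<rho>) p"
    by cases (auto simp: cn_primary_def cn_outer_def coef_primary coef_outer primary_def outer_def)
qed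

lemma primary_cn_primary: "multiplier primary (cn_primary \<rho>) = cn_primary \<rho>"
  unfolding cn_primary_def by (rule wiener_eqI) (auto simp: coef_primary primary_def)

lemma outer_cn_outer: "multiplier outer (cn_outer \<rho>) = cn_outer \<rho>"
  unfolding cn_outer_def by (rule wiener_eqI) (auto simp: coef_outer outer_def)

lemma swapw_cn_primary: "swapw (cn_primary \<rho>) = cn_primary \<rho>"
  using multiplier_swapw[OF primary_le, of 1 "cn \<rho>"] by (simp add: cn_primary_def primary_def swapw_cn[OF \<rho>])

lemma swapw_cn_outer: "swapw (cn_outer \<rho>) = cn_outer \<rho>"
  using multiplier_swapw[OF outer_le, of 1 "cn \<rho>"] by (simp add: cn_outer_def outer_def swapw_cn[OF \<rho>])

lemma coef_cn_primary: "coef (cn_primary \<rho>) (i, j) = (if i = Suc j \<or> j = Suc i then - amp * \<rho> ^ (i + j) else 0)"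
proof -
  consider "i = Suc j" | "j = Suc i" | "\<bar>int i - int j\<bar> \<noteq> 1" by linarith
  then show ?thesis
    by cases (auto simp: cn_primary_def coef_primary primary_def coef_cn[OF \<rho>] cn_coef_def)
qed

lemma norm_of_bound:
  assumes "\<And>i j. \<bar>coef X (i, j)\<bar> \<le> C * (1/2) ^ (i + j)"
  shows "norm X \<le> 4 * C"
  using abs_summable_geometric(2)[of "coef X" C] assms by (simp add: norm_wiener_def)

lemma norm_cn_primary: "norm (cn_primary \<rho>) \<le> 8 * amp * \<rho>"
proof -
  have "\<bar>coef (cn_primary \<rho>) (i, j)\<bar> \<le> (2 * amp * \<rho>) * (1/2) ^ (i + j)" for i j
  proof (cases "i = Suc j \<or> j = Suc i")
    case True
    then obtain n where n: "i + j = Suc n" by (cases i; cases j) auto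
    have "\<rho> ^ n \<le> (1/2) ^ n" using \<rho> by (intro power_mono) auto
    then have "amp * (\<rho> * \<rho> ^ n) \<le> amp * (\<rho> * (1/2) ^ n)" using amp \<rho> by (intro mult_left_mono) auto
    then show ?thesis using True amp \<rho> by (simp add: coef_cn_primary n abs_mult)
  qed (use amp \<rho> in \<open>auto simp: coef_cn_primary\<close>)
  from norm_of_bound[OF this] show ?thesis by simp
qed

lemma cn_divisor_bound: "\<bar>(if (i, j) = (0, 0) then - 1 / (amp * \<rho>) else if (i, j) = (1, 1) then \<rho> / amp else 0)\<bar> \<le> (4 / (amp * \<rho>)) * (1/2) ^ (i + j)"
proof -
  have "\<rho> * \<rho> \<le> 1 * 1" using \<rho> by (intro mult_mono) auto
  then have "\<rho> / amp \<le> 1 / (amp * \<rho>)" using \<rho> amp by (simp add: field_simps)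
  moreover have "1 / (amp * \<rho>) \<le> 4 / (amp * \<rho>)" using \<rho> amp by (simp add: divide_right_mono)
  ultimately show ?thesis using \<rho> amp by (auto simp: power2_eq_square abs_mult)
qed

lemma coef_cn_divisor: "coef (cn_divisor \<rho>) p = (if p = (0, 0) then - 1 / (amp * \<rho>) else if p = (1, 1) then \<rho> / amp else 0)"
proof -
  have "(\<lambda>p :: nat \<times> nat. if p = (0, 0) then - 1 / (amp * \<rho>) else if p = (1, 1) then \<rho> / amp else 0) abs_summable_on UNIV"
    by (rule abs_summable_geometric(1)) (rule cn_divisor_bound)
  then show ?thesis unfolding cn_divisor_def by (simp add: coef_of_coef)
qed

lemma norm_cn_divisor: "norm (cn_divisor \<rho>) \<le> 16 / (amp * \<rho>)"
  using norm_of_bound[of "cn_divisor \<rho>" "4 / (amp * \<rho>)"] cn_divisor_bound by (simp add: coef_cn_divisor)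

lemma diag_cn_divisor: "diag (cn_divisor \<rho>)"
  by (simp add: diag_def coef_cn_divisor)

lemma cn_divisor_tau: "cn_divisor \<rho> * tau (cn_primary \<rho>) = 1"
proof (rule wiener_eqI)
  fix p :: "nat \<times> nat"
  obtain i j where p: "p = (i, j)" by (cases p)
  show "coef (cn_divisor \<rho> * tau (cn_primary \<rho>)) p = coef 1 p"
  proof (cases "i = j")
    case False
    have "diag (cn_divisor \<rho> * tau (cn_primary \<rho>))" by (rule diag_mult[OF diag_cn_divisor diag_tau])
    then show ?thesis using False by (auto simp: p diag_def zero_prod_def)
  next
    case True
    have eq: "coef (cn_divisor \<rho> * tau (cn_primary \<rho>)) p = (\<Sum>n\<le>i. coef (cn_divisor \<rho>) (n, n) * (- amp * \<rho> ^ (2 * (i - n) + 1)))"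
      using True by (simp add: p coef_diag_mult[OF diag_cn_divisor] coef_cn_primary mult_2)
    show ?thesis
    proof (cases i)
      case 0
      then show ?thesis using True amp \<rho> unfolding eq by (simp add: p coef_cn_divisor zero_prod_def)
    next
      case (Suc l)
      have "(\<Sum>n\<le>i. coef (cn_divisor \<rho>) (n, n) * (- amp * \<rho> ^ (2 * (i - n) + 1))) = (\<Sum>n\<in>{0,1}. coef (cn_divisor \<rho>) (n, n) * (- amp * \<rho> ^ (2 * (i - n) + 1)))"
        by (rule sum.mono_neutral_right) (auto simp: Suc coef_cn_divisor)
      also have "\<dots> = 0" using amp \<rho> by (simp add: coef_cn_divisor Suc field_simps)
      finally show ?thesis unfolding eq using Suc True by (simp add: p zero_prod_def)
    qed
  qed
qed

lemma mode_cn_profile: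
  assumes r: "0 < r" "r < 1"
  shows "mode r k (multiplier dinv2 (cn \<rho>)) = of_real (amp * (-1) ^ nat \<bar>k\<bar> * lambert (\<rho> * r) k)"
  using r by (cases "k = 0") (auto simp: mode_multiplier[OF dinv2_le] mode_cn[OF \<rho> r] dinv2_def lambert_def)

lemma mode_cn_square:
  assumes r: "0 < r" "r < 1" and k: "k \<noteq> 0"
  shows "mode r k ((multiplier dinv2 (cn \<rho>))\<^sup>2) =
    of_real (amp\<^sup>2 * (-1) ^ nat \<bar>k\<bar> * (lambert (\<rho> * r) k * (((of_int k)\<^sup>2 - 1) / 6 + 2 * (\<Sum>\<^sub>\<infinity>l. lambert_tail (\<rho> * r) l))))"
proof -
  define q where "q = \<rho> * r"
  have q: "0 < q" "q < 1" using \<rho> r mult_strict_mono[of \<rho> 1 r 1] by (auto simp: q_def)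
  let ?f = "multiplier dinv2 (cn \<rho>)"
  have sgn: "(-1 :: real) ^ nat \<bar>l\<bar> * (-1) ^ nat \<bar>k - l\<bar> = (-1) ^ nat \<bar>k\<bar>" for l
    by (auto simp: minus_one_power_iff even_nat_iff)
  have "((\<lambda>l. mode r l ?f * mode r (k - l) ?f) has_sum mode r k (?f\<^sup>2)) UNIV"
    unfolding power2_eq_square by (rule has_sum_mode_mult) (use r in auto)
  moreover have "(\<lambda>l. mode r l ?f * mode r (k - l) ?f) = (\<lambda>l. of_real (amp\<^sup>2 * (-1) ^ nat \<bar>k\<bar> * (lambert q l * lambert q (k - l))))"
  proof
    fix l
    have "mode r l ?f * mode r (k - l) ?f = of_real (amp\<^sup>2 * ((-1) ^ nat \<bar>l\<bar> * (-1) ^ nat \<bar>k - l\<bar>) * (lambert q l * lambert q (k - l)))"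
      by (simp only: mode_cn_profile[OF r] q_def of_real_mult[symmetric] power2_eq_square) (simp only: ac_simps)
    then show "mode r l ?f * mode r (k - l) ?f = of_real (amp\<^sup>2 * (-1) ^ nat \<bar>k\<bar> * (lambert q l * lambert q (k - l)))"
      by (simp only: sgn)
  qed
  ultimately have "((\<lambda>l. of_real (amp\<^sup>2 * (-1) ^ nat \<bar>k\<bar> * (lambert q l * lambert q (k - l)))) has_sum mode r k (?f\<^sup>2)) UNIV" by simp
  moreover have "((\<lambda>l. complex_of_real (amp\<^sup>2 * (-1) ^ nat \<bar>k\<bar> * (lambert q l * lambert q (k - l)))) has_sum
     of_real (amp\<^sup>2 * (-1) ^ nat \<bar>k\<bar> * (lambert q k * (((of_int k)\<^sup>2 - 1) / 6 + 2 * (\<Sum>\<^sub>\<infinity>l. lambert_tail q l))))) UNIV"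
    by (intro has_sum_of_real has_sum_cmult_right has_sum_lambert_convolution q k)
  ultimately show ?thesis unfolding q_def by (rule has_sum_unique)
qed

text \<open>By \<open>mode_zero_imp\<close> it suffices to compare modes at each \<open>r\<close>. There the convolution identity
  evaluates the square of the profile, its first mode gives \<open>\<kappa> = -m amp E\<close>, and the terms with
  \<open>E\<close> cancel in all other modes.\<close>
lemma cn_fixed_point: "wave_map kdv (cn_divisor \<rho>) (cn_primary \<rho>) (cn_outer \<rho>) = cn_outer \<rho>"
proof -
  let ?\<kappa> = "speed_shift kdv (cn_divisor \<rho>) (cn_primary \<rho>) (cn_outer \<rho>)"
  define N where "N = nlin kdv (jets (cn \<rho>))"
  define F where "F = wave_map kdv (cn_divisor \<rho>) (cn_primary \<rho>) (cn_outer \<rho>)"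
  have N: "N = (1/2) *\<^sub>R (multiplier dinv2 (cn \<rho>))\<^sup>2" by (simp add: N_def nlin_kdv jets_D0)
  have \<kappa>: "?\<kappa> = - m *\<^sub>R (cn_divisor \<rho> * tau N)" by (simp add: speed_shift_def cn_primary_plus_outer N_def)
  have d\<kappa>: "diag ?\<kappa>" by (rule diag_speed_shift[OF diag_cn_divisor])
  have "swapw F = F" unfolding F_def
  proof (rule swapw_wave_map)
    show "majorised (jet_const * norm (cn \<rho>) + 1) kdv" using jet_const by (intro majorised_kdv) (simp add: add_nonneg_pos)
  qed (auto simp: kdv_parity swapw_cn_primary swapw_cn_outer diag_cn_divisor cn_primary_plus_outer)
  have "F - cn_outer \<rho> = 0"
  proof (rule mode_zero_imp)
    show "swapw (F - cn_outer \<rho>) = F - cn_outer \<rho>" by (simp add: linear_swapw swapw_cn_outer \<open>swapw F = F\<close>)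
    fix r :: real and n :: nat assume r: "0 < r" "r < 1"
    define k where "k = int n"
    define q where "q = \<rho> * r"
    have q: "0 < q" "q < 1" using \<rho> r mult_strict_mono[of \<rho> 1 r 1] by (auto simp: q_def)
    define E where "E = (\<Sum>\<^sub>\<infinity>l. lambert_tail q l)"
    have r': "0 \<le> r" "r \<le> 1" using r by auto
    interpret M: bounded_linear "mode r l" for l by (rule bounded_linear_mode[OF r'])
    have mN: "mode r k N = of_real (1/2 * (amp\<^sup>2 * (-1) ^ nat \<bar>k\<bar> * (lambert q k * (((of_int k)\<^sup>2 - 1) / 6 + 2 * E))))" if "k \<noteq> 0" for k
      unfolding N M.scaleR mode_cn_square[OF r that] q_def E_def by (simp add: scaleR_conv_of_real)
    have l1: "lambert q 1 \<noteq> 0" using q one_minus_pow(2)[OF q, of 1] by (simp add: lambert_def)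
    have m\<kappa>: "mode r 0 ?\<kappa> = of_real (- m * amp * E)"
    proof -
      have "mode r 0 ?\<kappa> * mode r 1 (cn_primary \<rho>) = mode r 1 (?\<kappa> * cn_primary \<rho>)" by (rule mode_diag_mult[OF d\<kappa> r', symmetric])
      also have "\<dots> = of_real r * mode r 0 (tau (?\<kappa> * cn_primary \<rho>))" by (rule mode_tau[OF r', symmetric])
      also have "tau (?\<kappa> * cn_primary \<rho>) = - m *\<^sub>R (tau N * (cn_divisor \<rho> * tau (cn_primary \<rho>)))"
        unfolding tau_diag_mult[OF d\<kappa>] unfolding \<kappa> by (simp add: mult_ac)
      also have "\<dots> = - m *\<^sub>R tau N" by (simp add: cn_divisor_tau)
      also have "of_real r * mode r 0 (- m *\<^sub>R tau N) = of_real (- m) * (of_real r * mode r 0 (tau N))"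
        unfolding M.scaleR by (simp add: scaleR_conv_of_real)
      also have "\<dots> = of_real (- m) * mode r 1 N" by (simp only: mode_tau[OF r'])
      also have "mode r 1 N = of_real (- (amp\<^sup>2 * lambert q 1 * E))" by (subst mN) auto
      finally have "mode r 0 ?\<kappa> * mode r 1 (cn_primary \<rho>) = of_real (m * amp\<^sup>2 * lambert q 1 * E)" by simp
      moreover have "mode r 1 (cn_primary \<rho>) = of_real (- amp * lambert q 1)"
        unfolding cn_primary_def mode_multiplier[OF primary_le r'] mode_cn[OF \<rho> r] q_def by (simp add: primary_def)
      ultimately have "mode r 0 ?\<kappa> * of_real (- amp * lambert q 1) = of_real (- m * amp * E) * of_real (- amp * lambert q 1)"
        by (simp add: power2_eq_square mult_ac)
      moreover have "complex_of_real (- amp * lambert q 1) \<noteq> 0" using l1 amp by simp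
      ultimately show ?thesis using mult_right_cancel by blast
    qed
    have "mode r k F = mode r k (cn_outer \<rho>)"
    proof (cases "\<bar>k\<bar> \<ge> 2")
      case False
      then show ?thesis
        unfolding F_def wave_map_def cn_outer_def M.scaleR mode_multiplier[OF resolvent_le r'] mode_multiplier[OF outer_le r']
        by (simp add: resolvent_def outer_def)
    next
      case True
      let ?c = "amp * (-1) ^ nat \<bar>k\<bar> * lambert q k" and ?k = "(of_int k)\<^sup>2 :: real"
      have k0: "k \<noteq> 0" using True by auto
      have k4: "?k \<ge> 4" by (rule int_sq_ge4[OF True])
      have H: "mode r k (cn_outer \<rho>) = of_real (?k * ?c)"
        unfolding cn_outer_def mode_multiplier[OF outer_le r'] mode_cn[OF \<rho> r] q_def using True by (simp add: outer_def)
      have dH: "mode r k (multiplier dinv2 (cn_outer \<rho>)) = of_real ?c"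
        unfolding mode_multiplier[OF dinv2_le r'] H using k0 by (simp add: dinv2_def)
      have "mode r k F = of_real (1 / \<mu>) * (of_real (?k / (?k - 1)) * (of_real (- m * amp * E) * of_real ?c
          + of_real m * of_real (1/2 * (amp\<^sup>2 * (-1) ^ nat \<bar>k\<bar> * (lambert q k * ((?k - 1) / 6 + 2 * E))))))"
        unfolding F_def wave_map_def cn_primary_plus_outer N_def[symmetric] M.scaleR mode_multiplier[OF resolvent_le r'] M.add mode_diag_mult[OF d\<kappa> r'] dH m\<kappa> mN[OF k0]
        using True by (simp add: resolvent_def scaleR_conv_of_real)
      also have "\<dots> = of_real (1 / \<mu> * (?k / (?k - 1) * (?c * (m * amp / 12 * (?k - 1)))))"
        by (simp only: of_real_mult[symmetric] of_real_add[symmetric] of_real_eq_iff) (simp add: algebra_simps power2_eq_square add_divide_distrib diff_divide_distrib)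
      also have "m * amp / 12 = \<mu>" by (simp add: amp_def \<mu>_def power2_eq_square power3_eq_cube)
      also have "1 / \<mu> * (?k / (?k - 1) * (?c * (\<mu> * (?k - 1)))) = ?k * ?c" using \<mu> k4 by (simp add: field_simps)
      finally show ?thesis by (simp add: H)
    qed
    then have "mode r k (F - cn_outer \<rho>) = 0" by (simp add: M.diff)
    then show "mode r (int n) (F - cn_outer \<rho>) = 0" by (simp only: k_def)
  qed
  then show ?thesis by (simp add: F_def)
qed

end

end

section \<open>Fourier series and plane waves\<close>

definition fourier :: "(int \<Rightarrow> complex) \<Rightarrow> real \<Rightarrow> complex" where
  "fourier c s = (\<Sum>\<^sub>\<infinity>k. c k * cis (s * of_int k))"

definition re_fourier :: "(int \<Rightarrow> complex) \<Rightarrow> real \<Rightarrow> real" where "re_fourier c s = Re (fourier c s)"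

lemma fourier_abs_summable:
  assumes "decays c" shows "(\<lambda>k. c k * cis (s * of_int k)) abs_summable_on UNIV"
  using decays_abs_summable[OF assms] by (simp add: norm_mult)

lemma has_sum_fourier:
  assumes "decays c" shows "((\<lambda>k. c k * cis (s * of_int k)) has_sum fourier c s) UNIV"
  unfolding fourier_def by (rule has_sum_infsum[OF abs_summable_summable[OF fourier_abs_summable[OF assms]]])

text \<open>The Fourier coefficients of the derivative.\<close>
definition dcoef :: "real \<Rightarrow> (int \<Rightarrow> complex) \<Rightarrow> int \<Rightarrow> complex" where
  "dcoef \<theta> c k = \<i> * of_real \<theta> * of_int k * c k"

lemma decays_dcoef: "decays c \<Longrightarrow> decays (dcoef \<theta> c)"
  using decays_cmult[OF decays_of_int_mult, of c "\<i> * of_real \<theta>"] by (simp add: dcoef_def[abs_def] mult_ac)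

lemma has_sum_int_sums:
  fixes f :: "int \<Rightarrow> 'a::real_normed_vector"
  assumes "f summable_on {0..}" "f summable_on {..-1}" "(f has_sum S) UNIV"
  shows "(\<lambda>n. f (int n) + f (- int n - 1)) sums S"
proof -
  obtain A B where A: "(f has_sum A) {0..}" and B: "(f has_sum B) {..-1}" using assms by (auto simp: summable_on_def)
  have "{0..} \<union> {..-1} = (UNIV :: int set)" by auto
  with has_sum_Un_disjoint[OF A B] have "(f has_sum A + B) UNIV" by fastforce
  then have "S = A + B" using assms(3) has_sum_unique by blast
  have "bij_betw int UNIV {0..}" by (rule bij_betwI[where g = nat]) auto
  from has_sum_reindex_bij_betw[OF this, of f A] A have "(\<lambda>n. f (int n)) sums A" by (simp add: has_sum_imp_sums)
  moreover have "bij_betw (\<lambda>n. - int n - 1) UNIV {..-1}" by (rule bij_betwI[where g = "\<lambda>k. nat (- k - 1)"]) auto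
  from has_sum_reindex_bij_betw[OF this, of f B] B have "(\<lambda>n. f (- int n - 1)) sums B" by (simp add: has_sum_imp_sums)
  ultimately show ?thesis unfolding \<open>S = A + B\<close> by (rule sums_add)
qed

lemma int_abs_summable_sums:
  fixes f :: "int \<Rightarrow> 'a::banach"
  assumes "f abs_summable_on UNIV"
  shows "(\<lambda>n. f (int n) + f (- int n - 1)) sums (\<Sum>\<^sub>\<infinity>k. f k)"
proof (rule has_sum_int_sums)
  have s: "f summable_on UNIV" by (rule abs_summable_summable[OF assms])
  then show "f summable_on {0..}" "f summable_on {..-1}" by (auto intro: summable_on_subset_banach)
  show "(f has_sum (\<Sum>\<^sub>\<infinity>k. f k)) UNIV" by (rule has_sum_infsum[OF s])
qed

lemma Re_cis_derivative:
  "((\<lambda>s. Re (c * cis (s * k))) has_real_derivative Re (\<i> * of_real k * c * cis (s * k))) (at s within S)"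
proof -
  have e: "Re (c * cis (s * k)) = Re c * cos (s * k) - Im c * sin (s * k)" for s by simp
  show ?thesis unfolding e
    by (auto intro!: derivative_eq_intros simp: algebra_simps)
qed

text \<open>Termwise differentiation is justified by exponential decay, which is inherited by the
  coefficients of the derivative.\<close>
lemma re_fourier_derivative:
  assumes c: "decays c"
  shows "((\<lambda>x. re_fourier c (\<theta> * x)) has_real_derivative re_fourier (dcoef \<theta> c) (\<theta> * x)) (at x)"
proof -
  define g where "g c k s = Re (c k * cis (s * of_int k))" for c and k :: int and s
  define h where "h c n s = g c (int n) s + g c (- int n - 1) s" for c and n :: nat and s
  have dc: "decays (dcoef 1 c)" by (rule decays_dcoef[OF c])
  have sums: "(\<lambda>n. h c n s) sums re_fourier c s" if "decays c" for c s
  proof -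
    from int_abs_summable_sums[OF fourier_abs_summable[OF that, of s]]
    show ?thesis unfolding h_def g_def re_fourier_def fourier_def by (simp add: sums_complex_iff)
  qed
  have M: "summable (\<lambda>n. norm (dcoef 1 c (int n)) + norm (dcoef 1 c (- int n - 1)))"
  proof -
    have "(\<lambda>k. norm (dcoef 1 c k)) abs_summable_on UNIV" using decays_abs_summable[OF dc] by simp
    from sums_summable[OF int_abs_summable_sums[OF this]] show ?thesis .
  qed
  have deriv: "(h c n has_real_derivative h (dcoef 1 c) n s) (at s within UNIV)" for n s
    unfolding h_def g_def dcoef_def
    by (rule DERIV_add) (rule DERIV_cong[OF Re_cis_derivative], simp)+
  have "uniformly_convergent_on UNIV (\<lambda>n x. \<Sum>i<n. h (dcoef 1 c) i x)"
  proof (rule Weierstrass_m_test'[OF _ M])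
    fix n s
    have "\<bar>g (dcoef 1 c) k s\<bar> \<le> norm (dcoef 1 c k)" for k
      unfolding g_def using abs_Re_le_cmod[of "dcoef 1 c k * cis (s * of_int k)"] by (simp add: norm_mult)
    then show "norm (h (dcoef 1 c) n s) \<le> norm (dcoef 1 c (int n)) + norm (dcoef 1 c (- int n - 1))"
      unfolding h_def real_norm_def by (intro order_trans[OF abs_triangle_ineq] add_mono)
  qed
  from has_field_derivative_series'(2)[OF convex_UNIV deriv this UNIV_I sums_summable[OF sums[OF c]], of "\<theta> * x"]
  have "((\<lambda>s. \<Sum>n. h c n s) has_real_derivative (\<Sum>n. h (dcoef 1 c) n (\<theta> * x))) (at (\<theta> * x))" by simp
  then have "(re_fourier c has_real_derivative re_fourier (dcoef 1 c) (\<theta> * x)) (at (\<theta> * x))"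
  proof -
    have "re_fourier c = (\<lambda>s. \<Sum>n. h c n s)" using sums_unique[OF sums[OF c]] by (simp add: fun_eq_iff)
    then show ?thesis using sums_unique[OF sums[OF dc]] \<open>((\<lambda>s. \<Sum>n. h c n s) has_real_derivative _) _\<close> by simp
  qed
  then have "((\<lambda>x. re_fourier c (\<theta> * x)) has_real_derivative re_fourier (dcoef 1 c) (\<theta> * x) * \<theta>) (at x)"
    by (rule DERIV_chain2) (auto intro!: derivative_eq_intros)
  also have "re_fourier (dcoef 1 c) (\<theta> * x) * \<theta> = re_fourier (dcoef \<theta> c) (\<theta> * x)"
  proof -
    have "fourier (dcoef \<theta> c) (\<theta> * x) = of_real \<theta> * fourier (dcoef 1 c) (\<theta> * x)"
      unfolding fourier_def by (subst infsum_cmult_right'[symmetric]) (simp add: dcoef_def mult_ac)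
    then show ?thesis by (simp add: re_fourier_def)
  qed
  finally show ?thesis .
qed

lemma re_fourier_periodic:
  assumes "\<theta> * \<gamma> = 2 * pi"
  shows "re_fourier c (\<theta> * (x + of_int j * \<gamma>)) = re_fourier c (\<theta> * x)"
proof -
  have "cis (\<theta> * (x + of_int j * \<gamma>) * of_int k) = cis (\<theta> * x * of_int k)" for k
  proof -
    have "\<theta> * (x + of_int j * \<gamma>) * of_int k = \<theta> * x * of_int k + 2 * pi * of_int (j * k)"
      using assms by (simp add: algebra_simps)
    also have "cis \<dots> = cis (\<theta> * x * of_int k) * cis (2 * pi * of_int (j * k))" by (rule cis_mult[symmetric])
    finally show ?thesis by (simp add: cis_multiple_2pi)
  qed
  then show ?thesis by (simp add: re_fourier_def fourier_def)
qed

lemma smooth_compose_linear: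
  fixes l :: "'a::euclidean_space \<Rightarrow> real"
  assumes F: "\<And>n x. (F n has_real_derivative F (Suc n) x) (at x)" and l: "bounded_linear l"
  shows "smooth (\<lambda>z. F n (l z + d))"
proof -
  have der: "((\<lambda>z. a * F n (l z + d)) has_derivative (\<lambda>h. a * F (Suc n) (l z + d) * l h)) (at z)" for a n z
  proof -
    have "((\<lambda>z. l z + d) has_derivative l) (at z)"
      using bounded_linear_imp_has_derivative[OF l] by (auto intro!: derivative_eq_intros)
    from DERIV_compose_FDERIV[OF F this] show ?thesis
      by (auto intro!: derivative_eq_intros simp: mult_ac)
  qed
  have "C_k k (\<lambda>z. a * F n (l z + d))" for k a n
  proof (induction k arbitrary: a n)
    case 0
    show ?case using has_derivative_continuous[OF der[of a n]] by (simp add: continuous_at_imp_continuous_on)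
  next
    case (Suc k)
    have "frechet_derivative (\<lambda>z. a * F n (l z + d)) (at z) b = (a * l b) * F (Suc n) (l z + d)" for z b
      using frechet_derivative_at[OF der[of a n z]] by (metis mult.assoc mult.commute)
    moreover have "(\<lambda>z. a * F n (l z + d)) differentiable (at x)" for x
      using der[of a n x] unfolding differentiable_def by blast
    ultimately show ?case using Suc[of "a * l _" "Suc n"] by simp
  qed
  from this[of _ 1 n] show ?thesis by (simp add: smooth_def)
qed

definition pwave :: "real \<Rightarrow> real \<Rightarrow> (real \<Rightarrow> real) \<Rightarrow> real \<Rightarrow> real \<times> real \<Rightarrow> real" where
  "pwave m n f e = (\<lambda>(x, y). f (m * x + n * y + e))"

lemma pwave_derivative:
  assumes "\<And>x. (f has_real_derivative f' x) (at x)"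
  shows "(pwave m n f e has_derivative (\<lambda>(h, k). f' (m * fst z + n * snd z + e) * (m * h + n * k))) (at z)"
proof -
  have "((\<lambda>z. m * fst z + n * snd z + e) has_derivative (\<lambda>h. m * fst h + n * snd h)) (at z)"
    by (auto intro!: derivative_eq_intros)
  from DERIV_compose_FDERIV[OF assms this] show ?thesis
    by (simp add: pwave_def case_prod_unfold mult.commute)
qed

lemma dx_pwave:
  assumes "\<And>x. (f has_real_derivative f' x) (at x)"
  shows "dx (pwave m n f e) = pwave m n (\<lambda>s. m * f' s) e" "dy (pwave m n f e) = pwave m n (\<lambda>s. n * f' s) e"
  unfolding dx_def[abs_def] dy_def[abs_def] fun_eq_iff frechet_derivative_at[OF pwave_derivative[OF assms], symmetric]
  by (auto simp: pwave_def)

lemma zero_xmean_pwave: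
  assumes G: "\<And>x. (G has_real_derivative f x) (at x)" and per: "\<And>x. G (x + m * \<gamma>) = G x" and "m \<noteq> 0" "\<gamma> > 0"
  shows "zero_xmean \<gamma> (pwave m n f e)"
  unfolding zero_xmean_def
proof
  fix y
  have "((\<lambda>x. f (m * x + n * y + e)) has_integral (G (m * \<gamma> + n * y + e) / m - G (m * 0 + n * y + e) / m)) {0..\<gamma>}"
  proof (rule fundamental_theorem_of_calculus)
    fix x
    have "((\<lambda>x. G (m * x + n * y + e) / m) has_real_derivative f (m * x + n * y + e)) (at x within {0..\<gamma>})"
      using \<open>m \<noteq> 0\<close> by (auto intro!: derivative_eq_intros DERIV_chain2[OF G])
    then show "((\<lambda>x. G (m * x + n * y + e) / m) has_vector_derivative f (m * x + n * y + e)) (at x within {0..\<gamma>})"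
      by (simp add: has_real_derivative_iff_has_vector_derivative)
  qed (use \<open>\<gamma> > 0\<close> in simp)
  moreover have "G (m * \<gamma> + n * y + e) = G (m * 0 + n * y + e)" using per[of "n * y + e"] by (simp add: add_ac)
  ultimately show "((\<lambda>x. pwave m n f e (x, y)) has_integral 0) {0..\<gamma>}" by (simp add: pwave_def)
qed

lemma torus_periodic_pwave:
  assumes "\<And>x. f (x + m * \<gamma>) = f x" "\<And>x. f (x + n * \<gamma>) = f x"
  shows "torus_periodic \<gamma> (pwave m n f e)"
  unfolding torus_periodic_def pwave_def
proof (intro allI conjI)
  fix x y
  show "(case (x + \<gamma>, y) of (x, y) \<Rightarrow> f (m * x + n * y + e)) = (case (x, y) of (x, y) \<Rightarrow> f (m * x + n * y + e))"
    using assms(1)[of "m * x + n * y + e"] by (simp add: algebra_simps)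
  show "(case (x, y + \<gamma>) of (x, y) \<Rightarrow> f (m * x + n * y + e)) = (case (x, y) of (x, y) \<Rightarrow> f (m * x + n * y + e))"
    using assms(2)[of "m * x + n * y + e"] by (simp add: algebra_simps)
qed

text \<open>Two antiderivatives in \<open>x\<close> differ by a function of \<open>y\<close>, and the mean determines it.\<close>
lemma dx_inv_eqI:
  assumes v: "torus_periodic \<gamma> v" "zero_xmean \<gamma> v" "\<And>x y. ((\<lambda>s. v (s, y)) has_real_derivative w (x, y)) (at x)" and "\<gamma> > 0"
  shows "dx_inv \<gamma> w = v"
  unfolding dx_inv_def
proof (rule the_equality)
  fix v' assume v': "torus_periodic \<gamma> v' \<and> zero_xmean \<gamma> v' \<and> (\<forall>x y. ((\<lambda>s. v' (s, y)) has_real_derivative w (x, y)) (at x))"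
  show "v' = v"
  proof
    fix z :: "real \<times> real"
    obtain x y where z: "z = (x, y)" by (cases z)
    define c where "c = v' (x, y) - v (x, y)"
    have "((\<lambda>s. v' (s, y) - v (s, y)) has_real_derivative 0) (at s)" for s
      using DERIV_diff[of "\<lambda>s. v' (s, y)" "w (s, y)" s UNIV "\<lambda>s. v (s, y)" "w (s, y)"] v(3) v' by simp
    then have c: "v' (s, y) - v (s, y) = c" for s
      using DERIV_isconst_all[of "\<lambda>s. v' (s, y) - v (s, y)" s x] by (simp add: c_def)
    have "((\<lambda>s. v' (s, y) - v (s, y)) has_integral (0 - 0)) {0..\<gamma>}"
      using v' v(2) by (intro has_integral_diff) (auto simp: zero_xmean_def)
    then have "((\<lambda>s. c) has_integral 0) {0..\<gamma>}" by (simp add: c)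
    moreover have "((\<lambda>s. c) has_integral (\<gamma> *\<^sub>R c)) {0..\<gamma>}" using has_integral_const_real[of c 0 \<gamma>] \<open>\<gamma> > 0\<close> by simp
    ultimately have "\<gamma> *\<^sub>R c = 0" by (rule has_integral_unique[rotated])
    then show "v' z = v z" using \<open>\<gamma> > 0\<close> by (simp add: z c_def)
  qed
qed (use v in auto)

lemma travelling_wave_pwave: "travelling_wave f \<omega> m0 n0 d t = pwave (of_int m0) (of_int n0) f (\<omega> * t + d)"
  by (auto simp: travelling_wave_def pwave_def fun_eq_iff algebra_simps)

text \<open>\<open>F\<close> lists the successive derivatives of a periodic primitive of the profile, so the profile
  is \<open>F 1\<close>. Starting from a primitive encodes that the profile has mean zero, and the periodic
  antiderivative of \<open>u\<^sub>y\<^sub>y\<close> is \<open>n0\<^sup>2 / m0\<close> times the first derivative of the profile.\<close>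
lemma kp_travelling_wave:
  fixes F :: "nat \<Rightarrow> real \<Rightarrow> real" and m0 n0 :: int
  assumes \<gamma>: "\<gamma> > 0" and m0: "m0 \<noteq> 0"
    and F: "\<And>j x. (F j has_real_derivative F (Suc j) x) (at x)"
    and per: "\<And>j l x. F j (x + of_int l * \<gamma>) = F j x"
    and P: "\<And>e z. P (pwave (of_int m0) (of_int n0) (F 1) e) z = pwave (of_int m0) (of_int n0) p e z"
    and ode: "\<And>s. \<omega> * F 2 s + of_int m0 ^ 3 * F 4 s - lam * ((of_int n0)\<^sup>2 / of_int m0) * F 2 s + of_int m0 * F 1 s * F 2 s + p s = 0"
  shows "kp_solution \<gamma> lam P (travelling_wave (F 1) \<omega> m0 n0 d)"
  unfolding kp_solution_def
proof (intro conjI allI)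
  let ?m = "real_of_int m0" and ?n = "real_of_int n0"
  let ?u = "travelling_wave (F 1) \<omega> m0 n0 d"
  have m: "?m \<noteq> 0" using m0 by simp
  define l where "l = (\<lambda>z :: real \<times> real \<times> real. \<omega> * fst z + ?m * fst (snd z) + ?n * snd (snd z))"
  have "bounded_linear l" unfolding l_def
    by (intro bounded_linear_intros bounded_linear_compose[OF bounded_linear_mult_right] bounded_linear_fst bounded_linear_snd
        bounded_linear_compose[OF bounded_linear_fst] bounded_linear_compose[OF bounded_linear_snd])
  from smooth_compose_linear[of F, OF F this, of 1 d]
  show "smooth (\<lambda>(t, z). ?u t z)"
    by (simp add: l_def travelling_wave_def case_prod_unfold)
  have mean: "zero_xmean \<gamma> (pwave ?m ?n (\<lambda>s. a * F (Suc j) s) e)" for a j e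
    using F[of j] per m \<gamma> by (intro zero_xmean_pwave[where G = "\<lambda>s. a * F j s"] DERIV_cmult) auto
  have tor: "torus_periodic \<gamma> (pwave ?m ?n (\<lambda>s. a * F j s) e)" for a j e
    by (intro torus_periodic_pwave) (simp_all add: per)
  fix t
  show "torus_periodic \<gamma> (?u t)" using tor[of 1 1] by (simp add: travelling_wave_pwave)
  show "zero_xmean \<gamma> (?u t)" using mean[of 1 0] by (simp add: travelling_wave_pwave)
  fix z :: "real \<times> real"
  define e where "e = \<omega> * t + d"
  obtain x y where z: "z = (x, y)" by (cases z)
  define s where "s = ?m * x + ?n * y + e"
  have dF: "((\<lambda>s. a * F j s) has_real_derivative a * F (Suc j) s) (at s)" for a j s
    by (intro DERIV_cmult F)
  have dxs: "dx (pwave ?m ?n (\<lambda>s. a * F j s) e) = pwave ?m ?n (\<lambda>s. (?m * a) * F (Suc j) s) e"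
    "dy (pwave ?m ?n (\<lambda>s. a * F j s) e) = pwave ?m ?n (\<lambda>s. (?n * a) * F (Suc j) s) e" for a j
    using dx_pwave[OF dF[of a j], of ?m ?n e] by (simp_all add: mult.assoc)
  have u: "?u t = pwave ?m ?n (\<lambda>s. 1 * F 1 s) e" by (simp add: travelling_wave_pwave e_def)
  have inv: "dx_inv \<gamma> (dy (dy (?u t))) = pwave ?m ?n (\<lambda>s. (?n\<^sup>2 / ?m) * F 2 s) e"
  proof (rule dx_inv_eqI)
    show "torus_periodic \<gamma> (pwave ?m ?n (\<lambda>s. (?n\<^sup>2 / ?m) * F 2 s) e)" by (rule tor)
    show "zero_xmean \<gamma> (pwave ?m ?n (\<lambda>s. (?n\<^sup>2 / ?m) * F 2 s) e)" using mean[of "?n\<^sup>2 / ?m" 1] by (simp add: numeral_2_eq_2)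
    fix x y
    have "((\<lambda>s. ?n\<^sup>2 / ?m * F 2 (?m * s + ?n * y + e)) has_real_derivative ?n\<^sup>2 / ?m * (F (Suc 2) (?m * x + ?n * y + e) * ?m)) (at x)"
      by (intro DERIV_cmult DERIV_chain2[OF F]) (auto intro!: derivative_eq_intros)
    then show "((\<lambda>s. pwave ?m ?n (\<lambda>s. ?n\<^sup>2 / ?m * F 2 s) e (s, y)) has_real_derivative dy (dy (?u t)) (x, y)) (at x)"
      unfolding u dxs using m by (simp add: pwave_def power2_eq_square numeral_2_eq_2 mult_ac)
  qed (rule \<gamma>)
  have "((\<lambda>t. ?u t z) has_real_derivative \<omega> * F 2 s) (at t)"
  proof -
    have "((\<lambda>t. F 1 (\<omega> * t + ?m * x + ?n * y + d)) has_real_derivative F (Suc 1) (\<omega> * t + ?m * x + ?n * y + d) * \<omega>) (at t)"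
      by (rule DERIV_chain2[OF F]) (auto intro!: derivative_eq_intros)
    then show ?thesis by (simp add: travelling_wave_def z s_def e_def numeral_2_eq_2 algebra_simps)
  qed
  then have dt: "deriv (\<lambda>s. ?u s z) t = \<omega> * F 2 s" by (rule DERIV_imp_deriv)
  have Pz: "P (?u t) z = p s" using P[of e z] by (simp add: travelling_wave_pwave e_def z s_def pwave_def)
  show "deriv (\<lambda>s. ?u s z) t + dx (dx (dx (?u t))) z - lam * dx_inv \<gamma> (dy (dy (?u t))) z + ?u t z * dx (?u t) z + P (?u t) z = 0"
    using ode[of s] unfolding dt inv Pz unfolding u dxs
    by (simp add: pwave_def z s_def numeral_eq_Suc power3_eq_cube mult_ac)
qed

section \<open>The logarithm of the theta function\<close>

lemma fourier_mult:
  assumes c: "decays c" and d: "decays d" and e: "\<And>k. ((\<lambda>l. c l * d (k - l)) has_sum e k) UNIV"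
  shows "fourier e s = fourier c s * fourier d s"
proof -
  let ?w = "\<lambda>k::int. cis (s * of_int k)"
  let ?f = "\<lambda>(l, j). (c l * ?w l) * (d j * ?w j)"
  have "?f abs_summable_on UNIV" by (rule abs_summable_tensor[OF fourier_abs_summable[OF c] fourier_abs_summable[OF d]])
  then have sf: "?f summable_on UNIV" by (rule abs_summable_summable)
  have A: "(?f has_sum infsum ?f UNIV) (UNIV \<times> UNIV)" using has_sum_infsum[OF sf] by simp
  have B: "((\<lambda>j. ?f (l, j)) has_sum (c l * ?w l) * fourier d s) UNIV" for l
    using has_sum_cmult_right[OF has_sum_fourier[OF d, of s], of "c l * ?w l"] by simp
  have "((\<lambda>l. (c l * ?w l) * fourier d s) has_sum infsum ?f UNIV) UNIV"
    by (rule has_sum_SigmaD[OF A B])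
  from has_sum_unique[OF this has_sum_cmult_left[OF has_sum_fourier[OF c]]]
  have I: "infsum ?f UNIV = fourier c s * fourier d s" .
  have bij: "bij_betw (\<lambda>(k, l). (l, k - l)) (UNIV :: (int \<times> int) set) UNIV"
    by (rule bij_betwI[where g = "\<lambda>(l, j). (l + j, l)"]) auto
  have "((\<lambda>z. ?f (case z of (k, l) \<Rightarrow> (l, k - l))) has_sum infsum ?f UNIV) UNIV"
    using has_sum_reindex_bij_betw[OF bij, of ?f "infsum ?f UNIV"] has_sum_infsum[OF sf] by simp
  moreover have "(\<lambda>z. ?f (case z of (k, l) \<Rightarrow> (l, k - l))) = (\<lambda>(k, l). (c l * d (k - l)) * ?w k)"
  proof
    fix z :: "int \<times> int"
    obtain k l where z: "z = (k, l)" by (cases z)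
    have w: "?w k = ?w l * ?w (k - l)" by (simp add: cis_mult algebra_simps)
    show "?f (case z of (k, l) \<Rightarrow> (l, k - l)) = (\<lambda>(k, l). (c l * d (k - l)) * ?w k) z"
      unfolding z prod.case w by (simp only: mult_ac)
  qed
  ultimately have "((\<lambda>(k, l). (c l * d (k - l)) * ?w k) has_sum infsum ?f UNIV) (UNIV \<times> UNIV)" by simp
  then have "((\<lambda>k. e k * ?w k) has_sum infsum ?f UNIV) UNIV"
    by (rule has_sum_SigmaD) (use has_sum_cmult_left[OF e] in simp)
  then show ?thesis unfolding fourier_def[of e] I by (rule infsumI)
qed

lemma fourier_real:
  assumes "\<And>k. c (- k) = cnj (c k)"
  shows "fourier c s \<in> \<real>"
proof -
  have "cnj (fourier c s) = (\<Sum>\<^sub>\<infinity>k. cnj (c k * cis (s * of_int k)))" unfolding fourier_def by (rule infsum_cnj[symmetric])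
  also have "\<dots> = (\<Sum>\<^sub>\<infinity>k. c (- k) * cis (s * of_int (- k)))" by (simp add: assms cis_cnj)
  also have "\<dots> = fourier c s" unfolding fourier_def
    by (rule infsum_reindex_bij_betw[of uminus UNIV UNIV "\<lambda>k. c k * cis (s * of_int k)"]) (auto intro!: bij_betwI[where g = uminus])
  finally show ?thesis by (simp add: Reals_cnj_iff)
qed

lemma powi_sq_nat: "q powi (k\<^sup>2) = q ^ nat (k\<^sup>2)" for q :: real
  by (simp add: power_int_def)

text \<open>Up to the factor \<open>\<i>\<close>, the Fourier coefficients of the logarithmic derivative of theta.\<close>
definition log_slope :: "real \<Rightarrow> int \<Rightarrow> real" where
  "log_slope q j = - ((-1) powi j * q powi j / (1 - q powi (2 * j)))"

context
  fixes q :: real assumes q: "0 < q" "q < 1"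
begin

lemma powi_sq_le: "q powi (k\<^sup>2) \<le> q ^ nat \<bar>k\<bar>"
proof -
  have "\<bar>k\<bar> * 1 \<le> \<bar>k\<bar> * \<bar>k\<bar>"
  proof (cases "k = 0")
    case False
    then have "1 \<le> \<bar>k\<bar>" by linarith
    then show ?thesis by (intro mult_left_mono) auto
  qed simp
  then have "nat \<bar>k\<bar> \<le> nat (k\<^sup>2)" by (simp add: power2_eq_square abs_mult_self_eq nat_mono)
  then show ?thesis unfolding powi_sq_nat using q by (intro power_decreasing) auto
qed

lemma decays_gauss: "decays (\<lambda>k. q powi (k\<^sup>2))"
  by (rule decaysI[of q _ 1]) (use q powi_sq_le in \<open>auto simp: powi_sq_nat\<close>)

lemma log_slope_lambert: "of_int j * log_slope q j = - ((-1) powi j * lambert q j)"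
  by (simp add: log_slope_def lambert_powi[OF q])

lemma decays_log_slope: "decays (log_slope q)"
proof (rule decays_mono[OF decays_lambert[OF q]])
  fix j
  show "norm (log_slope q j) \<le> norm (lambert q j)"
  proof (cases "j = 0")
    case False
    then have "1 * \<bar>log_slope q j\<bar> \<le> \<bar>of_int j\<bar> * \<bar>log_slope q j\<bar>" by (intro mult_right_mono) auto
    also have "\<dots> = \<bar>lambert q j\<bar>" unfolding abs_mult[symmetric] log_slope_lambert by (simp add: abs_mult power_int_abs)
    finally show ?thesis by simp
  qed (simp add: log_slope_def)
qed

lemma log_slope_minus: "log_slope q (- j) = - log_slope q j"
proof (cases "j = 0")
  case False
  have "of_int j * (log_slope q (- j) + log_slope q j) = - (of_int (- j) * log_slope q (- j)) + of_int j * log_slope q j" by (simp add: algebra_simps)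
  also have "\<dots> = 0" unfolding log_slope_lambert by (simp add: lambert_def power_int_minus_left)
  finally show ?thesis using False by simp
qed (simp add: log_slope_def)

text \<open>Comparing the sums \<open>U\<close> at \<open>k\<close> and \<open>k - 1\<close> cancels the denominators \<open>1 - q\<^sup>2\<^sup>j\<close>. What
  remains is an alternating Gaussian sum that vanishes under the involution
  \<open>j \<mapsto> 2 k - 1 - j\<close>, except that the term \<open>j = 0\<close> is missing, which yields the increment
  \<open>q powi k\<^sup>2\<close>. At \<open>k = 0\<close> the summand is odd.\<close>
lemma theta_recursion: "((\<lambda>j. log_slope q j * q powi ((k - j)\<^sup>2)) has_sum of_int k * q powi (k\<^sup>2)) UNIV"
proof -
  have summ: "(\<lambda>j. log_slope q j * q powi ((k - j)\<^sup>2)) summable_on UNIV" for k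
  proof (rule decays_summable[OF decays_mono[OF decays_log_slope]])
    have "q powi ((k - j)\<^sup>2) \<le> 1" for j unfolding powi_sq_nat using q by (intro power_le_one) auto
    then show "norm (log_slope q j * q powi ((k - j)\<^sup>2)) \<le> norm (log_slope q j)" for j
      using q by (simp add: abs_mult mult_left_le)
  qed
  define U where "U k = (\<Sum>\<^sub>\<infinity>j. log_slope q j * q powi ((k - j)\<^sup>2))" for k
  have U: "((\<lambda>j. log_slope q j * q powi ((k - j)\<^sup>2)) has_sum U k) UNIV" for k
    unfolding U_def by (rule has_sum_infsum[OF summ])
  have alt: "((\<lambda>j. (-1) powi j * q powi (j + (k - j)\<^sup>2)) has_sum 0) UNIV" for k
  proof -
    have bij: "bij_betw (\<lambda>j. 2 * k - 1 - j) (UNIV :: int set) UNIV"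
      by (rule bij_betwI[where g = "\<lambda>j. 2 * k - 1 - j"]) auto
    let ?f = "\<lambda>j. (-1::real) powi j * q powi (j + (k - j)\<^sup>2)"
    have exp: "(2 * k - 1 - j) + (k - (2 * k - 1 - j))\<^sup>2 = j + (k - j)\<^sup>2" for j by (simp add: power2_eq_square algebra_simps)
    have sgn: "(-1::real) powi (2 * k - 1 - j) = - ((-1) powi j)" for j
      by (simp add: power_int_minus_left)
    have "?f summable_on UNIV"
    proof (rule decays_summable)
      show "decays ?f"
      proof (rule decaysI[of q _ "q powi (- (k\<^sup>2) - 2 * \<bar>k\<bar> - 2)"])
        fix j
        have "0 \<le> (\<bar>j - k\<bar> - 1)\<^sup>2" by simp
        also have "(\<bar>j - k\<bar> - 1)\<^sup>2 = \<bar>j - k\<bar>\<^sup>2 - 2 * \<bar>j - k\<bar> + 1" by (simp add: power2_diff)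
        also have "\<bar>j - k\<bar>\<^sup>2 = (k - j)\<^sup>2" by (simp add: power2_commute)
        finally have "2 * \<bar>j - k\<bar> \<le> (k - j)\<^sup>2 + 1" by simp
        moreover have "0 \<le> k\<^sup>2" by simp
        moreover have "\<bar>j\<bar> \<le> \<bar>j - k\<bar> + \<bar>k\<bar>" "- j \<le> \<bar>j\<bar>" by arith+
        moreover have "- K - 2 * a - 2 + b \<le> i + S"
          if "2 * c \<le> S + 1" "0 \<le> K" "b \<le> c + a" "- i \<le> b" for K a b c i S :: int using that by linarith
        ultimately have "- (k\<^sup>2) - 2 * \<bar>k\<bar> - 2 + \<bar>j\<bar> \<le> j + (k - j)\<^sup>2" by blast
        then have "q powi (j + (k - j)\<^sup>2) \<le> q powi (- (k\<^sup>2) - 2 * \<bar>k\<bar> - 2 + \<bar>j\<bar>)"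
          using q by (intro power_int_decreasing) auto
        also have "\<dots> = q powi (- (k\<^sup>2) - 2 * \<bar>k\<bar> - 2) * q powi \<bar>j\<bar>" using q by (intro power_int_add) auto
        also have "q powi \<bar>j\<bar> = q ^ nat \<bar>j\<bar>" by (simp add: power_int_nonneg_exp)
        finally show "norm (?f j) \<le> q powi (- (k\<^sup>2) - 2 * \<bar>k\<bar> - 2) * q ^ nat \<bar>j\<bar>"
          using q by (simp add: abs_mult power_int_abs)
      qed (use q in auto)
    qed
    then obtain S where S: "(?f has_sum S) UNIV" by (auto simp: summable_on_def)
    with has_sum_reindex_bij_betw[OF bij, of ?f S] have "((\<lambda>j. ?f (2 * k - 1 - j)) has_sum S) UNIV" by simp
    then have "((\<lambda>j. - ?f j) has_sum S) UNIV" unfolding exp sgn by simp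
    from has_sum_unique[OF this has_sum_uminusI[OF S]] show ?thesis using S by simp
  qed
  have rec: "U k = q powi (2 * k - 1) * U (k - 1) + q powi (k\<^sup>2)" for k
  proof -
    have "((\<lambda>j. log_slope q j * q powi ((k - j)\<^sup>2) + - (q powi (2 * k - 1) * (log_slope q j * q powi ((k - 1 - j)\<^sup>2)))) has_sum U k + - (q powi (2 * k - 1) * U (k - 1))) UNIV"
      by (intro has_sum_add has_sum_uminusI has_sum_cmult_right U)
    moreover have "log_slope q j * q powi ((k - j)\<^sup>2) + - (q powi (2 * k - 1) * (log_slope q j * q powi ((k - 1 - j)\<^sup>2)))
        = - ((-1) powi j * q powi (j + (k - j)\<^sup>2)) + (if j = 0 then q powi (k\<^sup>2) else 0)" for j
    proof (cases "j = 0")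
      case False
      have "nat \<bar>j\<bar> \<ge> 1" using False by linarith
      then have "lambert q j \<noteq> 0" using False q one_minus_pow(2)[OF q, of "nat \<bar>j\<bar>"] by (simp add: lambert_def)
      then have ne: "1 - q powi (2 * j) \<noteq> 0" unfolding lambert_powi[OF q] by auto
      have e: "q powi (2 * k - 1) * q powi ((k - 1 - j)\<^sup>2) = q powi (2 * j) * q powi ((k - j)\<^sup>2)"
        using q by (simp add: power_int_add[symmetric]) (simp add: power2_eq_square algebra_simps)
      have "q powi (2 * k - 1) * (log_slope q j * q powi ((k - 1 - j)\<^sup>2)) = log_slope q j * (q powi (2 * j) * q powi ((k - j)\<^sup>2))"
        unfolding e[symmetric] by (simp only: mult_ac)
      then have "log_slope q j * q powi ((k - j)\<^sup>2) + - (q powi (2 * k - 1) * (log_slope q j * q powi ((k - 1 - j)\<^sup>2))) = log_slope q j * q powi ((k - j)\<^sup>2) + - (log_slope q j * (q powi (2 * j) * q powi ((k - j)\<^sup>2)))"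
        by (simp only:)
      also have "\<dots> = log_slope q j * (1 - q powi (2 * j)) * q powi ((k - j)\<^sup>2)" by (simp add: algebra_simps)
      also have "log_slope q j * (1 - q powi (2 * j)) = - ((-1) powi j * q powi j)" using ne by (simp add: log_slope_def)
      finally show ?thesis using False q by (simp add: power_int_add)
    qed (simp add: log_slope_def)
    moreover have "((\<lambda>j. - ((-1) powi j * q powi (j + (k - j)\<^sup>2)) + (if j = 0 then q powi (k\<^sup>2) else 0)) has_sum (- 0 + q powi (k\<^sup>2))) UNIV"
      by (intro has_sum_add has_sum_uminusI alt has_sum_finite_neutralI[where B = "{0}"]) auto
    ultimately have "U k + - (q powi (2 * k - 1) * U (k - 1)) = - 0 + q powi (k\<^sup>2)"
      using has_sum_unique by (simp only:)
    then show ?thesis by simp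
  qed
  have U0: "U 0 = 0"
  proof -
    have "((\<lambda>j. log_slope q (- j) * q powi ((0 - (- j))\<^sup>2)) has_sum U 0) UNIV"
      using U[of 0] by (subst has_sum_reindex_bij_betw[of uminus UNIV UNIV "\<lambda>j. log_slope q j * q powi ((0 - j)\<^sup>2)"]) (auto intro!: bij_betwI[where g = uminus])
    then have "((\<lambda>j. - (log_slope q j * q powi ((0 - j)\<^sup>2))) has_sum U 0) UNIV" by (simp add: log_slope_minus)
    from has_sum_unique[OF this has_sum_uminusI[OF U[of 0]]] show ?thesis by simp
  qed
  have sq: "q powi (2 * k - 1) * q powi ((k - 1)\<^sup>2) = q powi (k\<^sup>2)" for k
    using q by (simp add: power_int_add[symmetric]) (simp add: power2_eq_square algebra_simps)
  have "U k = of_int k * q powi (k\<^sup>2)"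
  proof (induction k rule: int_induct[where k = 0])
    case base then show ?case by (simp add: U0)
  next
    case (step1 i)
    have "U (i + 1) = of_int i * (q powi (2 * (i + 1) - 1) * q powi ((i + 1 - 1)\<^sup>2)) + q powi ((i + 1)\<^sup>2)"
      unfolding rec[of "i + 1"] using step1 by simp
    then show ?case unfolding sq by (simp add: algebra_simps)
  next
    case (step2 i)
    have "q powi (2 * i - 1) * U (i - 1) = of_int i * q powi (i\<^sup>2) - q powi (i\<^sup>2)" using rec[of i] step2 by simp
    also have "\<dots> = q powi (2 * i - 1) * (of_int (i - 1) * q powi ((i - 1)\<^sup>2))" unfolding sq[of i, symmetric] by (simp add: algebra_simps)
    finally show ?case using q by simp
  qed
  with U[of k] show ?thesis by (simp only:)
qed

definition theta_coef :: "int \<Rightarrow> complex" where "theta_coef k = of_real (q powi (k\<^sup>2))"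
definition log_coef :: "int \<Rightarrow> complex" where "log_coef j = of_real (log_slope q j / of_int j)"

lemma decays_of_real: "decays c \<Longrightarrow> decays (\<lambda>k. complex_of_real (c k))"
  unfolding decays_def by simp

lemma decays_theta_coef: "decays theta_coef"
  unfolding theta_coef_def[abs_def] by (rule decays_of_real[OF decays_gauss])

lemma decays_log_coef: "decays log_coef"
proof (rule decays_mono[OF decays_of_real[OF decays_log_slope]])
  fix j :: int
  have "\<bar>log_slope q j / of_int j\<bar> \<le> \<bar>log_slope q j\<bar>"
  proof (cases "j = 0")
    case False
    then have "\<bar>log_slope q j\<bar> / \<bar>of_int j\<bar> \<le> \<bar>log_slope q j\<bar> / 1" by (intro divide_left_mono) auto
    then show ?thesis by simp
  qed simp
  then show "norm (log_coef j) \<le> norm (complex_of_real (log_slope q j))"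
    unfolding log_coef_def norm_of_real .
qed

lemma fourier_dcoef: "fourier (dcoef \<theta> c) s = of_real \<theta> * fourier (dcoef 1 c) s"
  unfolding fourier_def by (subst infsum_cmult_right'[symmetric]) (simp add: dcoef_def mult_ac)

text \<open>The recursion for the coefficients says that theta solves a linear equation of first order.\<close>
lemma theta_derivative: "fourier (dcoef \<theta> theta_coef) s = fourier (dcoef \<theta> log_coef) s * fourier theta_coef s"
proof -
  have "fourier (dcoef 1 theta_coef) s = fourier (dcoef 1 log_coef) s * fourier theta_coef s"
  proof (rule fourier_mult[OF decays_dcoef[OF decays_log_coef] decays_theta_coef])
    fix k
    have "((\<lambda>l. \<i> * complex_of_real (log_slope q l * q powi ((k - l)\<^sup>2))) has_sum \<i> * of_real (of_int k * q powi (k\<^sup>2))) UNIV"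
      by (intro has_sum_cmult_right has_sum_of_real theta_recursion)
    moreover have "dcoef 1 log_coef l * theta_coef (k - l) = \<i> * complex_of_real (log_slope q l * q powi ((k - l)\<^sup>2))" for l
      by (cases "l = 0") (auto simp: dcoef_def log_coef_def theta_coef_def log_slope_def)
    moreover have "dcoef 1 theta_coef k = \<i> * of_real (of_int k * q powi (k\<^sup>2))"
      by (simp add: dcoef_def theta_coef_def)
    ultimately show "((\<lambda>l. dcoef 1 log_coef l * theta_coef (k - l)) has_sum dcoef 1 theta_coef k) UNIV"
      by (simp only:)
  qed
  then show ?thesis by (simp add: fourier_dcoef[of \<theta>])
qed

text \<open>Solving that equation presents theta as a positive multiple of the exponential of
  a real Fourier series, which yields positivity on the real line together with the logarithm.\<close>
lemma theta_pos: "fourier theta_coef s \<in> \<real>" "re_fourier theta_coef s > 0"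
  and ln_theta: "ln (re_fourier theta_coef s) = re_fourier log_coef s + (ln (re_fourier theta_coef 0) - re_fourier log_coef 0)"
proof -
  show R: "fourier theta_coef s \<in> \<real>" for s by (rule fourier_real) (simp add: theta_coef_def)
  have dT: "((\<lambda>x. re_fourier theta_coef x) has_real_derivative re_fourier (dcoef 1 theta_coef) x) (at x)" for x
    using re_fourier_derivative[OF decays_theta_coef, of 1 x] by simp
  have dL: "((\<lambda>x. re_fourier log_coef x) has_real_derivative re_fourier (dcoef 1 log_coef) x) (at x)" for x
    using re_fourier_derivative[OF decays_log_coef, of 1 x] by simp
  have prod: "re_fourier (dcoef 1 theta_coef) x = re_fourier (dcoef 1 log_coef) x * re_fourier theta_coef x" for x
    using R[of x] by (simp add: re_fourier_def theta_derivative complex_is_Real_iff)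
  have "((\<lambda>x. re_fourier theta_coef x * exp (- re_fourier log_coef x)) has_real_derivative 0) (at x)" for x
    by (rule derivative_eq_intros dT dL refl | simp add: prod)+
  then have const: "re_fourier theta_coef s * exp (- re_fourier log_coef s) = re_fourier theta_coef 0 * exp (- re_fourier log_coef 0)" for s
    using DERIV_isconst_all[of "\<lambda>x. re_fourier theta_coef x * exp (- re_fourier log_coef x)" s 0] by simp
  have pos0: "re_fourier theta_coef 0 > 0"
  proof -
    have h: "((\<lambda>k. Re (theta_coef k * cis (0 * of_int k))) has_sum re_fourier theta_coef 0) UNIV"
      unfolding re_fourier_def by (rule has_sum_Re[OF has_sum_fourier[OF decays_theta_coef]])
    have "(\<Sum>k\<in>{0}. Re (theta_coef k * cis (0 * of_int k))) \<le> re_fourier theta_coef 0"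
      by (rule finite_sum_le_has_sum[OF h]) (use q in \<open>auto simp: theta_coef_def simp del: of_real_power_int\<close>)
    then show ?thesis by (simp add: theta_coef_def)
  qed
  have eq: "re_fourier theta_coef s = re_fourier theta_coef 0 * exp (- re_fourier log_coef 0) * exp (re_fourier log_coef s)" for s
    using const[of s] by (simp add: exp_minus field_simps)
  show "re_fourier theta_coef s > 0" unfolding eq[of s] using pos0 by simp
  show "ln (re_fourier theta_coef s) = re_fourier log_coef s + (ln (re_fourier theta_coef 0) - re_fourier log_coef 0)"
    unfolding eq[of s] using pos0 by (simp add: ln_mult)
qed

lemma theta_eq_fourier:
  assumes \<tau>: "\<tau> = \<i> * of_real (- ln q / pi)"
  shows "theta (of_real x) \<tau> = fourier theta_coef (2 * pi * x)"
  unfolding theta_def fourier_def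
proof (rule infsum_cong)
  fix k :: int
  have e1: "of_real pi * \<i> * of_int k ^ 2 * \<tau> = complex_of_real (of_int (k\<^sup>2) * ln q)"
    by (simp add: \<tau> field_simps)
  have e2: "exp (of_int (k\<^sup>2) * ln q) = q powi (k\<^sup>2)"
  proof -
    have "real_of_int (k\<^sup>2) = of_nat (nat (k\<^sup>2))" by simp
    then show ?thesis using q by (simp only: powi_sq_nat exp_of_nat_mult exp_ln)
  qed
  have e3: "exp (2 * of_real pi * \<i> * of_int k * of_real x) = cis (2 * pi * x * of_int k)"
    by (simp add: cis_conv_exp mult_ac)
  show "exp (of_real pi * \<i> * of_int k ^ 2 * \<tau> + 2 * of_real pi * \<i> * of_int k * of_real x) = theta_coef k * cis (2 * pi * x * of_int k)"
    unfolding exp_add e1 e3 exp_of_real e2 theta_coef_def ..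
qed

lemma one_gap_representation:
  fixes m0 n0 :: int
  assumes \<gamma>: "\<gamma> > 0" and m0: "m0 \<noteq> 0"
  defines "\<theta> \<equiv> 2 * pi / \<gamma>"
  defines "f \<equiv> \<lambda>\<zeta>. re_fourier (\<lambda>k. of_real (one_gap_coeff \<gamma> m0 q k)) (\<theta> * \<zeta>)"
  shows "\<exists>\<tau> U V W D. Im \<tau> > 0 \<and> U \<noteq> 0 \<and>
        (\<forall>s::real. theta (of_real s) \<tau> \<in> \<real> \<and> Re (theta (of_real s) \<tau>) > 0) \<and>
        (\<forall>t z. travelling_wave f \<omega> m0 n0 d t z =
           12 * dx (dx (\<lambda>(x, y). ln (Re (theta (of_real (U * x + V * y + W * t + D)) \<tau>)))) z)"
proof -
  define \<tau> where "\<tau> = \<i> * complex_of_real (- ln q / pi)"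
  note th = theta_eq_fourier[OF \<tau>_def]
  have \<tau>: "Im \<tau> > 0" using q by (simp add: \<tau>_def divide_neg_pos)
  define K where "K = ln (re_fourier theta_coef 0) - re_fourier log_coef 0"
  define L where "L \<zeta> = re_fourier log_coef (\<theta> * \<zeta>) + K" for \<zeta>
  define L1 where "L1 \<zeta> = re_fourier (dcoef \<theta> log_coef) (\<theta> * \<zeta>)" for \<zeta>
  define L2 where "L2 \<zeta> = re_fourier (dcoef \<theta> (dcoef \<theta> log_coef)) (\<theta> * \<zeta>)" for \<zeta>
  have d1: "(L has_real_derivative L1 \<zeta>) (at \<zeta>)" for \<zeta>
    unfolding L_def[abs_def] L1_def using re_fourier_derivative[OF decays_log_coef, of \<theta> \<zeta>] by (auto intro!: derivative_eq_intros)
  have d2: "(L1 has_real_derivative L2 \<zeta>) (at \<zeta>)" for \<zeta>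
    unfolding L1_def[abs_def] L2_def by (rule re_fourier_derivative[OF decays_dcoef[OF decays_log_coef]])
  let ?m = "real_of_int m0" and ?n = "real_of_int n0"
  have ln: "ln (Re (theta (of_real (?m / \<gamma> * x + ?n / \<gamma> * y + \<omega> / \<gamma> * t + d / \<gamma>)) \<tau>)) = L (?m * x + ?n * y + (\<omega> * t + d))" for x y t
  proof -
    have "2 * pi * (?m / \<gamma> * x + ?n / \<gamma> * y + \<omega> / \<gamma> * t + d / \<gamma>) = \<theta> * (?m * x + ?n * y + (\<omega> * t + d))"
      using \<gamma> by (simp add: \<theta>_def field_simps)
    then show ?thesis unfolding th re_fourier_def[symmetric] L_def K_def by (subst ln_theta) (simp only:)
  qed
  have coef: "one_gap_coeff \<gamma> m0 q k = 12 * ?m\<^sup>2 * (- (\<theta>\<^sup>2 * (of_int k * log_slope q k)))" for k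
  proof -
    have "(-1::real) powi k = (-1) ^ nat \<bar>k\<bar>" by (simp add: power_int_minus_left minus_one_power_iff even_nat_iff)
    then show ?thesis unfolding log_slope_lambert one_gap_coeff_def lambert_def
      by (simp add: \<theta>_def power_divide power_mult_distrib)
  qed
  have f: "f \<zeta> = 12 * (?m * (?m * L2 \<zeta>))" for \<zeta>
  proof -
    have "complex_of_real (one_gap_coeff \<gamma> m0 q k) = of_real (12 * ?m * ?m) * dcoef \<theta> (dcoef \<theta> log_coef) k" for k
      unfolding coef by (cases "k = 0") (auto simp: dcoef_def log_coef_def power2_eq_square)
    then have "fourier (\<lambda>k. of_real (one_gap_coeff \<gamma> m0 q k)) s = of_real (12 * ?m * ?m) * fourier (dcoef \<theta> (dcoef \<theta> log_coef)) s" for s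
      unfolding fourier_def by (subst infsum_cmult_right'[symmetric]) (simp add: mult_ac)
    then show ?thesis by (simp add: f_def re_fourier_def L2_def)
  qed
  have "travelling_wave f \<omega> m0 n0 d t z = 12 * dx (dx (\<lambda>(x, y). ln (Re (theta (of_real (?m / \<gamma> * x + ?n / \<gamma> * y + \<omega> / \<gamma> * t + d / \<gamma>)) \<tau>)))) z" for t z
  proof -
    have "(\<lambda>(x, y). ln (Re (theta (of_real (?m / \<gamma> * x + ?n / \<gamma> * y + \<omega> / \<gamma> * t + d / \<gamma>)) \<tau>))) = pwave ?m ?n L (\<omega> * t + d)"
      unfolding ln pwave_def ..
    then show ?thesis
      by (simp only: dx_pwave(1)[OF d1] dx_pwave(1)[OF DERIV_cmult[OF d2]] travelling_wave_pwave) (simp add: pwave_def f case_prod_unfold)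
  qed
  moreover have "theta (of_real s) \<tau> \<in> \<real> \<and> Re (theta (of_real s) \<tau>) > 0" for s :: real
    unfolding th using theta_pos[of "2 * pi * s"] by (simp add: re_fourier_def)
  ultimately show ?thesis using \<tau> m0 \<gamma>
    by (intro exI[of _ \<tau>] exI[of _ "?m / \<gamma>"] exI[of _ "?n / \<gamma>"] exI[of _ "\<omega> / \<gamma>"] exI[of _ "d / \<gamma>"]) auto
qed

end

section \<open>From the algebra to travelling waves\<close>

lemma real_analytic_on_Re_holomorphic:
  assumes h: "h holomorphic_on ball 0 \<rho>" and f: "\<And>r. r \<in> {0<..<\<rho>} \<Longrightarrow> f r = Re (h (of_real r))"
  shows "real_analytic_on f {0<..<\<rho>}"
  unfolding real_analytic_on_def
proof
  fix x assume x: "x \<in> {0<..<\<rho>}"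
  define \<epsilon> where "\<epsilon> = min x (\<rho> - x)"
  define a where "a n = Re ((deriv ^^ n) h (of_real x) / fact n)" for n
  have sub: "ball (complex_of_real x) \<epsilon> \<subseteq> ball 0 \<rho>"
  proof
    fix z assume "z \<in> ball (complex_of_real x) \<epsilon>"
    then have "norm (z - of_real x) < \<rho> - x" by (simp add: dist_norm norm_minus_commute \<epsilon>_def)
    then show "z \<in> ball 0 \<rho>" using norm_triangle_ineq[of "z - of_real x" "of_real x"] x by simp
  qed
  have "(\<lambda>n. a n * (y - x) ^ n) sums f y" if y: "\<bar>y - x\<bar> < \<epsilon>" for y
  proof -
    have yb: "complex_of_real y \<in> ball (of_real x) \<epsilon>"
      using y by (simp add: dist_norm norm_minus_commute flip: of_real_diff)
    have "(\<lambda>n. (deriv ^^ n) h (of_real x) / fact n * (of_real y - of_real x) ^ n) sums h (of_real y)"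
      by (rule holomorphic_power_series[OF holomorphic_on_subset[OF h sub] yb])
    then have "(\<lambda>n. Re ((deriv ^^ n) h (of_real x) / fact n * of_real ((y - x) ^ n))) sums Re (h (of_real y))"
      by (simp add: sums_complex_iff)
    moreover have "f y = Re (h (of_real y))" using y by (intro f) (auto simp: \<epsilon>_def)
    moreover have "Re (c * complex_of_real t) = Re c * t" for c t by simp
    ultimately show ?thesis unfolding a_def by (simp only:)
  qed
  then show "\<exists>\<epsilon>>0. \<exists>a. \<forall>y. \<bar>y - x\<bar> < \<epsilon> \<longrightarrow> (\<lambda>n. a n * (y - x) ^ n) sums f y"
    using x by (intro exI[of _ \<epsilon>]) (auto simp: \<epsilon>_def)
qed

text \<open>The mode 0 is a power series in \<open>r\<^sup>2\<close>.\<close>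
lemma real_analytic_on_mode0:
  assumes \<rho>: "\<rho> > 0"
  shows "real_analytic_on (\<lambda>r. c + Re (mode (r / \<rho>) 0 K)) {0<..<\<rho>}"
proof -
  define a where "a j = complex_of_real (coef K (j, j))" for j
  define g where "g z = (\<Sum>j. a j * z ^ j)" for z
  have sa: "summable (\<lambda>j. norm (a j))"
  proof (rule summable_on_imp_summable)
    have "(\<lambda>p. \<bar>coef K p\<bar>) summable_on range (\<lambda>j. (j, j))"
      by (rule summable_on_subset_banach[OF coef_summable']) auto
    then show "(\<lambda>j. norm (a j)) summable_on UNIV"
      by (subst (asm) summable_on_reindex) (auto simp: inj_on_def o_def a_def)
  qed
  have g: "(\<lambda>j. a j * z ^ j) sums g z" if "norm z < 1" for z
    unfolding g_def
  proof (rule summable_sums, rule summable_comparison_test[OF _ sa])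
    show "\<exists>N. \<forall>j\<ge>N. norm (a j * z ^ j) \<le> norm (a j)"
      using that by (auto simp: norm_mult norm_power intro!: mult_left_le power_le_one exI[of _ 0])
  qed
  have "g holomorphic_on ball 0 1"
    by (rule power_series_holomorphic[of 0 1 a]) (use g in auto)
  then have "(g \<circ> (\<lambda>z. (z / of_real \<rho>)\<^sup>2)) holomorphic_on ball 0 \<rho>"
  proof (rule holomorphic_on_compose_gen[rotated])
    show "(\<lambda>z. (z / complex_of_real \<rho>)\<^sup>2) ` ball 0 \<rho> \<subseteq> ball 0 1"
      using \<rho> by (auto simp: norm_power norm_divide power_less_one_iff)
  qed (use \<rho> in \<open>auto intro!: holomorphic_intros\<close>)
  then have hol: "(\<lambda>z. of_real c + g ((z / of_real \<rho>)\<^sup>2)) holomorphic_on ball 0 \<rho>"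
    by (auto intro!: holomorphic_intros simp: o_def)
  show ?thesis
  proof (rule real_analytic_on_Re_holomorphic[OF hol])
    fix r assume r: "r \<in> {0<..<\<rho>}"
    have x: "0 \<le> r / \<rho>" "r / \<rho> \<le> 1" "r / \<rho> < 1" using r by auto
    have "(\<lambda>j. of_real (coef K (j + 0, j) * (r / \<rho>) ^ (2 * j + 0))) sums mode (r / \<rho>) (int 0) K"
      by (rule has_sum_imp_sums[OF has_sum_mode_shift[OF x(1,2)]])
    then have "(\<lambda>j. a j * ((of_real r / of_real \<rho>)\<^sup>2) ^ j) sums mode (r / \<rho>) 0 K"
      by (simp add: a_def power_mult)
    moreover have "norm ((complex_of_real r / of_real \<rho>)\<^sup>2) < 1"
      using x r by (simp add: norm_power norm_divide power_less_one_iff)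
    ultimately have "mode (r / \<rho>) 0 K = g ((of_real r / of_real \<rho>)\<^sup>2)" using g sums_unique2 by blast
    then show "c + Re (mode (r / \<rho>) 0 K) = Re (of_real c + g ((of_real r / of_real \<rho>)\<^sup>2))" by simp
  qed
qed

lemma mode_real: "mode r k X \<in> \<real>"
proof -
  have "cnj (mode r k X) = mode r k X"
    unfolding mode_def pair_def infsum_cnj[symmetric] by (rule infsum_cong) (simp add: case_prod_unfold)
  then show ?thesis by (simp add: Reals_cnj_iff)
qed

context
  fixes r :: real assumes r: "0 < r" "r < 1"
begin

lemma r01: "0 \<le> r" "r \<le> 1" using r by auto

lemma decays_mode: "decays (\<lambda>k. mode r k X)"
  by (rule decaysI[of r _ "norm X"]) (use r norm_mode_le[of r 0 X] in \<open>auto simp: mult.commute\<close>)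

lemma val_fourier: "val r s X = fourier (\<lambda>k. mode r k X) s"
  using has_sum_unique[OF has_sum_mode_val[OF r01] has_sum_fourier[OF decays_mode]] .

lemma mode_even: "swapw X = X \<Longrightarrow> mode r (- k) X = mode r k X"
  using mode_swapw[OF r01, of k X] by simp

lemma val_real: "swapw X = X \<Longrightarrow> val r s X \<in> \<real>"
  unfolding val_fourier by (rule fourier_real) (simp add: mode_even, metis Reals_cnj_iff mode_real)

text \<open>Elements independent of \<open>\<zeta>\<close> evaluate to their mode 0 at every point.\<close>
lemma val_diag:
  assumes "diag K" shows "val r s K = mode r 0 K"
proof -
  have "fourier (\<lambda>k. mode r k K) s = mode r 0 K"
    unfolding fourier_def
    by (rule infsumI, rule has_sum_finite_neutralI[where B = "{0}"]) (auto simp: mode_diag[OF assms r01])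
  then show ?thesis by (simp add: val_fourier)
qed

end

context wave
begin

definition profile :: "real \<Rightarrow> wiener \<Rightarrow> real \<Rightarrow> real" where
  "profile r X \<zeta> = re_fourier (\<lambda>k. mode r k X) (\<theta> * \<zeta>)"

text \<open>The factor omitted in \<open>jet_symbol\<close>.\<close>
definition unit :: "jetvar \<Rightarrow> complex" where "unit v = (if v \<in> {Dx, Dy} then \<i> else 1)"

context
  fixes r :: real and \<Phi> :: wiener
  assumes r: "0 < r" "r < 1" and \<Phi>: "swapw \<Phi> = \<Phi>" and \<Phi>0: "\<And>i. coef \<Phi> (i, i) = 0"
begin

abbreviation "pc \<equiv> (\<lambda>k. mode r k (multiplier dinv2 \<Phi>))"

lemma mode0: "mode r 0 \<Phi> = 0"
  unfolding mode_def pair_def by (rule infsum_0) (auto simp: \<Phi>0 split: if_splits)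

lemma pc: "pc k = mode r k \<Phi> / (of_int k)\<^sup>2"
  using r by (simp add: mode_multiplier[OF dinv2_le] dinv2_def)

lemma dcoef2_pc: "dcoef \<theta> (dcoef \<theta> pc) k = of_real (- \<theta>\<^sup>2) * mode r k \<Phi>"
  unfolding dcoef_def pc by (cases "k = 0") (auto simp: mode0 power2_eq_square mult.left_commute[of "of_real \<theta>" "\<i>"])

definition F :: "nat \<Rightarrow> real \<Rightarrow> real" where
  "F j \<zeta> = re_fourier ((dcoef \<theta> ^^ j) (\<lambda>k. pc k / (\<i> * of_real \<theta> * of_int k))) (\<theta> * \<zeta>)"

lemma decays_pc: "decays pc" by (rule decays_mode[OF r])

lemma dcoef_antiderivative: "dcoef \<theta> (\<lambda>k. pc k / (\<i> * of_real \<theta> * of_int k)) = pc"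
proof
  show "dcoef \<theta> (\<lambda>k. pc k / (\<i> * of_real \<theta> * of_int k)) k = pc k" for k
    using \<theta> by (cases "k = 0") (auto simp: dcoef_def pc mode0)
qed

lemma F_derivative: "(F j has_real_derivative F (Suc j) \<zeta>) (at \<zeta>)"
proof -
  have "decays (\<lambda>k. pc k / (\<i> * of_real \<theta> * of_int k))"
  proof (rule decays_mono[OF decays_cmult[OF decays_pc, of "of_real (1 / \<theta>)"]])
    fix k :: int
    have "norm (pc k) / (\<theta> * \<bar>of_int k\<bar>) \<le> norm (pc k) / (\<theta> * 1)" if "k \<noteq> 0"
      using that \<theta> by (intro divide_left_mono mult_left_mono) auto
    then show "norm (pc k / (\<i> * of_real \<theta> * of_int k)) \<le> norm (of_real (1 / \<theta>) * pc k)"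
      using \<theta> by (cases "k = 0") (auto simp: norm_mult norm_divide)
  qed
  then have "decays ((dcoef \<theta> ^^ j) (\<lambda>k. pc k / (\<i> * of_real \<theta> * of_int k)))"
    by (induction j) (auto intro: decays_dcoef)
  from re_fourier_derivative[OF this] show ?thesis unfolding F_def[abs_def] by simp
qed

lemma F1: "F 1 = profile r (multiplier dinv2 \<Phi>)"
  by (simp add: F_def[abs_def] profile_def[abs_def] dcoef_antiderivative)

lemma F_jet: "F 2 \<zeta> = re_fourier (dcoef \<theta> pc) (\<theta> * \<zeta>)" "F 3 \<zeta> = - \<theta>\<^sup>2 * Re (val r (\<theta> * \<zeta>) \<Phi>)"
proof -
  show "F 2 \<zeta> = re_fourier (dcoef \<theta> pc) (\<theta> * \<zeta>)" by (simp add: F_def numeral_2_eq_2 dcoef_antiderivative)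
  have "(dcoef \<theta> ^^ 3) (\<lambda>k. pc k / (\<i> * of_real \<theta> * of_int k)) = (\<lambda>k. of_real (- \<theta>\<^sup>2) * mode r k \<Phi>)"
    by (simp add: numeral_3_eq_3 dcoef_antiderivative dcoef2_pc[abs_def] fun_eq_iff dcoef2_pc)
  moreover have "fourier (\<lambda>k. of_real (- \<theta>\<^sup>2) * mode r k \<Phi>) s = of_real (- \<theta>\<^sup>2) * fourier (\<lambda>k. mode r k \<Phi>) s" for s
    unfolding fourier_def mult.assoc by (rule infsum_cmult_right')
  ultimately show "F 3 \<zeta> = - \<theta>\<^sup>2 * Re (val r (\<theta> * \<zeta>) \<Phi>)" unfolding F_def re_fourier_def val_fourier[OF r] by simp
qed

lemma of_real_re_fourier: "fourier c s \<in> \<real> \<Longrightarrow> complex_of_real (re_fourier c s) = fourier c s"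
  by (simp add: re_fourier_def)

lemma sym_f: "swapw (multiplier dinv2 \<Phi>) = multiplier dinv2 \<Phi>"
  using multiplier_swapw[OF dinv2_le, of 1 \<Phi>] by (simp add: \<Phi> dinv2_def)

lemma profile_jet:
  "of_real (jet (pwave m n (F 1) e) (x, y) v) = unit v * val r (\<theta> * (m * x + n * y + e)) (jets \<Phi> v)"
proof -
  have r': "0 \<le> r" "r \<le> 1" using r by auto
  define s where "s = \<theta> * (m * x + n * y + e)"
  have d: "((\<lambda>\<zeta>. a * F j \<zeta>) has_real_derivative a * F (Suc j) \<zeta>) (at \<zeta>)" for a j \<zeta>
    by (rule DERIV_cmult[OF F_derivative])
  have dxs: "dx (pwave m n (\<lambda>s. a * F j s) e) = pwave m n (\<lambda>s. m * (a * F (Suc j) s)) e"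
    "dy (pwave m n (\<lambda>s. a * F j s) e) = pwave m n (\<lambda>s. n * (a * F (Suc j) s)) e" for a j
    using dx_pwave[OF d[of a j], of m n e] by simp_all
  have dx1: "dx (pwave m n (F 1) e) = pwave m n (\<lambda>s. m * F 2 s) e" "dy (pwave m n (F 1) e) = pwave m n (\<lambda>s. n * F 2 s) e"
    using dxs[of 1 1] by (simp_all add: numeral_2_eq_2)
  have dx2: "dx (pwave m n (\<lambda>s. a * F 2 s) e) = pwave m n (\<lambda>s. m * (a * F 3 s)) e"
    "dy (pwave m n (\<lambda>s. a * F 2 s) e) = pwave m n (\<lambda>s. n * (a * F 3 s)) e" for a
    using dxs[of a 2] by (simp_all add: numeral_3_eq_3 numeral_2_eq_2)
  have v0: "of_real (F 1 (m * x + n * y + e)) = val r s (multiplier dinv2 \<Phi>)"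
  proof -
    have "fourier pc s \<in> \<real>" using val_real[OF r sym_f, of s] by (simp add: val_fourier[OF r])
    then show ?thesis unfolding F1 profile_def val_fourier[OF r] s_def[symmetric] by (rule of_real_re_fourier)
  qed
  have v1: "of_real (a * F 2 (m * x + n * y + e)) = \<i> * val r s (multiplier (\<lambda>k. a * \<theta> / of_int k) \<Phi>)" for a
  proof -
    have mb: "multiplier_bound \<bar>a * \<theta>\<bar> (\<lambda>k. a * \<theta> / of_int k)" using divide_int_le by (simp add: multiplier_bound_def)
    have R: "fourier (dcoef \<theta> pc) s \<in> \<real>"
    proof (rule fourier_real)
      fix k
      have "cnj (pc k) = pc k" using mode_real by (simp add: Reals_cnj_iff)
      then show "dcoef \<theta> pc (- k) = cnj (dcoef \<theta> pc k)"
        using mode_even[OF r sym_f, of k] by (simp add: dcoef_def)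
    qed
    have "\<i> * val r s (multiplier (\<lambda>k. a * \<theta> / of_int k) \<Phi>) = (\<Sum>\<^sub>\<infinity>k. \<i> * (mode r k (multiplier (\<lambda>k. a * \<theta> / of_int k) \<Phi>) * cis (s * of_int k)))"
      unfolding val_fourier[OF r] fourier_def by (rule infsum_cmult_right'[symmetric])
    also have "\<dots> = (\<Sum>\<^sub>\<infinity>k. of_real a * (dcoef \<theta> pc k * cis (s * of_int k)))"
    proof (rule infsum_cong)
      fix k :: int
      show "\<i> * (mode r k (multiplier (\<lambda>k. a * \<theta> / of_int k) \<Phi>) * cis (s * of_int k)) = of_real a * (dcoef \<theta> pc k * cis (s * of_int k))"
        unfolding mode_multiplier[OF mb r'] dcoef_def pc by (cases "k = 0") (auto simp: mode0 power2_eq_square)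
    qed
    also have "\<dots> = of_real a * fourier (dcoef \<theta> pc) s" unfolding fourier_def by (rule infsum_cmult_right')
    also have "\<dots> = of_real (a * F 2 (m * x + n * y + e))"
      unfolding F_jet s_def[symmetric] of_real_mult of_real_re_fourier[OF R] ..
    finally show ?thesis by simp
  qed
  have v2: "of_real (a * F 3 (m * x + n * y + e)) = val r s (multiplier (\<lambda>_. - (a * \<theta>\<^sup>2)) \<Phi>)" for a
  proof -
    have "multiplier (\<lambda>_. - (a * \<theta>\<^sup>2)) \<Phi> = (- (a * \<theta>\<^sup>2)) *\<^sub>R \<Phi>"
      by (rule wiener_eqI) (auto simp: coef_multiplier[of "\<bar>a * \<theta>\<^sup>2\<bar>"] multiplier_bound_def)
    moreover have "val r s \<Phi> = of_real (Re (val r s \<Phi>))" using val_real[OF r \<Phi>] by simp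
    ultimately show ?thesis
      using linear_cmul[OF bounded_linear.linear[OF bounded_linear_val[OF r', of s]], of "- (a * \<theta>\<^sup>2)" \<Phi>]
      by (simp add: F_jet s_def[symmetric] scaleR_conv_of_real mult_ac)
  qed
  have jet_symbol0: "multiplier (jet_symbol D0) \<Phi> = multiplier dinv2 \<Phi>" using jets_D0[of \<Phi>] by (simp add: jets_def)
  have jet_symbol_eq: "multiplier (jet_symbol Dx) \<Phi> = multiplier (\<lambda>k. m * \<theta> / of_int k) \<Phi>" "multiplier (jet_symbol Dy) \<Phi> = multiplier (\<lambda>k. n * \<theta> / of_int k) \<Phi>"
    "multiplier (jet_symbol Dxx) \<Phi> = multiplier (\<lambda>_. - ((m * m) * \<theta>\<^sup>2)) \<Phi>" "multiplier (jet_symbol Dxy) \<Phi> = multiplier (\<lambda>_. - ((m * n) * \<theta>\<^sup>2)) \<Phi>"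
    "multiplier (jet_symbol Dyy) \<Phi> = multiplier (\<lambda>_. - ((n * n) * \<theta>\<^sup>2)) \<Phi>"
    by (simp_all add: multiplier_def power2_eq_square mult_ac)
  show ?thesis
    unfolding s_def[symmetric] jets_def
    by (cases v; simp only: jet.simps dx1 dx2 jet_symbol_eq jet_symbol0 unit_def insert_iff empty_iff jetvar.distinct if_True if_False simp_thms mult_1)
       (simp_all only: pwave_def prod.case mult.assoc[symmetric] v0 v1 v2)
qed

text \<open>The algebraic equation evaluated at a point says that a combination of \<open>f\<close>, \<open>f''\<close>, \<open>f\<^sup>2\<close> and
  the perturbation is independent of \<open>\<zeta>\<close>; differentiating removes the constant.\<close>
lemma profile_equation:
  assumes dE: "diag (\<kappa> * multiplier dinv2 \<Phi> + \<mu> *\<^sub>R (multiplier dinv2 \<Phi> - \<Phi>) + m *\<^sub>R ((1/2) *\<^sub>R (multiplier dinv2 \<Phi>)\<^sup>2 + M))"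
    and d\<kappa>: "diag \<kappa>" and M: "swapw M = M"
  shows "(\<mu> + Re (mode r 0 \<kappa>)) * F 2 \<zeta> + m ^ 3 * F 4 \<zeta> + m * F 1 \<zeta> * F 2 \<zeta> + m * re_fourier (dcoef \<theta> (\<lambda>k. mode r k M)) (\<theta> * \<zeta>) = 0"
proof -
  let ?f = "multiplier dinv2 \<Phi>"
  have r': "0 \<le> r" "r \<le> 1" using r by auto
  interpret V: bounded_linear "val r s" for s by (rule bounded_linear_val[OF r'])
  define k0 where "k0 = Re (mode r 0 \<kappa>)"
  have k0: "mode r 0 \<kappa> = of_real k0" using mode_real[of r 0 \<kappa>] by (simp add: k0_def)
  define E where "E = \<kappa> * ?f + \<mu> *\<^sub>R (?f - \<Phi>) + m *\<^sub>R ((1/2) *\<^sub>R ?f\<^sup>2 + M)"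
  define g where "g \<zeta> = k0 * F 1 \<zeta> + \<mu> * (F 1 \<zeta> + F 3 \<zeta> / \<theta>\<^sup>2) + m * (F 1 \<zeta> * F 1 \<zeta> / 2 + profile r M \<zeta>)" for \<zeta>
  have "g \<zeta> = Re (mode r 0 E)" for \<zeta>
  proof -
    let ?s = "\<theta> * \<zeta>"
    have f: "val r ?s ?f = of_real (F 1 \<zeta>)"
      using val_real[OF r sym_f, of ?s] unfolding F1 profile_def val_fourier[OF r] by (simp add: re_fourier_def)
    have p: "val r ?s \<Phi> = of_real (- F 3 \<zeta> / \<theta>\<^sup>2)"
      using val_real[OF r \<Phi>, of ?s] \<theta> by (simp add: F_jet)
    have M': "val r ?s M = of_real (profile r M \<zeta>)"
      using val_real[OF r M, of ?s] by (simp add: profile_def val_fourier[OF r] re_fourier_def)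
    have "mode r 0 E = val r ?s E" using val_diag[OF r, of E] dE by (simp add: E_def)
    also have "\<dots> = of_real (g \<zeta>)"
      unfolding E_def V.add V.diff V.scaleR power2_eq_square[of ?f] val_mult[OF r'] val_diag[OF r d\<kappa>] k0 f p M'
      by (simp add: g_def scaleR_conv_of_real)
    finally show ?thesis by simp
  qed
  then have const: "g = (\<lambda>_. Re (mode r 0 E))" by auto
  have dM: "((\<lambda>\<zeta>. profile r M \<zeta>) has_real_derivative re_fourier (dcoef \<theta> (\<lambda>k. mode r k M)) (\<theta> * \<zeta>)) (at \<zeta>)"
    unfolding profile_def by (rule re_fourier_derivative[OF decays_mode[OF r]])
  have dF: "(F 1 has_real_derivative F 2 \<zeta>) (at \<zeta>)" "(F 3 has_real_derivative F 4 \<zeta>) (at \<zeta>)"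
    using F_derivative[of 1 \<zeta>] F_derivative[of 3 \<zeta>] by (simp_all add: numeral_2_eq_2 eval_nat_numeral)
  have "(g has_real_derivative k0 * F 2 \<zeta> + \<mu> * (F 2 \<zeta> + F 4 \<zeta> / \<theta>\<^sup>2) + m * (F 1 \<zeta> * F 2 \<zeta> + re_fourier (dcoef \<theta> (\<lambda>k. mode r k M)) (\<theta> * \<zeta>))) (at \<zeta>)"
  proof -
    have *: "((\<lambda>\<zeta>. k0 * a \<zeta> + \<mu> * (a \<zeta> + b \<zeta> / t) + m * (a \<zeta> * a \<zeta> / 2 + c \<zeta>)) has_real_derivative
        k0 * a' + \<mu> * (a' + b' / t) + m * (a \<zeta> * a' + c')) (at \<zeta>)"
      if "(a has_real_derivative a') (at \<zeta>)" "(b has_real_derivative b') (at \<zeta>)" "(c has_real_derivative c') (at \<zeta>)"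
      and "t \<noteq> 0" for a b c :: "real \<Rightarrow> real" and a' b' c' t
      using that by (auto intro!: derivative_eq_intros simp: field_simps)
    show ?thesis unfolding g_def[abs_def] by (rule *[OF dF dM]) (use \<theta> in simp)
  qed
  moreover have "(g has_real_derivative 0) (at \<zeta>)" unfolding const by simp
  ultimately have "k0 * F 2 \<zeta> + \<mu> * (F 2 \<zeta> + F 4 \<zeta> / \<theta>\<^sup>2) + m * (F 1 \<zeta> * F 2 \<zeta> + re_fourier (dcoef \<theta> (\<lambda>k. mode r k M)) (\<theta> * \<zeta>)) = 0"
    by (rule DERIV_unique)
  moreover have "\<mu> * (F 4 \<zeta> / \<theta>\<^sup>2) = m ^ 3 * F 4 \<zeta>" using \<theta> by (simp add: \<mu>_def)
  ultimately show ?thesis by (simp add: k0_def algebra_simps)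
qed

lemma wave_solution:
  fixes m0 n0 :: int
  assumes mn: "m = of_int m0" "n = of_int n0" and \<gamma>: "\<gamma> > 0" "\<theta> = 2 * pi / \<gamma>"
    and dE: "diag (\<kappa> * multiplier dinv2 \<Phi> + \<mu> *\<^sub>R (multiplier dinv2 \<Phi> - \<Phi>) + m *\<^sub>R ((1/2) *\<^sub>R (multiplier dinv2 \<Phi>)\<^sup>2 + M))"
    and d\<kappa>: "diag \<kappa>" and M: "swapw M = M"
    and P: "\<And>e z. P (pwave m n (profile r (multiplier dinv2 \<Phi>)) e) z = pwave m n (\<lambda>\<zeta>. m * re_fourier (dcoef \<theta> (\<lambda>k. mode r k M)) (\<theta> * \<zeta>)) e z"
  shows "kp_solution \<gamma> lam P (travelling_wave (profile r (multiplier dinv2 \<Phi>)) (\<mu> + lam * n\<^sup>2 / m + Re (mode r 0 \<kappa>)) m0 n0 d)"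
  unfolding F1[symmetric]
proof (rule kp_travelling_wave[where F = F, OF \<gamma>(1) _ F_derivative])
  show "m0 \<noteq> 0" using m mn by auto
  show "F j (x + of_int l * \<gamma>) = F j x" for j l x
    unfolding F_def using \<gamma> by (intro re_fourier_periodic) simp
  show "P (pwave (of_int m0) (of_int n0) (F 1) e) z = pwave (of_int m0) (of_int n0) (\<lambda>\<zeta>. m * re_fourier (dcoef \<theta> (\<lambda>k. mode r k M)) (\<theta> * \<zeta>)) e z" for e z
    unfolding mn[symmetric] F1 by (rule P)
  fix s
  show "(\<mu> + lam * n\<^sup>2 / m + Re (mode r 0 \<kappa>)) * F 2 s + of_int m0 ^ 3 * F 4 s - lam * ((of_int n0)\<^sup>2 / of_int m0) * F 2 s + of_int m0 * F 1 s * F 2 s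
     + m * re_fourier (dcoef \<theta> (\<lambda>k. mode r k M)) (\<theta> * s) = 0"
    using profile_equation[OF dE d\<kappa> M, of s] unfolding mn[symmetric] by (simp add: algebra_simps)
qed

lemma profile_fourier:
  assumes "\<gamma> > 0" "\<theta> = 2 * pi / \<gamma>"
  shows "has_fourier_series \<gamma> (profile r (multiplier dinv2 \<Phi>)) pc"
  unfolding has_fourier_series_def
proof
  fix \<zeta>
  have "fourier pc (\<theta> * \<zeta>) = of_real (profile r (multiplier dinv2 \<Phi>) \<zeta>)"
    using val_real[OF r sym_f, of "\<theta> * \<zeta>"] by (simp add: profile_def val_fourier[OF r] re_fourier_def)
  with has_sum_fourier[OF decays_pc, of "\<theta> * \<zeta>"]
  have "((\<lambda>k. pc k * cis (\<theta> * \<zeta> * of_int k)) has_sum of_real (profile r (multiplier dinv2 \<Phi>) \<zeta>)) UNIV" by simp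
  then show "((\<lambda>k. pc k * exp (2 * of_real pi * \<i> / of_real \<gamma> * of_int k * of_real \<zeta>)) has_sum of_real (profile r (multiplier dinv2 \<Phi>) \<zeta>)) (UNIV - {0})"
  proof (rule has_sum_cong_neutral[THEN iffD1, rotated -1])
    show "pc k * cis (\<theta> * \<zeta> * of_int k) = 0" if "k \<in> UNIV - (UNIV - {0})" for k using that by (simp add: pc mode0)
    show "pc k * cis (\<theta> * \<zeta> * of_int k) = pc k * exp (2 * of_real pi * \<i> / of_real \<gamma> * of_int k * of_real \<zeta>)" for k
      using assms by (simp add: cis_conv_exp mult_ac)
  qed auto
qed

end

end

context wave
begin

section \<open>The perturbation\<close>

lemma monomial_reflect:
  fixes z :: "jetvar \<Rightarrow> complex"
  shows "monomial (z(Dx := - z Dx, Dy := - z Dy)) \<alpha> = (-1) ^ parity \<alpha> * monomial z \<alpha>"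
  unfolding monomial_jetvar parity_def power_add
  by (simp add: power_minus[of "z _"] mult_ac)

lemma monomial_unit:
  assumes "\<And>v. z v = unit v * V v"
  shows "monomial z \<alpha> = \<i> ^ parity \<alpha> * monomial V \<alpha>"
  unfolding monomial_jetvar parity_def power_add assms
  by (simp add: unit_def power_mult_distrib mult_ac)

text \<open>At the jet of a wave the first derivatives are \<open>\<i>\<close> times evaluations of elements of the
  algebra. The coefficients \<open>b\<close> express \<open>Q\<close> through these evaluations.\<close>
definition represents :: "real \<Rightarrow> ((jetvar \<Rightarrow> nat) \<Rightarrow> real) \<Rightarrow> ((jetvar \<Rightarrow> complex) \<Rightarrow> complex) \<Rightarrow> bool" where
  "represents \<epsilon> b Q \<longleftrightarrow> (\<forall>z V. (\<forall>v. \<bar>z v\<bar> < \<epsilon>) \<longrightarrow> (\<forall>v. of_real (z v) = unit v * V v) \<longrightarrow>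
     ((\<lambda>\<alpha>. of_real (b \<alpha>) * monomial V \<alpha>) has_sum Q (\<lambda>v. of_real (z v))) UNIV)"

text \<open>Averaging the Taylor series of \<open>Q\<close> over the reflection of \<open>u\<^sub>x\<close> and \<open>u\<^sub>y\<close> leaves only the
  monomials with an even number of first derivatives, whose factors \<open>\<i>\<close> multiply to a sign.
  Hence the coefficients with respect to the algebra are real.\<close>
lemma admissible_coefficients:
  assumes "admissible_perturbation \<gamma> p R Q"
  obtains \<epsilon> b where "0 < \<epsilon>" "\<epsilon> \<le> R" "majorised \<epsilon> b" "\<And>\<alpha>. deg \<alpha> < p + 2 \<Longrightarrow> b \<alpha> = 0" "\<And>\<alpha>. odd (parity \<alpha>) \<Longrightarrow> b \<alpha> = 0"
    "represents \<epsilon> b Q"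
proof -
  from assms obtain a where R: "R > 0" and T: "has_taylor Q (\<lambda>_. 0) a" and re: "\<And>\<alpha>. a \<alpha> \<in> \<real>"
    and van: "\<And>\<alpha>. deg \<alpha> < p + 2 \<Longrightarrow> a \<alpha> = 0"
    and sym: "\<And>z. z \<in> polydisc (\<lambda>_. 0) R \<Longrightarrow> Q (z(Dx := - z Dx, Dy := - z Dy)) = Q z"
    unfolding admissible_perturbation_def deg_def by blast
  from T obtain \<epsilon>0 where \<epsilon>0: "\<epsilon>0 > 0" and hs: "\<And>z. z \<in> polydisc (\<lambda>_. 0) \<epsilon>0 \<Longrightarrow> ((\<lambda>\<alpha>. a \<alpha> * monomial z \<alpha>) has_sum Q z) UNIV"
    unfolding has_taylor_def monomial_def by auto
  define \<epsilon> where "\<epsilon> = min (\<epsilon>0 / 2) R"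
  have \<epsilon>: "0 < \<epsilon>" "\<epsilon> < \<epsilon>0" "\<epsilon> \<le> R" using \<epsilon>0 R by (auto simp: \<epsilon>_def)
  \<comment> \<open>The sign is \<open>\<i>\<close> to the power \<open>parity \<alpha>\<close>.\<close>
  define b where "b \<alpha> = (if even (parity \<alpha>) then (-1) ^ (parity \<alpha> div 2) * Re (a \<alpha>) else 0)" for \<alpha>
  have a: "a \<alpha> = of_real (Re (a \<alpha>))" for \<alpha> using re[of \<alpha>] by simp
  show ?thesis
  proof (rule that[of \<epsilon> b])
    show "majorised \<epsilon> b"
    proof -
      have "((\<lambda>\<alpha>. a \<alpha> * monomial (\<lambda>_. of_real \<epsilon>) \<alpha>) has_sum Q (\<lambda>_. of_real \<epsilon>)) UNIV"
        using \<epsilon> by (intro hs) (simp add: polydisc_def)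
      then have "(\<lambda>\<alpha>. norm (a \<alpha> * monomial (\<lambda>_. complex_of_real \<epsilon>) \<alpha>)) summable_on UNIV"
        by (rule has_sum_imp_summable[THEN summable_on_iff_abs_summable_on_complex[THEN iffD1]])
      moreover have "norm (a \<alpha> * monomial (\<lambda>_. complex_of_real \<epsilon>) \<alpha>) = norm (a \<alpha>) * \<epsilon> ^ deg \<alpha>" for \<alpha>
        using \<epsilon> by (simp add: norm_mult monomial_def deg_def power_sum norm_power prod_norm[symmetric])
      ultimately have s: "(\<lambda>\<alpha>. norm (a \<alpha>) * \<epsilon> ^ deg \<alpha>) summable_on UNIV" by simp
      have "(\<lambda>\<alpha>. norm (b \<alpha> * \<epsilon> ^ deg \<alpha>)) summable_on UNIV"
      proof (rule Infinite_Sum.abs_summable_on_comparison_test'[OF s])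
        fix \<alpha>
        have "\<bar>b \<alpha>\<bar> \<le> norm (a \<alpha>)" using abs_Re_le_cmod[of "a \<alpha>"] by (simp add: b_def abs_mult power_abs)
        then show "norm (b \<alpha> * \<epsilon> ^ deg \<alpha>) \<le> norm (a \<alpha>) * \<epsilon> ^ deg \<alpha>" using \<epsilon> by (simp add: abs_mult mult_right_mono)
      qed
      then show ?thesis using \<epsilon> by (simp add: majorised_def abs_mult)
    qed
    show "b \<alpha> = 0" if "deg \<alpha> < p + 2" for \<alpha> using van[OF that] by (simp add: b_def)
    show "b \<alpha> = 0" if "odd (parity \<alpha>)" for \<alpha> using that by (simp add: b_def)
    show "represents \<epsilon> b Q" unfolding represents_def
    proof (intro allI impI)
      fix z :: "jetvar \<Rightarrow> real" and V :: "jetvar \<Rightarrow> complex"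
      assume z': "\<forall>v. \<bar>z v\<bar> < \<epsilon>" and V': "\<forall>v. complex_of_real (z v) = unit v * V v"
      note z = z'[rule_format] and V = V'[rule_format]
      let ?z = "\<lambda>v. complex_of_real (z v)"
      let ?z' = "?z(Dx := - ?z Dx, Dy := - ?z Dy)"
      have zl: "norm (?z v) < \<epsilon>0" "norm (?z v) < R" "norm (?z' v) < \<epsilon>0" for v
        using z[of v] \<epsilon> by auto
      have h1: "((\<lambda>\<alpha>. a \<alpha> * monomial ?z \<alpha>) has_sum Q ?z) UNIV"
        by (rule hs) (use zl in \<open>simp add: polydisc_def\<close>)
      have "((\<lambda>\<alpha>. a \<alpha> * monomial ?z' \<alpha>) has_sum Q ?z') UNIV"
        by (rule hs) (use zl(3) in \<open>simp only: polydisc_def mem_Collect_eq diff_zero simp_thms\<close>)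
      also have "Q ?z' = Q ?z" by (rule sym) (use zl in \<open>simp add: polydisc_def\<close>)
      finally have h2: "((\<lambda>\<alpha>. a \<alpha> * ((-1) ^ parity \<alpha> * monomial ?z \<alpha>)) has_sum Q ?z) UNIV"
        by (simp only: monomial_reflect[of ?z])
      have "((\<lambda>\<alpha>. (1/2) * (a \<alpha> * monomial ?z \<alpha> + a \<alpha> * ((-1) ^ parity \<alpha> * monomial ?z \<alpha>))) has_sum (1/2) * (Q ?z + Q ?z)) UNIV"
        by (intro has_sum_cmult_right has_sum_add h1 h2)
      moreover have "(1/2) * (a \<alpha> * monomial ?z \<alpha> + a \<alpha> * ((-1) ^ parity \<alpha> * monomial ?z \<alpha>)) = of_real (b \<alpha>) * monomial V \<alpha>" for \<alpha>
      proof (cases "even (parity \<alpha>)")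
        case True
        then obtain l where l: "parity \<alpha> = 2 * l" by (elim evenE)
        have "\<i> ^ (2 * l) = (-1) ^ l" by (simp add: power_mult)
        then have "monomial ?z \<alpha> = (-1) ^ l * monomial V \<alpha>" using monomial_unit[of ?z V \<alpha>, OF V] by (simp add: l)
        then show ?thesis using a[of \<alpha>] by (simp add: b_def l mult_ac)
      qed (simp add: b_def)
      ultimately show "((\<lambda>\<alpha>. of_real (b \<alpha>) * monomial V \<alpha>) has_sum Q ?z) UNIV" by simp
    qed
  qed (use \<epsilon> in auto)
qed

lemma perturbation_of_profile:
  fixes p :: nat
  assumes r: "0 < r" "r < 1" and \<Phi>: "swapw \<Phi> = \<Phi>" and \<Phi>0: "\<And>i. coef \<Phi> (i, i) = 0"
    and \<epsilon>: "\<epsilon> \<le> R" "majorised \<epsilon> b" and small: "jet_const * norm \<Phi> < \<epsilon>"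
    and Q: "represents \<epsilon> b Q"
  defines "f \<equiv> profile r (multiplier dinv2 \<Phi>)"
    and "M \<equiv> (multiplier dinv2 \<Phi>) ^ p + (multiplier dinv2 \<Phi>) ^ (p + 1) + nlin b (jets \<Phi>)"
  shows "jet_in_polydisc R (pwave m n f e)"
    and "swapw M = M \<Longrightarrow> Q1 p Q (pwave m n f e) = pwave m n (profile r M) e"
    and "swapw M = M \<Longrightarrow> P1 p Q (pwave m n f e) = pwave m n (\<lambda>\<zeta>. m * re_fourier (dcoef \<theta> (\<lambda>k. mode r k M)) (\<theta> * \<zeta>)) e"
proof -
  have r': "0 \<le> r" "r \<le> 1" using r by auto
  have f: "f = F r \<Phi> 1" unfolding f_def by (rule F1[OF r \<Phi> \<Phi>0, symmetric])
  have J: "of_real (jet (pwave m n f e) (x, y) v) = unit v * val r (\<theta> * (m * x + n * y + e)) (jets \<Phi> v)" for x y v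
    unfolding f by (rule profile_jet[OF r \<Phi> \<Phi>0])
  have nj: "norm (jets \<Phi> v) < \<epsilon>" for v using norm_jets[of \<Phi> v] small by linarith
  have lt: "\<bar>jet (pwave m n f e) (x, y) v\<bar> < \<epsilon>" for x y v
  proof -
    have "\<bar>jet (pwave m n f e) (x, y) v\<bar> = norm (complex_of_real (jet (pwave m n f e) (x, y) v))" by simp
    also have "\<dots> \<le> norm (jets \<Phi> v)" unfolding J using norm_val[OF r'] by (simp add: norm_mult unit_def)
    finally show ?thesis using nj[of v] by linarith
  qed
  show "jet_in_polydisc R (pwave m n f e)" unfolding jet_in_polydisc_def
  proof (intro allI)
    fix z :: "real \<times> real" and v
    obtain x y where z: "z = (x, y)" by (cases z)
    show "\<bar>jet (pwave m n f e) z v\<bar> < R" using lt[of x y v] \<epsilon> by (simp add: z)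
  qed
  assume M: "swapw M = M"
  show Q1: "Q1 p Q (pwave m n f e) = pwave m n (profile r M) e"
  proof
    fix z :: "real \<times> real"
    obtain x y where z: "z = (x, y)" by (cases z)
    define s where "s = \<theta> * (m * x + n * y + e)"
    interpret V: bounded_linear "val r s" by (rule bounded_linear_val[OF r'])
    have w: "val r s (multiplier dinv2 \<Phi>) = of_real (pwave m n f e z)"
      using J[of x y D0] by (simp add: unit_def jets_D0 s_def z)
    have "((\<lambda>\<alpha>. of_real (b \<alpha>) * monomial (\<lambda>v. val r s (jets \<Phi> v)) \<alpha>) has_sum Q (\<lambda>v. of_real (jet (pwave m n f e) z v))) UNIV"
      by (rule Q[unfolded represents_def, rule_format]) (use lt J in \<open>simp_all add: z s_def\<close>)
    moreover have "((\<lambda>\<alpha>. of_real (b \<alpha>) * monomial (\<lambda>v. val r s (jets \<Phi> v)) \<alpha>) has_sum val r s (nlin b (jets \<Phi>))) UNIV"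
      by (rule has_sum_val_nlin[OF \<epsilon>(2) _ r']) (use nj less_imp_le in blast)
    ultimately have "Q (\<lambda>v. of_real (jet (pwave m n f e) z v)) = val r s (nlin b (jets \<Phi>))" by (rule has_sum_unique)
    then have "Q1 p Q (pwave m n f e) z = Re (val r s M)"
      unfolding Q1_def M_def V.add val_power[OF r'] w by (simp flip: of_real_power of_real_mult)
    then show "Q1 p Q (pwave m n f e) z = pwave m n (profile r M) e z"
      by (simp add: pwave_def z profile_def re_fourier_def val_fourier[OF r] s_def)
  qed
  have "((\<lambda>\<zeta>. profile r M \<zeta>) has_real_derivative re_fourier (dcoef \<theta> (\<lambda>k. mode r k M)) (\<theta> * \<zeta>)) (at \<zeta>)" for \<zeta>
    unfolding profile_def by (rule re_fourier_derivative[OF decays_mode[OF r]])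
  then show "P1 p Q (pwave m n f e) = pwave m n (\<lambda>\<zeta>. m * re_fourier (dcoef \<theta> (\<lambda>k. mode r k M)) (\<theta> * \<zeta>)) e"
    unfolding P1_def Q1 by (rule dx_pwave(1))
qed

end

section \<open>Perturbed waves and their distance to the one-gap family\<close>

lemma half_power_split:
  fixes x :: real
  assumes "0 \<le> x" "x \<le> 1/2"
  shows "x ^ max p n \<le> x ^ p * 2 ^ p * (1/2) ^ n"
proof (cases "n \<le> p")
  case True
  then have "(2::real) ^ n \<le> 2 ^ p" by (intro power_increasing) auto
  then have "1 \<le> 2 ^ p * (1/2::real) ^ n" by (simp add: power_divide)
  then show ?thesis using True assms mult_left_mono[of 1 "2 ^ p * (1/2) ^ n" "x ^ p"] by (simp add: max_def mult.assoc)
next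
  case False
  then obtain l where n: "n = p + l" using le_Suc_ex nat_le_linear by blast
  have "x ^ l \<le> (1/2) ^ l" using assms by (intro power_mono) auto
  then have "x ^ p * x ^ l \<le> x ^ p * (1/2) ^ l" using assms by (intro mult_left_mono) auto
  also have "(1/2::real) ^ l = 2 ^ p * (1/2) ^ n" by (simp add: n power_add power_divide)
  finally show ?thesis by (simp add: n power_add mult.assoc max_def)
qed

lemma mode_diff: "0 \<le> r \<Longrightarrow> r \<le> 1 \<Longrightarrow> mode r k (X - Y) = mode r k X - mode r k Y"
  by (rule linear_diff[OF bounded_linear.linear[OF bounded_linear_mode]])

context wave
begin

lemma perturbed_family:
  assumes p: "p \<ge> 3" and \<epsilon>: "0 < \<epsilon>" and maj: "majorised \<epsilon> c" and van: "\<And>\<alpha>. deg \<alpha> < p \<Longrightarrow> c \<alpha> = 0"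
    and par: "\<And>\<alpha>. odd (parity \<alpha>) \<Longrightarrow> c \<alpha> = 0"
  obtains \<rho> H \<kappa> where "0 < \<rho>" "\<rho> \<le> 1/16" "jet_const * norm (cn_primary \<rho> + H) < \<epsilon>" "swapw H = H" "multiplier outer H = H" "diag \<kappa>"
    "diag (\<kappa> * multiplier dinv2 (cn_primary \<rho> + H) + \<mu> *\<^sub>R (multiplier dinv2 (cn_primary \<rho> + H) - (cn_primary \<rho> + H))
       + m *\<^sub>R ((1/2) *\<^sub>R (multiplier dinv2 (cn_primary \<rho> + H))\<^sup>2 + nlin c (jets (cn_primary \<rho> + H))))"
    "swapw (nlin c (jets (cn_primary \<rho> + H))) = nlin c (jets (cn_primary \<rho> + H))"
    "ord_ge p (H - cn_outer \<rho>)" "ord_ge (p - 1) (\<kappa> - speed_shift kdv (cn_divisor \<rho>) (cn_primary \<rho>) (cn_outer \<rho>))"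
proof -
  define b where "b = (\<lambda>\<alpha>. kdv \<alpha> + c \<alpha>)"
  have mb: "majorised \<epsilon> b" unfolding b_def by (rule majorised_add[OF majorised_kdv[OF \<epsilon>] maj])
  have b2: "b \<alpha> = 0" if "deg \<alpha> < 2" for \<alpha> using that p by (simp add: b_def kdv_deg van)
  have bp: "b \<alpha> = 0" if "odd (parity \<alpha>)" for \<alpha> using that by (simp add: b_def kdv_parity par)
  define K1 where "K1 = 8 * amp + 16 / amp"
  have K1: "K1 > 0" using amp by (simp add: K1_def add_pos_pos)
  obtain \<rho>1 where \<rho>1: "\<rho>1 > 0" and ex:
    "\<And>\<rho> W B1. 0 < \<rho> \<Longrightarrow> \<rho> \<le> \<rho>1 \<Longrightarrow> norm B1 \<le> K1 * \<rho> \<Longrightarrow> norm W \<le> K1 / \<rho> \<Longrightarrow> diag W \<Longrightarrow> swapw B1 = B1 \<Longrightarrow>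
       \<exists>H. norm H \<le> \<rho> \<and> swapw H = H \<and> multiplier outer H = H \<and> wave_map b W B1 H = H"
    using fixed_point_exists[OF mb b2 bp K1] by metis
  \<comment> \<open>The three constraints come from the convergence of the one-gap series, from the contraction, and
    from the requirement that the jets stay within the domain of the perturbation.\<close>
  define \<rho> where "\<rho> = min (min (1/16) \<rho>1) (\<epsilon> / (2 * (jet_const * (K1 + 1))))"
  have KK: "jet_const * (K1 + 1) > 0" using jet_const K1 by simp
  have \<rho>: "0 < \<rho>" "\<rho> \<le> 1/16" "\<rho> \<le> \<rho>1" "\<rho> \<le> \<epsilon> / (2 * (jet_const * (K1 + 1)))"
  proof -
    show "0 < \<rho>" using \<rho>1 \<epsilon> KK by (simp add: \<rho>_def)
    show "\<rho> \<le> 1/16" "\<rho> \<le> \<rho>1" "\<rho> \<le> \<epsilon> / (2 * (jet_const * (K1 + 1)))"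
      unfolding \<rho>_def by (simp_all only: min.cobounded2 min.coboundedI1 min.cobounded1)
  qed
  have nB: "norm (cn_primary \<rho>) \<le> K1 * \<rho>"
    using norm_cn_primary[OF \<rho>(1,2)] amp \<rho> by (simp add: K1_def algebra_simps) (smt (verit) divide_nonneg_pos mult_nonneg_nonneg)
  have nW: "norm (cn_divisor \<rho>) \<le> K1 / \<rho>"
  proof -
    have "16 / (amp * \<rho>) \<le> K1 / \<rho>" using amp \<rho> by (simp add: K1_def field_simps)
    then show ?thesis using norm_cn_divisor[OF \<rho>(1,2)] by linarith
  qed
  obtain H where H: "norm H \<le> \<rho>" "swapw H = H" "multiplier outer H = H" and fpH: "wave_map b (cn_divisor \<rho>) (cn_primary \<rho>) H = H"
    using ex[OF \<rho>(1,3) nB nW diag_cn_divisor[OF \<rho>(1,2)] swapw_cn_primary[OF \<rho>(1,2)]] by blast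
  let ?\<Phi> = "cn_primary \<rho> + H"
  have small: "jet_const * norm ?\<Phi> < \<epsilon>"
  proof -
    have "norm ?\<Phi> \<le> (K1 + 1) * \<rho>" using norm_triangle_ineq[of "cn_primary \<rho>" H] nB H(1) by (simp add: algebra_simps)
    then have "jet_const * norm ?\<Phi> \<le> jet_const * ((K1 + 1) * \<rho>)" using jet_const by (intro mult_left_mono) auto
    also have "\<dots> = jet_const * (K1 + 1) * \<rho>" by simp
    also have "\<dots> \<le> \<epsilon> / 2" using \<rho>(4) KK by (simp add: field_simps)
    finally show ?thesis using \<epsilon> by linarith
  qed
  have nj: "norm (jets ?\<Phi> v) \<le> \<epsilon>" for v using norm_jets[of ?\<Phi> v] small by linarith
  have N: "nlin b (jets ?\<Phi>) = (1/2) *\<^sub>R (multiplier dinv2 ?\<Phi>)\<^sup>2 + nlin c (jets ?\<Phi>)"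
    unfolding b_def nlin_add[OF majorised_kdv[OF \<epsilon>] maj nj] nlin_kdv jets_D0 ..
  have s\<Phi>: "swapw ?\<Phi> = ?\<Phi>" by (simp add: linear_swapw swapw_cn_primary[OF \<rho>(1,2)] H)
  have sN: "swapw (nlin b (jets ?\<Phi>)) = nlin b (jets ?\<Phi>)" by (rule swapw_nlin[OF swapw_jets[OF s\<Phi>] bp mb nj])
  have sc: "swapw (nlin c (jets ?\<Phi>)) = nlin c (jets ?\<Phi>)" by (rule swapw_nlin[OF swapw_jets[OF s\<Phi>] par maj nj])
  have ordc: "ord_ge p (nlin b (jets \<Phi>) - nlin kdv (jets \<Phi>))" if "ord_ge 1 \<Phi>" "\<Phi> = ?\<Phi>" for \<Phi>
  proof -
    have "nlin b (jets \<Phi>) - nlin kdv (jets \<Phi>) = nlin c (jets \<Phi>)" unfolding that N by (simp add: nlin_kdv jets_D0)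
    moreover have "ord_ge p (nlin c (jets \<Phi>))"
      by (rule ord_ge_nlin[OF van ord_ge_jets[OF that(1)] maj]) (use nj that in auto)
    ultimately show ?thesis by simp
  qed
  note cmp = comparison[OF ordc nlin_kdv p fpH cn_fixed_point[OF \<rho>(1,2)] primary_cn_primary[OF \<rho>(1,2)]]
  show ?thesis
  proof (rule that[OF \<rho>(1,2) small H(2,3) diag_speed_shift[OF diag_cn_divisor[OF \<rho>(1,2)]] _ sc cmp])
    show "diag (speed_shift b (cn_divisor \<rho>) (cn_primary \<rho>) H * multiplier dinv2 ?\<Phi> + \<mu> *\<^sub>R (multiplier dinv2 ?\<Phi> - ?\<Phi>)
       + m *\<^sub>R ((1/2) *\<^sub>R (multiplier dinv2 ?\<Phi>)\<^sup>2 + nlin c (jets ?\<Phi>)))"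
      using full_equation[OF fpH diag_cn_divisor[OF \<rho>(1,2)] primary_cn_primary[OF \<rho>(1,2)] swapw_cn_primary[OF \<rho>(1,2)] H(2) cn_divisor_tau[OF \<rho>(1,2)] sN]
      unfolding N .
  qed
qed

lemma cn_equation:
  assumes \<rho>: "0 < \<rho>" "\<rho> \<le> 1/16"
  shows "diag (speed_shift kdv (cn_divisor \<rho>) (cn_primary \<rho>) (cn_outer \<rho>) * multiplier dinv2 (cn \<rho>) + \<mu> *\<^sub>R (multiplier dinv2 (cn \<rho>) - cn \<rho>)
       + m *\<^sub>R ((1/2) *\<^sub>R (multiplier dinv2 (cn \<rho>))\<^sup>2 + 0))"
proof -
  have "swapw (nlin kdv (jets (cn \<rho>))) = nlin kdv (jets (cn \<rho>))"
  proof (rule swapw_nlin[OF swapw_jets[OF swapw_cn[OF \<rho>]] kdv_parity majorised_kdv])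
    show "norm (jets (cn \<rho>) v) \<le> jet_const * norm (cn \<rho>) + 1" for v using norm_jets[of "cn \<rho>" v] by simp
    show "jet_const * norm (cn \<rho>) + 1 > 0" using jet_const by (simp add: add_nonneg_pos)
  qed
  then show ?thesis
    using full_equation[OF cn_fixed_point[OF \<rho>] diag_cn_divisor[OF \<rho>] primary_cn_primary[OF \<rho>] swapw_cn_primary[OF \<rho>] swapw_cn_outer[OF \<rho>] cn_divisor_tau[OF \<rho>]]
    by (simp add: cn_primary_plus_outer[OF \<rho>] nlin_kdv jets_D0)
qed

lemma coef_cn_diag: "0 < \<rho> \<Longrightarrow> \<rho> \<le> 1/16 \<Longrightarrow> coef (cn \<rho>) (i, i) = 0"
  by (simp add: coef_cn cn_coef_def)

lemma coef_outer_diag: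
  assumes "multiplier outer H = H" shows "coef H (i, i) = 0"
proof -
  have "coef (multiplier outer H) (i, i) = 0" by (simp add: coef_outer outer_def)
  then show ?thesis by (simp only: assms)
qed

lemma mode_estimate:
  assumes r: "0 < r" "r \<le> \<rho> / 2" and \<rho>: "0 < \<rho>" and X: "ord_ge p X"
  shows "(norm (mode (r / \<rho>) k X))\<^sup>2 * 2 ^ nat \<bar>k\<bar> \<le> (norm X * 2 ^ p / \<rho> ^ p)\<^sup>2 * r ^ (2 * p) * (1/2) ^ nat \<bar>k\<bar>"
proof -
  let ?x = "r / \<rho>"
  have x: "0 \<le> ?x" "?x \<le> 1/2" "?x \<le> 1" using r \<rho> by (auto simp: field_simps)
  have "norm (mode ?x k X) \<le> ?x ^ max p (nat \<bar>k\<bar>) * norm X" by (rule norm_mode_le[OF x(1,3) X])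
  also have "\<dots> \<le> (?x ^ p * 2 ^ p * (1/2) ^ nat \<bar>k\<bar>) * norm X" by (intro mult_right_mono half_power_split x) auto
  also have "\<dots> = (norm X * 2 ^ p / \<rho> ^ p) * r ^ p * (1/2) ^ nat \<bar>k\<bar>" by (simp add: power_divide)
  finally have "(norm (mode ?x k X))\<^sup>2 \<le> ((norm X * 2 ^ p / \<rho> ^ p) * r ^ p * (1/2) ^ nat \<bar>k\<bar>)\<^sup>2" by (intro power_mono) auto
  also have "\<dots> = (norm X * 2 ^ p / \<rho> ^ p)\<^sup>2 * r ^ (2 * p) * ((1/2) ^ nat \<bar>k\<bar> * (1/2) ^ nat \<bar>k\<bar>)"
  proof -
    have "r ^ (2 * p) = (r ^ p)\<^sup>2" by (metis mult.commute power_mult)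
    then show ?thesis by (simp only: power_mult_distrib power2_eq_square[of "(1/2) ^ _"])
  qed
  finally have "(norm (mode ?x k X))\<^sup>2 * 2 ^ nat \<bar>k\<bar> \<le> (norm X * 2 ^ p / \<rho> ^ p)\<^sup>2 * r ^ (2 * p) * ((1/2) ^ nat \<bar>k\<bar> * (1/2) ^ nat \<bar>k\<bar>) * 2 ^ nat \<bar>k\<bar>"
    by (intro mult_right_mono) auto
  also have "\<dots> = (norm X * 2 ^ p / \<rho> ^ p)\<^sup>2 * r ^ (2 * p) * (1/2) ^ nat \<bar>k\<bar> * ((1/2) ^ nat \<bar>k\<bar> * 2 ^ nat \<bar>k\<bar>)"
    by (simp only: mult_ac)
  also have "((1/2::real) ^ nat \<bar>k\<bar> * 2 ^ nat \<bar>k\<bar>) = 1" by (simp flip: power_mult_distrib)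
  finally show ?thesis by simp
qed

lemma weighted_sum_estimate:
  fixes X :: wiener
  assumes r: "0 < r" "r \<le> \<rho> / 2" and \<rho>: "0 < \<rho>" and X: "ord_ge p X" and \<gamma>: "\<gamma> > 0"
  defines "w \<equiv> \<lambda>k::int. (norm (mode (r / \<rho>) k X))\<^sup>2 * exp (4 * pi * (\<gamma> * ln 2 / (4 * pi)) / \<gamma> * of_int \<bar>k\<bar>)"
  shows "w summable_on S"
    and "(\<Sum>\<^sub>\<infinity>k\<in>S. w k) \<le> ((norm X * 2 ^ p / \<rho> ^ p)\<^sup>2 * (\<Sum>\<^sub>\<infinity>k::int. (1/2) ^ nat \<bar>k\<bar>)) * \<bar>r\<bar> ^ (2 * p)"
proof -
  let ?D = "(norm X * 2 ^ p / \<rho> ^ p)\<^sup>2 * r ^ (2 * p)"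
  have ex: "exp (4 * pi * (\<gamma> * ln 2 / (4 * pi)) / \<gamma> * real_of_int \<bar>k\<bar>) = 2 ^ nat \<bar>k\<bar>" for k
  proof -
    have "4 * pi * (\<gamma> * ln 2 / (4 * pi)) / \<gamma> * real_of_int \<bar>k\<bar> = of_nat (nat \<bar>k\<bar>) * ln 2" using \<gamma> by simp
    then show ?thesis by (simp only: exp_of_nat_mult) simp
  qed
  have le: "w k \<le> ?D * (1/2) ^ nat \<bar>k\<bar>" for k
    unfolding w_def ex by (rule mode_estimate[OF r \<rho> X])
  have w0: "0 \<le> w k" for k by (simp add: w_def)
  have g: "(\<lambda>k::int. ?D * (1/2) ^ nat \<bar>k\<bar>) summable_on UNIV"
    by (intro summable_on_cmult_right int_geometric_summable) auto
  have "(\<lambda>k. norm (w k)) summable_on UNIV"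
    by (rule Infinite_Sum.abs_summable_on_comparison_test'[OF g]) (use le w0 in auto)
  then have sU: "w summable_on UNIV" using w0 by simp
  then show sS: "w summable_on S" by (rule summable_on_subset_banach) auto
  have "(\<Sum>\<^sub>\<infinity>k\<in>S. w k) \<le> (\<Sum>\<^sub>\<infinity>k. w k)" by (rule infsum_mono2[OF sS sU]) (use w0 in auto)
  also have "\<dots> \<le> (\<Sum>\<^sub>\<infinity>k::int. ?D * (1/2) ^ nat \<bar>k\<bar>)" by (rule infsum_mono[OF sU g le])
  also have "\<dots> = ?D * (\<Sum>\<^sub>\<infinity>k::int. (1/2) ^ nat \<bar>k\<bar>)" by (rule infsum_cmult_right')
  finally show "(\<Sum>\<^sub>\<infinity>k\<in>S. w k) \<le> ((norm X * 2 ^ p / \<rho> ^ p)\<^sup>2 * (\<Sum>\<^sub>\<infinity>k::int. (1/2) ^ nat \<bar>k\<bar>)) * \<bar>r\<bar> ^ (2 * p)"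
    using r by (simp add: mult_ac)
qed

text \<open>The monomials \<open>(ab)\<^sup>n\<close> have even degree.\<close>
lemma ord_ge_diag_even:
  assumes "diag K" "ord_ge (p - 1) K" "even p" "p \<ge> 1"
  shows "ord_ge p K"
  unfolding ord_ge_def
proof (intro allI impI)
  fix i j :: nat assume lt: "i + j < p"
  show "coef K (i, j) = 0"
  proof (cases "i = j")
    case True
    with lt assms(3,4) have "i + j < p - 1" by presburger
    then show ?thesis using assms(2) by (simp add: ord_ge_def)
  qed (use assms(1) in \<open>simp add: diag_def\<close>)
qed

end

theorem theorem1p2:
  fixes \<gamma> R1 :: real and p :: nat and m0 n0 :: int
    and Q :: "(jetvar \<Rightarrow> complex) \<Rightarrow> complex"
  assumes "\<gamma> > 0" and "p \<ge> 3" and "m0 \<noteq> 0"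
    and "admissible_perturbation \<gamma> p R1 Q"
  shows "\<exists>\<rho>>0. \<exists>(q :: nat \<Rightarrow> real \<Rightarrow> real) (\<omega>0 :: nat \<Rightarrow> real \<Rightarrow> real)
            (u0 :: nat \<Rightarrow> real \<Rightarrow> real \<Rightarrow> real).
    (\<forall>\<iota>\<in>{1, 2}.
       real_analytic_on (q \<iota>) {0<..<\<rho>} \<and>
       real_analytic_on (\<omega>0 \<iota>) {0<..<\<rho>} \<and>
       (\<exists>C. \<forall>r\<in>{0<..<\<rho>}. \<bar>q \<iota> r - r\<bar> \<le> C * \<bar>r\<bar> ^ 3) \<and>
       (\<forall>r\<in>{0<..<\<rho>}.
          has_fourier_series \<gamma> (u0 \<iota> r) (\<lambda>k. of_real (one_gap_coeff \<gamma> m0 (q \<iota> r) k)) \<and>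
          (\<forall>d. one_gap_solution \<gamma> (kp_sign \<iota>)
                 (travelling_wave (u0 \<iota> r) (\<omega>0 \<iota> r) m0 n0 d)))) \<and>
    (\<exists>\<rho>0\<in>{0<..<\<rho>}. \<forall>\<rho>'\<in>{0<..\<rho>0}.
       \<exists>(\<omega> :: nat \<Rightarrow> real \<Rightarrow> real) (u :: nat \<Rightarrow> real \<Rightarrow> real \<Rightarrow> real)
         (uhat :: nat \<Rightarrow> real \<Rightarrow> int \<Rightarrow> complex). \<forall>\<iota>\<in>{1, 2}.
         real_analytic_on (\<omega> \<iota>) {0<..<\<rho>'} \<and>
         (\<forall>r\<in>{0<..<\<rho>'}.
            has_fourier_series \<gamma> (u \<iota> r) (uhat \<iota> r) \<and>
            (\<forall>d. perturbed_kp_solution \<gamma> (kp_sign \<iota>) p R1 Q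
                   (travelling_wave (u \<iota> r) (\<omega> \<iota> r) m0 n0 d))) \<and>
         (\<exists>\<sigma>>0. \<exists>C. \<forall>r\<in>{0<..<\<rho>'}.
            (\<lambda>k. (norm (uhat \<iota> r k - of_real (one_gap_coeff \<gamma> m0 (q \<iota> r) k)))\<^sup>2
                  * exp (4 * pi * \<sigma> / \<gamma> * of_int \<bar>k\<bar>)) summable_on {k. k \<noteq> 0 \<and> \<bar>k\<bar> \<noteq> 1} \<and>
            (\<Sum>\<^sub>\<infinity>k\<in>{k. k \<noteq> 0 \<and> \<bar>k\<bar> \<noteq> 1}.
               (norm (uhat \<iota> r k - of_real (one_gap_coeff \<gamma> m0 (q \<iota> r) k)))\<^sup>2
                  * exp (4 * pi * \<sigma> / \<gamma> * of_int \<bar>k\<bar>)) \<le> C * \<bar>r\<bar> ^ (2 * p)) \<and>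
         (\<forall>r\<in>{0<..<\<rho>'}.
            uhat \<iota> r 1 = of_real (one_gap_coeff \<gamma> m0 (q \<iota> r) 1) \<and>
            uhat \<iota> r (-1) = of_real (one_gap_coeff \<gamma> m0 (q \<iota> r) (-1))) \<and>
         (\<exists>C. \<forall>r\<in>{0<..<\<rho>'}.
            \<bar>\<omega> \<iota> r - \<omega>0 \<iota> r\<bar> \<le> C * \<bar>r\<bar> ^ (if odd p then p - 1 else p)))"
proof -
  define \<theta> where "\<theta> = 2 * pi / \<gamma>"
  define m where "m = real_of_int m0"
  define n where "n = real_of_int n0"
  interpret wave \<theta> m n
    by standard (use \<open>\<gamma> > 0\<close> \<open>m0 \<noteq> 0\<close> in \<open>simp_all add: \<theta>_def m_def\<close>)
  obtain \<epsilon> b where \<epsilon>: "0 < \<epsilon>" "\<epsilon> \<le> R1" and mb: "majorised \<epsilon> b" and van: "\<And>\<alpha>. deg \<alpha> < p + 2 \<Longrightarrow> b \<alpha> = 0" and par: "\<And>\<alpha>. odd (parity \<alpha>) \<Longrightarrow> b \<alpha> = 0"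
    and Q: "represents \<epsilon> b Q"
    by (rule admissible_coefficients[OF assms(4)]) (rule that, assumption+)
  define c1 where "c1 = (\<lambda>\<alpha>. single p 1 \<alpha> + single (p + 1) 1 \<alpha>)"
  define c where "c = (\<lambda>\<alpha>. c1 \<alpha> + b \<alpha>)"
  have m1: "majorised \<epsilon> c1" unfolding c1_def by (intro majorised_add majorised_single \<epsilon>)
  have mc: "majorised \<epsilon> c" unfolding c_def by (rule majorised_add[OF m1 mb])
  have vc: "c \<alpha> = 0" if "deg \<alpha> < p" for \<alpha> using that van[of \<alpha>] by (auto simp: c_def c1_def single_def)
  have pc: "c \<alpha> = 0" if "odd (parity \<alpha>)" for \<alpha> using that par[of \<alpha>] by (auto simp: c_def c1_def single_def)
  obtain \<rho> H \<kappa> where \<rho>: "0 < \<rho>" "\<rho> \<le> 1/16" and small: "jet_const * norm (cn_primary \<rho> + H) < \<epsilon>" and sH: "swapw H = H" and oH: "multiplier outer H = H"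
    and d\<kappa>: "diag \<kappa>"
    and eqn: "diag (\<kappa> * multiplier dinv2 (cn_primary \<rho> + H) + \<mu> *\<^sub>R (multiplier dinv2 (cn_primary \<rho> + H) - (cn_primary \<rho> + H))
       + m *\<^sub>R ((1/2) *\<^sub>R (multiplier dinv2 (cn_primary \<rho> + H))\<^sup>2 + nlin c (jets (cn_primary \<rho> + H))))"
    and sN: "swapw (nlin c (jets (cn_primary \<rho> + H))) = nlin c (jets (cn_primary \<rho> + H))"
    and ordH: "ord_ge p (H - cn_outer \<rho>)" and ord\<kappa>: "ord_ge (p - 1) (\<kappa> - speed_shift kdv (cn_divisor \<rho>) (cn_primary \<rho>) (cn_outer \<rho>))"
    by (rule perturbed_family[OF assms(2) \<epsilon>(1) mc]) (erule vc, erule pc, rule that)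
  \<comment> \<open>Both families are evaluated at \<open>r / \<rho>\<close>, as the algebra is built on the rescaled variables.\<close>
  define \<Phi> where "\<Phi> = cn_primary \<rho> + H"
  define \<kappa>0 where "\<kappa>0 = speed_shift kdv (cn_divisor \<rho>) (cn_primary \<rho>) (cn_outer \<rho>)"
  define lam where "lam \<iota> = kp_sign \<iota> * n\<^sup>2 / m" for \<iota>
  define \<omega>0 where "\<omega>0 \<iota> r = \<mu> + lam \<iota> + Re (mode (r / \<rho>) 0 \<kappa>0)" for \<iota> :: nat and r
  define \<omega> where "\<omega> \<iota> r = \<mu> + lam \<iota> + Re (mode (r / \<rho>) 0 \<kappa>)" for \<iota> :: nat and r
  define u0 where "u0 r = profile (r / \<rho>) (multiplier dinv2 (cn \<rho>))" for r
  define u where "u r = profile (r / \<rho>) (multiplier dinv2 \<Phi>)" for r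
  define uhat where "uhat r k = mode (r / \<rho>) k (multiplier dinv2 \<Phi>)" for r k
  have sB: "swapw (cn_primary \<rho>) = cn_primary \<rho>" by (rule swapw_cn_primary[OF \<rho>])
  have s\<Phi>: "swapw \<Phi> = \<Phi>" by (simp add: \<Phi>_def linear_swapw sB sH)
  have \<Phi>0: "coef \<Phi> (i, i) = 0" for i
    using coef_outer_diag[OF oH] by (simp add: \<Phi>_def coef_cn_primary[OF \<rho>])
  have d\<kappa>0: "diag \<kappa>0" unfolding \<kappa>0_def by (rule diag_speed_shift[OF diag_cn_divisor[OF \<rho>]])
  have cnm: "mode (r / \<rho>) k (multiplier dinv2 (cn \<rho>)) = of_real (one_gap_coeff \<gamma> m0 r k)" if r: "r \<in> {0<..<\<rho>}" for r k
  proof -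
    have "\<rho> * (r / \<rho>) = r" using \<rho> by simp
    moreover have "amp = 48 * (of_int m0)\<^sup>2 * pi\<^sup>2 / \<gamma>\<^sup>2" unfolding amp_def by (simp add: \<theta>_def m_def power_divide power_mult_distrib)
    ultimately show ?thesis using mode_cn_profile[OF \<rho>, of "r / \<rho>" k] r
      by (simp only: one_gap_coeff_def lambert_def) (simp add: mult_ac)
  qed
  have diffX: "uhat r k - of_real (one_gap_coeff \<gamma> m0 r k) = mode (r / \<rho>) k (multiplier dinv2 (H - cn_outer \<rho>))" if r: "r \<in> {0<..<\<rho>}" for r k
  proof -
    have "multiplier dinv2 \<Phi> - multiplier dinv2 (cn \<rho>) = multiplier dinv2 (H - cn_outer \<rho>)"
      unfolding \<Phi>_def cn_primary_plus_outer[OF \<rho>, symmetric] by (simp add: linear_multiplier[OF dinv2_le])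
    moreover have "mode (r / \<rho>) k (multiplier dinv2 \<Phi> - multiplier dinv2 (cn \<rho>)) = mode (r / \<rho>) k (multiplier dinv2 \<Phi>) - mode (r / \<rho>) k (multiplier dinv2 (cn \<rho>))"
      by (rule mode_diff) (use r in auto)
    ultimately show ?thesis by (simp add: uhat_def cnm[OF r])
  qed
  have ordX: "ord_ge p (multiplier dinv2 (H - cn_outer \<rho>))" by (rule ord_ge_multiplier[OF dinv2_le ordH])
  have cn_sym: "swapw (cn \<rho>) = cn \<rho>" "\<And>i. coef (cn \<rho>) (i, i) = 0"
    using swapw_cn[OF \<rho>] coef_cn_diag[OF \<rho>] by auto
  have sub: "r \<in> {0<..<\<rho>}" "0 < r" "r \<le> \<rho> / 2" if "r \<in> {0<..<\<rho>'}" "\<rho>' \<in> {0<..\<rho> / 2}" for r \<rho>'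
    using that \<rho> by auto
  have scaled: "0 < r / \<rho>" "r / \<rho> < 1" "0 \<le> r / \<rho>" "r / \<rho> \<le> 1" if "r \<in> {0<..<\<rho>}" for r
    using that by auto

  have fourier0: "has_fourier_series \<gamma> (u0 r) (\<lambda>k. of_real (one_gap_coeff \<gamma> m0 r k))" if r: "r \<in> {0<..<\<rho>}" for r
    using profile_fourier[OF scaled(1,2)[OF r] cn_sym \<open>\<gamma> > 0\<close> \<theta>_def] unfolding u0_def cnm[OF r] .

  have one_gap: "one_gap_solution \<gamma> (kp_sign \<iota>) (travelling_wave (u0 r) (\<omega>0 \<iota> r) m0 n0 d)"
    if r: "r \<in> {0<..<\<rho>}" for r \<iota> d
    unfolding one_gap_solution_def
  proof
    have z0: "swapw 0 = 0" by (rule wiener_eqI) simp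
    have m0: "mode (r / \<rho>) k 0 = 0" for k by (simp add: mode_def pair_def)
    have "kp_solution \<gamma> (kp_sign \<iota>) (\<lambda>_ _. 0)
        (travelling_wave (profile (r / \<rho>) (multiplier dinv2 (cn \<rho>))) (\<mu> + kp_sign \<iota> * n\<^sup>2 / m + Re (mode (r / \<rho>) 0 \<kappa>0)) m0 n0 d)"
      by (rule wave_solution[OF scaled(1,2)[OF r] cn_sym m_def n_def \<open>\<gamma> > 0\<close> \<theta>_def _ d\<kappa>0 z0])
         (use cn_equation[OF \<rho>] in \<open>simp_all add: \<kappa>0_def m0 dcoef_def re_fourier_def fourier_def pwave_def case_prod_unfold\<close>)
    then show "kp_solution \<gamma> (kp_sign \<iota>) (\<lambda>_ _. 0) (travelling_wave (u0 r) (\<omega>0 \<iota> r) m0 n0 d)"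
      by (simp only: u0_def \<omega>0_def lam_def)
    have "u0 r = (\<lambda>\<zeta>. re_fourier (\<lambda>k. of_real (one_gap_coeff \<gamma> m0 r k)) (2 * pi / \<gamma> * \<zeta>))"
      unfolding u0_def profile_def[abs_def] cnm[OF r] by (simp only: \<theta>_def)
    then show "\<exists>\<tau> U V W D. Im \<tau> > 0 \<and> U \<noteq> 0 \<and>
      (\<forall>s::real. theta (of_real s) \<tau> \<in> \<real> \<and> Re (theta (of_real s) \<tau>) > 0) \<and>
      (\<forall>t z. travelling_wave (u0 r) (\<omega>0 \<iota> r) m0 n0 d t z =
         12 * dx (dx (\<lambda>(x, y). ln (Re (theta (of_real (U * x + V * y + W * t + D)) \<tau>)))) z)"
      using one_gap_representation[of r \<gamma> m0 "\<omega>0 \<iota> r" n0 d] r \<rho> \<open>\<gamma> > 0\<close> \<open>m0 \<noteq> 0\<close> by simp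
  qed

  have fourier: "has_fourier_series \<gamma> (u r) (uhat r)" if r: "r \<in> {0<..<\<rho>}" for r
    using profile_fourier[OF scaled(1,2)[OF r] s\<Phi> \<Phi>0 \<open>\<gamma> > 0\<close> \<theta>_def] unfolding u_def uhat_def .

  have perturbed: "perturbed_kp_solution \<gamma> (kp_sign \<iota>) p R1 Q (travelling_wave (u r) (\<omega> \<iota> r) m0 n0 d)"
    if r: "r \<in> {0<..<\<rho>}" for r \<iota> d
  proof -
    note r1 = scaled(1,2)[OF r]
    have nj: "norm (jets \<Phi> v) \<le> \<epsilon>" for v using norm_jets[of \<Phi> v] small by (simp add: \<Phi>_def)
    have N: "nlin c (jets \<Phi>) = (multiplier dinv2 \<Phi>) ^ p + (multiplier dinv2 \<Phi>) ^ (p + 1) + nlin b (jets \<Phi>)"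
      unfolding c_def nlin_add[OF m1 mb nj] unfolding c1_def nlin_add[OF majorised_single[OF \<epsilon>(1)] majorised_single[OF \<epsilon>(1)] nj] nlin_single jets_D0
      by simp
    note jet_bound = perturbation_of_profile(1)[OF r1 s\<Phi> \<Phi>0 \<epsilon>(2) mb small[folded \<Phi>_def] Q]
    note pert = perturbation_of_profile(3)[where p = p, OF r1 s\<Phi> \<Phi>0 \<epsilon>(2) mb small[folded \<Phi>_def] Q, folded N]
    have sN': "swapw (nlin c (jets \<Phi>)) = nlin c (jets \<Phi>)" using sN by (simp add: \<Phi>_def)
    have eq': "diag (\<kappa> * multiplier dinv2 \<Phi> + \<mu> *\<^sub>R (multiplier dinv2 \<Phi> - \<Phi>) + m *\<^sub>R ((1/2) *\<^sub>R (multiplier dinv2 \<Phi>)\<^sup>2 + nlin c (jets \<Phi>)))"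
      using eqn by (simp only: \<Phi>_def)
    have "kp_solution \<gamma> (kp_sign \<iota>) (P1 p Q) (travelling_wave (profile (r / \<rho>) (multiplier dinv2 \<Phi>)) (\<mu> + kp_sign \<iota> * n\<^sup>2 / m + Re (mode (r / \<rho>) 0 \<kappa>)) m0 n0 d)"
      by (rule wave_solution[OF r1 s\<Phi> \<Phi>0 m_def n_def \<open>\<gamma> > 0\<close> \<theta>_def eq' d\<kappa> sN'])
         (simp only: pert[OF sN'])
    moreover have "jet_in_polydisc R1 (travelling_wave (u r) (\<omega> \<iota> r) m0 n0 d t)" for t
      unfolding travelling_wave_pwave u_def m_def[symmetric] n_def[symmetric] by (rule jet_bound)
    ultimately show ?thesis
      unfolding perturbed_kp_solution_def by (simp add: u_def \<omega>_def lam_def)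
  qed

  have pinned: "uhat r k = of_real (one_gap_coeff \<gamma> m0 r k)" if r: "r \<in> {0<..<\<rho>}" and k: "\<bar>k\<bar> = 1" for r k
  proof -
    have "multiplier outer (H - cn_outer \<rho>) = H - cn_outer \<rho>" by (simp add: linear_multiplier[OF outer_le] oH outer_cn_outer[OF \<rho>])
    then have "mode (r / \<rho>) k (multiplier dinv2 (H - cn_outer \<rho>)) = of_real (dinv2 k) * (of_real (outer k) * mode (r / \<rho>) k (H - cn_outer \<rho>))"
      using mode_multiplier[OF outer_le scaled(3,4)[OF r], of k "H - cn_outer \<rho>"] by (simp add: mode_multiplier[OF dinv2_le scaled(3,4)[OF r]])
    also have "\<dots> = 0" using k by (simp add: outer_def)
    finally show ?thesis using diffX[OF r, of k] by simp
  qed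

  define N where "N = (if odd p then p - 1 else p)"
  have dd: "diag (\<kappa> - \<kappa>0)" using d\<kappa> d\<kappa>0 by (simp add: diag_def)
  have oN: "ord_ge N (\<kappa> - \<kappa>0)"
    using ord_ge_diag_even[OF dd] ord\<kappa> assms(2) by (simp add: N_def \<kappa>0_def)
  have frequency: "\<bar>\<omega> \<iota> r - \<omega>0 \<iota> r\<bar> \<le> norm (\<kappa> - \<kappa>0) / \<rho> ^ N * \<bar>r\<bar> ^ N" if r: "r \<in> {0<..<\<rho>}" for r \<iota>
  proof -
    have "\<omega> \<iota> r - \<omega>0 \<iota> r = Re (mode (r / \<rho>) 0 (\<kappa> - \<kappa>0))"
      by (simp add: \<omega>_def \<omega>0_def mode_diff[OF scaled(3,4)[OF r]])
    then have "\<bar>\<omega> \<iota> r - \<omega>0 \<iota> r\<bar> \<le> norm (mode (r / \<rho>) 0 (\<kappa> - \<kappa>0))" using abs_Re_le_cmod by simp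
    also have "\<dots> \<le> (r / \<rho>) ^ max N (nat \<bar>0\<bar>) * norm (\<kappa> - \<kappa>0)" by (rule norm_mode_le[OF scaled(3,4)[OF r] oN])
    also have "\<dots> = norm (\<kappa> - \<kappa>0) / \<rho> ^ N * \<bar>r\<bar> ^ N" using r by (simp add: power_divide)
    finally show ?thesis .
  qed

  have analytic: "real_analytic_on (\<lambda>r. \<mu> + lam \<iota> + Re (mode (r / \<rho>) 0 K)) {0<..<s}" if "s \<le> \<rho>" for s \<iota> K
    using real_analytic_on_mode0[OF \<rho>(1), of "\<mu> + lam \<iota>" K] that unfolding real_analytic_on_def by auto

  show ?thesis
  proof (rule exI[of _ \<rho>], rule conjI[OF \<rho>(1)], rule exI[of _ "\<lambda>_ r. r"], rule exI[of _ \<omega>0], rule exI[of _ "\<lambda>_. u0"],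
      intro conjI ballI bexI[of _ "\<rho> / 2"])
    show "real_analytic_on (\<lambda>r. r) {0<..<\<rho>}"
      by (rule real_analytic_on_Re_holomorphic[of "\<lambda>z. z"]) (auto intro: holomorphic_intros)
    show "real_analytic_on (\<omega>0 \<iota>) {0<..<\<rho>}" for \<iota>
      unfolding \<omega>0_def[abs_def] by (rule analytic) simp
    show "\<exists>C. \<forall>r\<in>{0<..<\<rho>}. \<bar>r - r\<bar> \<le> C * \<bar>r\<bar> ^ 3" by (rule exI[of _ 0]) auto
    show "has_fourier_series \<gamma> (u0 r) (\<lambda>k. of_real (one_gap_coeff \<gamma> m0 r k))" if "r \<in> {0<..<\<rho>}" for r
      using that by (rule fourier0)
    show "\<forall>d. one_gap_solution \<gamma> (kp_sign \<iota>) (travelling_wave (u0 r) (\<omega>0 \<iota> r) m0 n0 d)" if "r \<in> {0<..<\<rho>}" for \<iota> r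
      using one_gap[OF that] by blast
    show "\<rho> / 2 \<in> {0<..<\<rho>}" using \<rho> by simp
    fix \<rho>' assume \<rho>': "\<rho>' \<in> {0<..\<rho> / 2}"
    note in_range = sub(1)[OF _ \<rho>']
    \<comment> \<open>For this width the weight is \<open>2\<^sup>|\<^sup>k\<^sup>|\<close>, while the squared coefficients decay like
      \<open>4\<^sup>-\<^sup>|\<^sup>k\<^sup>|\<close> for \<open>r \<le> \<rho>/2\<close>.\<close>
    let ?\<sigma> = "\<gamma> * ln 2 / (4 * pi)" and ?X = "multiplier dinv2 (H - cn_outer \<rho>)"
    show "\<exists>(\<omega> :: nat \<Rightarrow> real \<Rightarrow> real) (u :: nat \<Rightarrow> real \<Rightarrow> real \<Rightarrow> real)
         (uhat :: nat \<Rightarrow> real \<Rightarrow> int \<Rightarrow> complex). \<forall>\<iota>\<in>{1, 2}.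
         real_analytic_on (\<omega> \<iota>) {0<..<\<rho>'} \<and>
         (\<forall>r\<in>{0<..<\<rho>'}.
            has_fourier_series \<gamma> (u \<iota> r) (uhat \<iota> r) \<and>
            (\<forall>d. perturbed_kp_solution \<gamma> (kp_sign \<iota>) p R1 Q
                   (travelling_wave (u \<iota> r) (\<omega> \<iota> r) m0 n0 d))) \<and>
         (\<exists>\<sigma>>0. \<exists>C. \<forall>r\<in>{0<..<\<rho>'}.
            (\<lambda>k. (norm (uhat \<iota> r k - of_real (one_gap_coeff \<gamma> m0 r k)))\<^sup>2
                  * exp (4 * pi * \<sigma> / \<gamma> * of_int \<bar>k\<bar>)) summable_on {k. k \<noteq> 0 \<and> \<bar>k\<bar> \<noteq> 1} \<and>
            (\<Sum>\<^sub>\<infinity>k\<in>{k. k \<noteq> 0 \<and> \<bar>k\<bar> \<noteq> 1}.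
               (norm (uhat \<iota> r k - of_real (one_gap_coeff \<gamma> m0 r k)))\<^sup>2
                  * exp (4 * pi * \<sigma> / \<gamma> * of_int \<bar>k\<bar>)) \<le> C * \<bar>r\<bar> ^ (2 * p)) \<and>
         (\<forall>r\<in>{0<..<\<rho>'}.
            uhat \<iota> r 1 = of_real (one_gap_coeff \<gamma> m0 r 1) \<and>
            uhat \<iota> r (-1) = of_real (one_gap_coeff \<gamma> m0 r (-1))) \<and>
         (\<exists>C. \<forall>r\<in>{0<..<\<rho>'}.
            \<bar>\<omega> \<iota> r - \<omega>0 \<iota> r\<bar> \<le> C * \<bar>r\<bar> ^ (if odd p then p - 1 else p))"
      unfolding N_def[symmetric]
    proof (rule exI[of _ \<omega>], rule exI[of _ "\<lambda>_. u"], rule exI[of _ "\<lambda>_. uhat"], rule ballI, intro conjI,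
        rule_tac [3] exI[of _ ?\<sigma>], rule_tac [5] exI[of _ "norm (\<kappa> - \<kappa>0) / \<rho> ^ N"])
      fix \<iota> :: nat
      show "real_analytic_on (\<omega> \<iota>) {0<..<\<rho>'}"
        unfolding \<omega>_def[abs_def] by (rule analytic) (use \<rho>' \<rho> in auto)
      show "\<forall>r\<in>{0<..<\<rho>'}. has_fourier_series \<gamma> (u r) (uhat r) \<and>
          (\<forall>d. perturbed_kp_solution \<gamma> (kp_sign \<iota>) p R1 Q (travelling_wave (u r) (\<omega> \<iota> r) m0 n0 d))"
        using fourier perturbed in_range by blast
      show "\<forall>r\<in>{0<..<\<rho>'}. uhat r 1 = of_real (one_gap_coeff \<gamma> m0 r 1) \<and> uhat r (-1) = of_real (one_gap_coeff \<gamma> m0 r (-1))"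
        using pinned in_range by simp
      show "\<forall>r\<in>{0<..<\<rho>'}. \<bar>\<omega> \<iota> r - \<omega>0 \<iota> r\<bar> \<le> norm (\<kappa> - \<kappa>0) / \<rho> ^ N * \<bar>r\<bar> ^ N"
        using frequency in_range by blast
      let ?w = "\<lambda>r k. (norm (uhat r k - of_real (one_gap_coeff \<gamma> m0 r k)))\<^sup>2 * exp (4 * pi * ?\<sigma> / \<gamma> * of_int \<bar>k\<bar>)"
      have "?w r summable_on {k. k \<noteq> 0 \<and> \<bar>k\<bar> \<noteq> 1} \<and>
          (\<Sum>\<^sub>\<infinity>k\<in>{k. k \<noteq> 0 \<and> \<bar>k\<bar> \<noteq> 1}. ?w r k) \<le> (norm ?X * 2 ^ p / \<rho> ^ p)\<^sup>2 * (\<Sum>\<^sub>\<infinity>k::int. (1/2) ^ nat \<bar>k\<bar>) * \<bar>r\<bar> ^ (2 * p)"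
        if r: "r \<in> {0<..<\<rho>'}" for r
        using weighted_sum_estimate[OF sub(2,3)[OF r \<rho>'] \<rho>(1) ordX \<open>\<gamma> > 0\<close>, of "{k. k \<noteq> 0 \<and> \<bar>k\<bar> \<noteq> 1}"]
        unfolding diffX[OF in_range[OF r]] by (rule conjI)
      moreover have "?\<sigma> > 0" using \<open>\<gamma> > 0\<close> by simp
      ultimately show "?\<sigma> > 0 \<and> (\<exists>C. \<forall>r\<in>{0<..<\<rho>'}. ?w r summable_on {k. k \<noteq> 0 \<and> \<bar>k\<bar> \<noteq> 1} \<and>
          (\<Sum>\<^sub>\<infinity>k\<in>{k. k \<noteq> 0 \<and> \<bar>k\<bar> \<noteq> 1}. ?w r k) \<le> C * \<bar>r\<bar> ^ (2 * p))"
        by blast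
    qed
  qed
qed

end
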